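(* Let $A=\mathcal B(\mathrm{SL}_\theta(2,\mathbb H))\rtimes H_F$ be the cobosonised transformation algebra, let $\mathsf p$ be the basic instanton projection over $\mathcal A_r(S^4_\theta)$, and let $\widetilde{\mathsf P}:=\Delta_L(\mathsf p)\in \mathrm M_4(A\otimes\mathcal A_r(S^4_\theta))$ be its image (entrywise) under the coaction $\Delta_L$ of $A$. Then the family of Grassmann connections $\widetilde\nabla:=\widetilde{\mathsf P}\circ(\mathrm{id}\otimes \mathrm d)$ has anti-self-dual curvature, that is $$(\mathrm{id}\otimes *_\theta)\,\widetilde{\mathsf P}\big((\mathrm{id}\otimes \mathrm d)\widetilde{\mathsf P}\big)^2=-\widetilde{\mathsf P}\big((\mathrm{id}\otimes \mathrm d)\widetilde{\mathsf P}\big)^2 .$$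
   Context: **Torus and twist.** Fix $\theta\in\mathbb R$. $H=\mathcal A(\mathbb T^2)$ is the Hopf $*$-algebra of Laurent polynomials in commuting $t_1,t_2$, $t_j^*=t_j^{-1}$, with all monomials $t^a=t_1^{a_1}t_2^{a_2}$ group-like. $(\tau_1,\tau_2,\tau_3,\tau_4):=(t_1,t_1^*,t_2,t_2^* )$. $F(t^a,t^b)=\exp(\tfrac{i\pi\theta}{2}(a_1b_2-a_2b_1))$ is a bicharacter two-cocycle; $F^{-2}(g,h):=F(g,h)^{-2}$ on group-likes. $H_F$ equals $H$ as a Hopf $*$-algebra, with coquasitriangular structure $F^{-2}$. For a left comodule, $v$ is homogeneous of degree $|v|$ (a group-like) if its coaction is $v\mapsto|v|\otimes v$. The cotwist of a commutative $H$-comodule $*$-algebra is the same vector space (and $*$) with new product $a\cdot_F b=F(|a|,|b|)ab$ on homogeneous elements. **Spheres.** $\mathcal A(\mathbb C^4_\theta)$ is the cotwist of the commutative $*$-algebra generated by $z_j,z_j^*$ ($1\le j\le4$) with coaction $z_j\mapsto\tau_j\otimes z_j$. The element $r^2=\sum_j z_j^*z_j$ is central; an inverse $r^{-2}$ is adjoined and the result is written $\mathcal A_r(S^7_\theta)$. $\mathsf u=(\mathsf u_{ia})$ is the $4\times2$ matrix with rows $(z_1,-z_2^* ),(z_2,z_1^* ),(z_3,-z_4^* ),(z_4,z_3^* )$; $\mathsf u^*\mathsf u=r^2$. Put $\mathsf q=\mathsf u r^{-2}\mathsf u^*$, $\mathsf p=1-\mathsf q$. $\mathcal A_r(S^4_\theta)$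 is the $*$-subalgebra generated by $r^{\pm2}$ and the entries of $\mathsf u\mathsf u^*$ (the $\mathrm{SU}(2)$-invariants), regarded as a family of four-spheres parameterised by $r^2$. Its calculus is that of spheres of fixed radius ($\mathrm d r^2=0$): as a graded vector space with differential $\mathrm d$ it is the classical one, and only products of forms are cotwisted. The Hodge operator $*_\theta$ on two-forms is the classical Hodge operator of the round sphere under this identification, with orientation such that the basic instanton $\mathsf p\circ \mathrm d$ has anti-self-dual curvature $*_\theta(\mathsf p(\mathrm d\mathsf p)^2)=-\mathsf p(\mathrm d\mathsf p)^2$. **Braided groups.** $\mathcal A(\mathrm M(2,\mathbb H))$ is the commutative $*$-algebra generated by the entries of the $4\times 4$ matrix $A=(A_{ij})$ with rows $(a_1,-a_2^*,b_1,-b_2^* )$, $(a_2,a_1^*,b_2,b_1^* )$, $(c_1,-c_2^*,d_1,-d_2^* )$, $(c_2,c_1^*,d_2,d_1^* )$, with matrix coproduct and $H$-coaction $A_{ij}\mapsto\tau_i\tau_j^*\otimes A_{ij}$; $\mathcal A(\mathrm{SL}(2,\mathbb H))$ is its quotient by $\det A=1$. $\mathcal B(\mathrm{SL}_\theta(2,\mathbb H))$ is the cotwist of the latter, with product $\underline\cdot$ and generators $\widehat A_{ij}=F^{-1}(\tau_i,\tau_j)A_{ij}$. The cobosonisation $\mathcal B(\mathrm{SL}_\theta(2,\mathbb H))\rtimes H_F$ is, as an algebra, the vector space $\mathcal B(\mathrm{SL}_\theta(2,\mathbb H))\otimes H_F$ with $(a\otimes g)(b\otimes h)=F^{-2}(|b|,g)\,a\,\underline\cdot\,b\otimes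 gh$ and $(a\otimes h)^*=(1\otimes h^* )(a^*\otimes1)$ for homogeneous $a,b$ and group-like $g,h$. **Coaction.** $\Delta_L$ is the $*$-algebra map $\mathcal A_r(S^7_\theta)\to A\otimes\mathcal A_r(S^7_\theta)$, $\mathsf u_{ia}\mapsto\sum_\beta\widehat A_{i\beta}\otimes\tau_\beta\otimes\mathsf u_{\beta a}$; it restricts to $\mathcal A_r(S^4_\theta)$. An inverse $\rho^{-2}=\Delta_L(r^{-2})$ of $\rho^2=\Delta_L(r^2)$ is adjoined to the target algebra without change of notation. *)

theory Defs
  imports "HOL-Analysis.Analysis" "HOL-Library.Poly_Mapping"
begin

section \<open>Complex vector spaces and algebras\<close>


class complex_space = ab_group_add +
  fixes scaleC :: "complex \<Rightarrow> 'a \<Rightarrow> 'a" (infixr \<open>*\<^sub>C\<close> 75)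
  assumes scaleC_add_right: "c *\<^sub>C (x + y) = c *\<^sub>C x + c *\<^sub>C y"
    and scaleC_add_left: "(b + c) *\<^sub>C x = b *\<^sub>C x + c *\<^sub>C x"
    and scaleC_scaleC: "b *\<^sub>C c *\<^sub>C x = (b * c) *\<^sub>C x"
    and scaleC_one: "1 *\<^sub>C x = x"
begin

lemma scaleC_zero_right [simp]: "c *\<^sub>C 0 = 0"
  using scaleC_add_right[of c 0 0] by simp

lemma scaleC_zero_left [simp]: "0 *\<^sub>C x = 0"
  using scaleC_add_left[of 0 0 x] by simp

lemma scaleC_minus_right: "c *\<^sub>C (- x) = - (c *\<^sub>C x)"
  using scaleC_add_right[of c x "- x"] by (simp add: eq_neg_iff_add_eq_0 add.commute)

lemma scaleC_diff_right: "c *\<^sub>C (x - y) = c *\<^sub>C x - c *\<^sub>C y"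
  using scaleC_add_right[of c x "- y"] by (simp add: scaleC_minus_right)

lemma scaleC_sum_right: "c *\<^sub>C sum f A = (\<Sum>x\<in>A. c *\<^sub>C f x)"
  by (induction A rule: infinite_finite_induct) (auto simp: scaleC_add_right)

end

class complex_algebra_1 = ring_1 + complex_space +
  assumes scaleC_mult_left: "(c *\<^sub>C x) * y = c *\<^sub>C (x * y)"
    and scaleC_mult_right: "x * (c *\<^sub>C y) = c *\<^sub>C (x * y)"

instantiation complex :: complex_algebra_1
begin
definition "c *\<^sub>C (x::complex) = c * x"
instance by intro_classes (auto simp: scaleC_complex_def algebra_simps)
end

instantiation poly_mapping :: (type, complex_space) complex_space
begin
definition "c *\<^sub>C (f :: 'a \<Rightarrow>\<^sub>0 'b) = Poly_Mapping.map ((*\<^sub>C) c) f"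

lemma lookup_scaleC [simp]: "Poly_Mapping.lookup (c *\<^sub>C f) k = c *\<^sub>C Poly_Mapping.lookup (f :: 'a \<Rightarrow>\<^sub>0 'b) k"
  unfolding scaleC_poly_mapping_def by transfer (simp add: when_def)

instance
  by intro_classes
    (auto intro!: poly_mapping_eqI simp: lookup_add scaleC_add_right scaleC_add_left scaleC_scaleC scaleC_one)
end

instantiation vec :: (complex_space, finite) complex_space
begin
definition "c *\<^sub>C (x :: ('a, 'b) vec) = (\<chi> i. c *\<^sub>C x $ i)"
instance
  by intro_classes
    (auto simp: vec_eq_iff scaleC_vec_def scaleC_add_right scaleC_add_left scaleC_scaleC scaleC_one)
end

section \<open>Tensor product of complex vector spaces\<close>

inductive_set tensor_null :: "(('a::complex_space \<times> 'b::complex_space) \<Rightarrow>\<^sub>0 complex) set" where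
  zero: "0 \<in> tensor_null"
| diff: "f \<in> tensor_null \<Longrightarrow> g \<in> tensor_null \<Longrightarrow> f - g \<in> tensor_null"
| add_left: "Poly_Mapping.single (a + a', b) c - Poly_Mapping.single (a, b) c
    - Poly_Mapping.single (a', b) c \<in> tensor_null"
| add_right: "Poly_Mapping.single (a, b + b') c - Poly_Mapping.single (a, b) c
    - Poly_Mapping.single (a, b') c \<in> tensor_null"
| scale_left: "Poly_Mapping.single (k *\<^sub>C a, b) c - Poly_Mapping.single (a, b) (k * c) \<in> tensor_null"
| scale_right: "Poly_Mapping.single (a, k *\<^sub>C b) c - Poly_Mapping.single (a, b) (k * c) \<in> tensor_null"

lemma tensor_null_uminus: "f \<in> tensor_null \<Longrightarrow> - f \<in> tensor_null"
  using tensor_null.diff[OF tensor_null.zero] by simp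

lemma tensor_null_add: "f \<in> tensor_null \<Longrightarrow> g \<in> tensor_null \<Longrightarrow> f + g \<in> tensor_null"
  using tensor_null.diff[of f "- g"] tensor_null_uminus[of g] by simp

lemma scaleC_single: "k *\<^sub>C Poly_Mapping.single x c = Poly_Mapping.single x (k *\<^sub>C c)"
  by (rule poly_mapping_eqI) (auto simp: lookup_single when_def)

lemma tensor_null_scaleC: "f \<in> tensor_null \<Longrightarrow> k *\<^sub>C f \<in> tensor_null"
proof (induction rule: tensor_null.induct)
  case (scale_left j a b c)
  then show ?case using tensor_null.scale_left[of j a b "k * c"]
    by (simp add: scaleC_diff_right scaleC_single scaleC_complex_def mult.left_commute)
next
  case (scale_right a j b c)
  then show ?case using tensor_null.scale_right[of a j b "k * c"]
    by (simp add: scaleC_diff_right scaleC_single scaleC_complex_def mult.left_commute)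
qed (auto simp: scaleC_diff_right scaleC_single intro: tensor_null.intros)

quotient_type (overloaded) ('a, 'b) tensor = "('a::complex_space \<times> 'b::complex_space) \<Rightarrow>\<^sub>0 complex"
  / "\<lambda>f g. f - g \<in> tensor_null"
proof (rule equivpI)
  show "reflp (\<lambda>f g. f - g \<in> (tensor_null :: (('a \<times> 'b) \<Rightarrow>\<^sub>0 complex) set))"
    by (auto intro!: reflpI tensor_null.zero)
  show "symp (\<lambda>f g. f - g \<in> (tensor_null :: (('a \<times> 'b) \<Rightarrow>\<^sub>0 complex) set))"
  proof (rule sympI)
    fix f g :: "('a \<times> 'b) \<Rightarrow>\<^sub>0 complex"
    assume "f - g \<in> tensor_null"
    from tensor_null_uminus[OF this] show "g - f \<in> tensor_null" by simp
  qed
  show "transp (\<lambda>f g. f - g \<in> (tensor_null :: (('a \<times> 'b) \<Rightarrow>\<^sub>0 complex) set))"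
  proof (rule transpI)
    fix f g h :: "('a \<times> 'b) \<Rightarrow>\<^sub>0 complex"
    assume "f - g \<in> tensor_null" "g - h \<in> tensor_null"
    from tensor_null_add[OF this] show "f - h \<in> tensor_null" by simp
  qed
qed

instantiation tensor :: (complex_space, complex_space) complex_space
begin

lift_definition zero_tensor :: "('a, 'b) tensor" is 0 .
lift_definition plus_tensor :: "('a, 'b) tensor \<Rightarrow> ('a, 'b) tensor \<Rightarrow> ('a, 'b) tensor" is "(+)"
  subgoal premises prems for f f' g g'
    using tensor_null_add[OF prems] by (simp add: algebra_simps)
  done
lift_definition uminus_tensor :: "('a, 'b) tensor \<Rightarrow> ('a, 'b) tensor" is uminus
  subgoal premises prems for f f'
    using tensor_null_uminus[OF prems] by (simp add: algebra_simps)
  done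
lift_definition minus_tensor :: "('a, 'b) tensor \<Rightarrow> ('a, 'b) tensor \<Rightarrow> ('a, 'b) tensor" is "(-)"
  subgoal premises prems for f f' g g'
    using tensor_null.diff[OF prems] by (simp add: algebra_simps)
  done
lift_definition scaleC_tensor :: "complex \<Rightarrow> ('a, 'b) tensor \<Rightarrow> ('a, 'b) tensor" is scaleC
  subgoal premises prems for c f f'
    using tensor_null_scaleC[OF prems, of c] by (simp add: scaleC_diff_right)
  done

instance
proof
  fix x y z :: "('a, 'b) tensor" and b c :: complex
  note ind = tensor.abs_induct
  show "x + y + z = x + (y + z)"
    by (induct x rule: ind, induct y rule: ind, induct z rule: ind) (simp only: plus_tensor.abs_eq add.assoc)
  show "x + y = y + x"
    by (induct x rule: ind, induct y rule: ind) (simp only: plus_tensor.abs_eq add.commute)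
  show "0 + x = x"
    by (induct x rule: ind) (simp only: plus_tensor.abs_eq zero_tensor_def add_0_left)
  show "- x + x = 0"
    by (induct x rule: ind) (simp only: plus_tensor.abs_eq uminus_tensor.abs_eq zero_tensor_def ab_left_minus)
  show "x - y = x + - y"
    by (induct x rule: ind, induct y rule: ind)
      (simp only: plus_tensor.abs_eq uminus_tensor.abs_eq minus_tensor.abs_eq diff_conv_add_uminus)
  show "c *\<^sub>C (x + y) = c *\<^sub>C x + c *\<^sub>C y"
    by (induct x rule: ind, induct y rule: ind)
      (simp only: plus_tensor.abs_eq scaleC_tensor.abs_eq scaleC_add_right)
  show "(b + c) *\<^sub>C x = b *\<^sub>C x + c *\<^sub>C x"
    by (induct x rule: ind) (simp only: plus_tensor.abs_eq scaleC_tensor.abs_eq scaleC_add_left)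
  show "b *\<^sub>C c *\<^sub>C x = (b * c) *\<^sub>C x"
    by (induct x rule: ind) (simp only: scaleC_tensor.abs_eq scaleC_scaleC)
  show "1 *\<^sub>C x = x"
    by (induct x rule: ind) (simp only: scaleC_tensor.abs_eq scaleC_one)
qed

end

definition pure_tensor :: "'a::complex_space \<Rightarrow> 'b::complex_space \<Rightarrow> ('a, 'b) tensor" (infixr \<open>\<otimes>\<^sub>C\<close> 72)
  where "a \<otimes>\<^sub>C b = abs_tensor (Poly_Mapping.single (a, b) 1)"

lemma pure_tensor_add_left: "(a + a') \<otimes>\<^sub>C b = a \<otimes>\<^sub>C b + a' \<otimes>\<^sub>C b"
  unfolding pure_tensor_def plus_tensor.abs_eq tensor.abs_eq_iff
  using tensor_null.add_left[of a a' b 1] by (simp add: diff_diff_eq)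

lemma pure_tensor_add_right: "a \<otimes>\<^sub>C (b + b') = a \<otimes>\<^sub>C b + a \<otimes>\<^sub>C b'"
  unfolding pure_tensor_def plus_tensor.abs_eq tensor.abs_eq_iff
  using tensor_null.add_right[of a b b' 1] by (simp add: diff_diff_eq)

lemma pure_tensor_scaleC_left: "(c *\<^sub>C a) \<otimes>\<^sub>C b = c *\<^sub>C (a \<otimes>\<^sub>C b)"
  unfolding pure_tensor_def scaleC_tensor.abs_eq tensor.abs_eq_iff
  using tensor_null.scale_left[of c a b 1] by (simp add: scaleC_single scaleC_complex_def)

lemma pure_tensor_scaleC_right: "a \<otimes>\<^sub>C (c *\<^sub>C b) = c *\<^sub>C (a \<otimes>\<^sub>C b)"
  unfolding pure_tensor_def scaleC_tensor.abs_eq tensor.abs_eq_iff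
  using tensor_null.scale_right[of a c b 1] by (simp add: scaleC_single scaleC_complex_def)


section \<open>Polynomials with a torus weight\<close>

text \<open>
  The monomials \<open>t\<^sup>a\<close> of \<open>\<A>(\<T>\<^sup>2)\<close> are identified with their exponents
  \<open>a :: weight\<close>, so the product of group-likes is addition and \<open>*\<close> is negation.
\<close>

abbreviation monom_of :: "'v \<Rightarrow> 'v \<Rightarrow>\<^sub>0 nat"
  where "monom_of v \<equiv> Poly_Mapping.single v 1"

type_synonym weight = "int \<times> int"
type_synonym 'v cpoly = "('v \<Rightarrow>\<^sub>0 nat) \<Rightarrow>\<^sub>0 complex"

definition mono_weight :: "('v \<Rightarrow> weight) \<Rightarrow> ('v \<Rightarrow>\<^sub>0 nat) \<Rightarrow> weight"
  where "mono_weight w m = (\<Sum>v\<in>Poly_Mapping.keys m.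
    (int (Poly_Mapping.lookup m v) * fst (w v), int (Poly_Mapping.lookup m v) * snd (w v)))"

definition mono_conj :: "('v \<Rightarrow> 'v) \<Rightarrow> ('v \<Rightarrow>\<^sub>0 nat) \<Rightarrow> 'v \<Rightarrow>\<^sub>0 nat"
  where "mono_conj cj m = (\<Sum>v\<in>Poly_Mapping.keys m. Poly_Mapping.single (cj v) (Poly_Mapping.lookup m v))"

definition poly_comp :: "('v \<Rightarrow> weight) \<Rightarrow> weight \<Rightarrow> 'v cpoly \<Rightarrow> 'v cpoly"
  where "poly_comp w n f = (\<Sum>m\<in>Poly_Mapping.keys f.
    if mono_weight w m = n then Poly_Mapping.single m (Poly_Mapping.lookup f m) else 0)"

definition poly_star :: "('v \<Rightarrow> 'v) \<Rightarrow> 'v cpoly \<Rightarrow> 'v cpoly"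
  where "poly_star cj f = (\<Sum>m\<in>Poly_Mapping.keys f.
    Poly_Mapping.single (mono_conj cj m) (cnj (Poly_Mapping.lookup f m)))"

definition poly_der :: "('v \<Rightarrow> 'v cpoly) \<Rightarrow> 'v cpoly \<Rightarrow> 'v cpoly"
  where "poly_der D f = (\<Sum>m\<in>Poly_Mapping.keys f. \<Sum>v\<in>Poly_Mapping.keys m.
    Poly_Mapping.single (m - monom_of v) (of_nat (Poly_Mapping.lookup m v) * Poly_Mapping.lookup f m) * D v)"

lemma poly_sum_single: "(f :: 'b \<Rightarrow>\<^sub>0 'c::comm_monoid_add) = (\<Sum>m\<in>Poly_Mapping.keys f. Poly_Mapping.single m (Poly_Mapping.lookup f m))"
proof (rule poly_mapping_eqI)
  fix k
  have "(\<Sum>m\<in>Poly_Mapping.keys f. Poly_Mapping.lookup (Poly_Mapping.single m (Poly_Mapping.lookup f m)) k)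
      = (\<Sum>m\<in>Poly_Mapping.keys f. if k = m then Poly_Mapping.lookup f m else 0)"
    by (intro sum.cong) (auto simp: lookup_single when_def)
  then show "Poly_Mapping.lookup f k
      = Poly_Mapping.lookup (\<Sum>m\<in>Poly_Mapping.keys f. Poly_Mapping.single m (Poly_Mapping.lookup f m)) k"
    by (simp add: lookup_sum in_keys_iff)
qed

lemma poly_additive_induct [case_names single add]:
  assumes "\<And>m c. P (Poly_Mapping.single m c)" "\<And>f g. P f \<Longrightarrow> P g \<Longrightarrow> P (f + g)"
  shows "P (f :: 'b \<Rightarrow>\<^sub>0 'c::comm_monoid_add)"
proof -
  have "P (\<Sum>m\<in>A. Poly_Mapping.single m (Poly_Mapping.lookup f m))" if "finite A" for A
    using that
  proof (induction A)
    case empty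
    then show ?case using assms(1)[of _ 0] by simp
  qed (auto intro: assms)
  then show ?thesis by (subst poly_sum_single) auto
qed

lemma mono_weight_zero [simp]: "mono_weight w 0 = 0"
  by (simp add: mono_weight_def)

lemma mono_weight_add: "mono_weight w (m + n) = mono_weight w m + mono_weight w n"
  unfolding mono_weight_def
  by (rule setsum_keys_plus_distrib[where f = "\<lambda>v k. (int k * fst (w v), int k * snd (w v))"])
    (auto simp: algebra_simps zero_prod_def)

lemma mono_weight_single [simp]: "mono_weight w (monom_of v) = w v"
  by (simp add: mono_weight_def)

lemma mono_conj_zero [simp]: "mono_conj cj 0 = 0"
  by (simp add: mono_conj_def)

lemma mono_conj_add: "mono_conj cj (m + n) = mono_conj cj m + mono_conj cj n"
  unfolding mono_conj_def
  by (rule setsum_keys_plus_distrib[where f = "\<lambda>v k. Poly_Mapping.single (cj v) k"])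
    (auto simp: single_add)

lemma mono_conj_single [simp]: "mono_conj cj (Poly_Mapping.single v k) = Poly_Mapping.single (cj v) k"
  by (cases "k = 0") (auto simp: mono_conj_def)

lemma mono_conj_conj: "(\<And>v. cj (cj v) = v) \<Longrightarrow> mono_conj cj (mono_conj cj m) = m"
  by (induction m rule: poly_additive_induct) (auto simp: mono_conj_add)

lemma mono_weight_conj: "(\<And>v. w (cj v) = - w v) \<Longrightarrow> mono_weight w (mono_conj cj m) = - mono_weight w m"
proof (induction m rule: poly_additive_induct)
  case (single v k)
  then show ?case by (cases "k = 0") (auto simp: mono_weight_def)
qed (auto simp: mono_conj_add mono_weight_add)

lemma poly_comp_single: "poly_comp w n (Poly_Mapping.single m c) = (if mono_weight w m = n then Poly_Mapping.single m c else 0)"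
  by (cases "c = 0") (auto simp: poly_comp_def)

lemma poly_comp_add: "poly_comp w n (f + g) = poly_comp w n f + poly_comp w n g"
  unfolding poly_comp_def
  by (rule setsum_keys_plus_distrib[where f = "\<lambda>m c. if mono_weight w m = n then Poly_Mapping.single m c else 0"])
    (auto simp: single_add)

lemma poly_comp_zero [simp]: "poly_comp w n 0 = 0"
  by (simp add: poly_comp_def)

lemma poly_comp_uminus: "poly_comp w n (- f) = - poly_comp w n f"
  using poly_comp_add[of w n "-f" f] by (simp add: eq_neg_iff_add_eq_0)

lemma poly_comp_diff: "poly_comp w n (f - g) = poly_comp w n f - poly_comp w n g"
  using poly_comp_add[of w n f "-g"] by (simp add: poly_comp_uminus)

lemma poly_comp_sum: "poly_comp w n (sum f A) = (\<Sum>x\<in>A. poly_comp w n (f x))"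
  by (induction A rule: infinite_finite_induct) (auto simp: poly_comp_add)

lemma poly_comp_scaleC: "poly_comp w n (c *\<^sub>C f) = c *\<^sub>C poly_comp w n f"
  by (induction f rule: poly_additive_induct)
    (auto simp: poly_comp_add poly_comp_single scaleC_single scaleC_add_right)

lemma poly_comp_comp: "poly_comp w n (poly_comp w k f) = (if n = k then poly_comp w k f else 0)"
  by (induction f rule: poly_additive_induct) (auto simp: poly_comp_add poly_comp_single)

lemma lookup_poly_comp: "Poly_Mapping.lookup (poly_comp w n f) m = (if mono_weight w m = n then Poly_Mapping.lookup f m else 0)"
  by (induction f rule: poly_additive_induct) (auto simp: poly_comp_add poly_comp_single lookup_add lookup_single when_def)

lemma poly_comp_nonzero_subset: "{n. poly_comp w n f \<noteq> 0} \<subseteq> mono_weight w ` Poly_Mapping.keys f"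
proof
  fix n assume "n \<in> {n. poly_comp w n f \<noteq> 0}"
  then obtain m where "m \<in> Poly_Mapping.keys f" "mono_weight w m = n"
    unfolding poly_comp_def by (auto elim!: sum.not_neutral_contains_not_neutral split: if_splits)
  then show "n \<in> mono_weight w ` Poly_Mapping.keys f" by auto
qed

lemma poly_sum_comp:
  assumes "finite A" "mono_weight w ` Poly_Mapping.keys f \<subseteq> A"
  shows "(\<Sum>n\<in>A. poly_comp w n f) = f"
proof (rule poly_mapping_eqI)
  fix m
  have "(\<Sum>n\<in>A. Poly_Mapping.lookup (poly_comp w n f) m) = (\<Sum>n\<in>A. if n = mono_weight w m then Poly_Mapping.lookup f m else 0)"
    by (intro sum.cong) (auto simp: lookup_poly_comp)
  also have "\<dots> = Poly_Mapping.lookup f m"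
  proof (cases "mono_weight w m \<in> A")
    case False
    then have "m \<notin> Poly_Mapping.keys f" using assms(2) by auto
    then show ?thesis using False assms(1) by (simp add: in_keys_iff)
  qed (use assms(1) in simp)
  finally show "Poly_Mapping.lookup (\<Sum>n\<in>A. poly_comp w n f) m = Poly_Mapping.lookup f m"
    by (simp add: lookup_sum)
qed

lemma poly_comp_mult:
  assumes "\<And>m. m \<in> Poly_Mapping.keys g \<Longrightarrow> mono_weight w m = k"
  shows "poly_comp w n (f * g) = poly_comp w (n - k) f * g"
proof (induction f rule: poly_additive_induct)
  case (single a c)
  have "Poly_Mapping.single a c * g = (\<Sum>m\<in>Poly_Mapping.keys g. Poly_Mapping.single (a + m) (c * Poly_Mapping.lookup g m))"
    by (subst poly_sum_single[of g]) (simp add: sum_distrib_left mult_single)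
  moreover from this have "poly_comp w n (Poly_Mapping.single a c * g) = (\<Sum>m\<in>Poly_Mapping.keys g.
      if mono_weight w a + k = n then Poly_Mapping.single (a + m) (c * Poly_Mapping.lookup g m) else 0)"
    by (auto simp: poly_comp_sum poly_comp_single mono_weight_add assms intro!: sum.cong)
  ultimately show ?case
    by (auto simp: poly_comp_single algebra_simps)
qed (simp add: poly_comp_add algebra_simps)

lemma poly_star_single: "poly_star cj (Poly_Mapping.single m c) = Poly_Mapping.single (mono_conj cj m) (cnj c)"
  by (cases "c = 0") (auto simp: poly_star_def)

lemma poly_star_add: "poly_star cj (f + g) = poly_star cj f + poly_star cj g"
  unfolding poly_star_def
  by (rule setsum_keys_plus_distrib[where f = "\<lambda>m c. Poly_Mapping.single (mono_conj cj m) (cnj c)"])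
    (auto simp: single_add)

lemma poly_star_uminus: "poly_star cj (- f) = - poly_star cj f"
  using poly_star_add[of cj "-f" f] by (simp add: eq_neg_iff_add_eq_0 poly_star_def)

lemma poly_star_diff: "poly_star cj (f - g) = poly_star cj f - poly_star cj g"
  using poly_star_add[of cj f "-g"] by (simp add: poly_star_uminus)

lemma poly_star_mult: "poly_star cj (f * g) = poly_star cj f * poly_star cj g"
proof (induction f rule: poly_additive_induct)
  case (single a c)
  then show ?case
    by (induction g rule: poly_additive_induct)
      (auto simp: poly_star_single poly_star_add mult_single mono_conj_add algebra_simps)
qed (auto simp: poly_star_add algebra_simps)

lemma poly_star_one [simp]: "poly_star cj 1 = 1"
  using poly_star_single[of cj 0 1] by simp

lemma poly_star_scaleC: "poly_star cj (c *\<^sub>C f) = cnj c *\<^sub>C poly_star cj f"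
  by (induction f rule: poly_additive_induct)
    (auto simp: poly_star_add poly_star_single scaleC_single scaleC_add_right scaleC_complex_def)

lemma poly_star_star: "(\<And>v. cj (cj v) = v) \<Longrightarrow> poly_star cj (poly_star cj f) = f"
  by (induction f rule: poly_additive_induct) (auto simp: poly_star_add poly_star_single mono_conj_conj)

lemma poly_der_single: "poly_der D (Poly_Mapping.single m c) = (\<Sum>v\<in>Poly_Mapping.keys m.
    Poly_Mapping.single (m - monom_of v) (of_nat (Poly_Mapping.lookup m v) * c) * D v)"
  by (cases "c = 0") (auto simp: poly_der_def)

lemma poly_der_add: "poly_der D (f + g) = poly_der D f + poly_der D g"
  unfolding poly_der_def
  by (rule setsum_keys_plus_distrib[where f = "\<lambda>m c. \<Sum>v\<in>Poly_Mapping.keys m.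
    Poly_Mapping.single (m - monom_of v) (of_nat (Poly_Mapping.lookup m v) * c) * D v"])
    (auto simp: single_add algebra_simps sum.distrib)

lemma poly_der_uminus: "poly_der D (- f) = - poly_der D f"
  using poly_der_add[of D "-f" f] by (simp add: eq_neg_iff_add_eq_0 poly_der_def)

lemma poly_der_diff: "poly_der D (f - g) = poly_der D f - poly_der D g"
  using poly_der_add[of D f "-g"] by (simp add: poly_der_uminus)

lemma poly_der_gen [simp]: "poly_der D (Poly_Mapping.single (monom_of v) 1) = D v"
  by (simp add: poly_der_single)

lemma poly_der_mult: "poly_der D (f * g) = poly_der D f * g + f * poly_der D g"
proof (induction f rule: poly_additive_induct)
  case (single a c)
  show ?case
  proof (induction g rule: poly_additive_induct)
    case (single b d)
    let ?K = "Poly_Mapping.keys a \<union> Poly_Mapping.keys b"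
    let ?l = "Poly_Mapping.lookup"
    have ext: "poly_der D (Poly_Mapping.single m e) = (\<Sum>v\<in>?K.
        Poly_Mapping.single (m - monom_of v) (of_nat (?l m v) * e) * D v)"
      if "Poly_Mapping.keys m \<subseteq> ?K" for m e
      unfolding poly_der_single using that
      by (intro sum.mono_neutral_left) (auto simp: in_keys_iff)
    have split: "Poly_Mapping.single (a + b - monom_of v) (of_nat (?l (a + b) v) * (c * d))
      = Poly_Mapping.single (a - monom_of v) (of_nat (?l a v) * c) * Poly_Mapping.single b d
        + Poly_Mapping.single a c * Poly_Mapping.single (b - monom_of v) (of_nat (?l b v) * d)" for v
    proof -
      have 1: "b + (a - monom_of v) = a + b - monom_of v" if "?l a v \<noteq> 0"
        using that by (intro poly_mapping_eqI) (auto simp: lookup_add lookup_minus lookup_single when_def)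
      have 2: "a + (b - monom_of v) = a + b - monom_of v" if "?l b v \<noteq> 0"
        using that by (intro poly_mapping_eqI) (auto simp: lookup_add lookup_minus lookup_single when_def)
      show ?thesis
        by (cases "?l a v = 0"; cases "?l b v = 0")
          (auto simp: mult_single 1 2 lookup_add algebra_simps single_add simp del: One_nat_def)
    qed
    let ?A = "\<lambda>v. Poly_Mapping.single (a - monom_of v) (of_nat (?l a v) * c)"
    let ?B = "\<lambda>v. Poly_Mapping.single (b - monom_of v) (of_nat (?l b v) * d)"
    have "poly_der D (Poly_Mapping.single a c * Poly_Mapping.single b d)
        = (\<Sum>v\<in>?K. Poly_Mapping.single (a + b - monom_of v) (of_nat (?l (a + b) v) * (c * d)) * D v)"
      by (simp only: mult_single ext[OF keys_add])
    also have "\<dots> = (\<Sum>v\<in>?K. ?A v * D v) * Poly_Mapping.single b d + Poly_Mapping.single a c * (\<Sum>v\<in>?K. ?B v * D v)"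
      unfolding split
      by (simp only: distrib_right sum.distrib sum_distrib_left sum_distrib_right mult.assoc
          mult.commute[of "Poly_Mapping.single b d"])
    finally show ?case by (simp only: ext[OF Un_upper1] ext[OF Un_upper2])
  qed (simp add: poly_der_add algebra_simps)
qed (simp add: poly_der_add algebra_simps)

lemma poly_der_scaleC: "poly_der D (c *\<^sub>C f) = c *\<^sub>C poly_der D f"
proof -
  have eq: "c *\<^sub>C h = Poly_Mapping.single 0 c * h" for h :: "'a cpoly"
    by (induction h rule: poly_additive_induct)
      (auto simp: scaleC_single mult_single scaleC_add_right algebra_simps scaleC_complex_def)
  show ?thesis by (simp add: eq poly_der_mult poly_der_single)
qed


section \<open>Comodules over the torus\<close>

text \<open>
  A coaction of the group algebra of \<open>weight\<close> is a grading;
  \<open>hcomp n x\<close> is the component of \<open>x\<close> of degree \<open>n\<close>.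
\<close>

class h_comodule = complex_space +
  fixes hcomp :: "weight \<Rightarrow> 'a \<Rightarrow> 'a"
  assumes hcomp_add: "hcomp n (x + y) = hcomp n x + hcomp n y"
    and hcomp_scaleC: "hcomp n (c *\<^sub>C x) = c *\<^sub>C hcomp n x"
    and hcomp_hcomp: "hcomp m (hcomp n x) = (if m = n then hcomp n x else 0)"
    and finite_hcomp: "finite {n. hcomp n x \<noteq> 0}"
    and sum_hcomp: "(\<Sum>n | hcomp n x \<noteq> 0. hcomp n x) = x"

section \<open>Coordinate algebras with one invariant relation\<close>

text \<open>
  The type \<open>'v\<close> of variables is closed under \<open>*\<close>, so \<open>'v cpoly\<close> is the commutative
  \<open>*\<close>-algebra they generate.  Imposing \<open>gen_relator = 0\<close> yields both
  \<open>\<A>(SL(2,\<H>))\<close> (relator \<open>det A - 1\<close>) and \<open>\<A>(\<C>\<^sup>4)\<close> with \<open>r\<^sup>-\<^sup>2\<close> adjoined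
  (relator \<open>r\<^sup>-\<^sup>2 r\<^sup>2 - 1\<close>).
\<close>

class presented_generators =
  fixes gen_conj :: "'a \<Rightarrow> 'a"
    and gen_weight :: "'a \<Rightarrow> weight"
    and gen_relator :: "'a cpoly"
  assumes gen_conj_conj: "gen_conj (gen_conj v) = v"
    and gen_weight_conj: "gen_weight (gen_conj v) = - gen_weight v"
    and gen_relator_weight: "m \<in> Poly_Mapping.keys gen_relator \<Longrightarrow> mono_weight gen_weight m = 0"
    and gen_relator_star: "poly_star gen_conj gen_relator = gen_relator"

lemma dvd_diff_swap: "(d :: 'a::comm_ring_1) dvd f - g \<Longrightarrow> d dvd g - f"
  using dvd_minus_iff[of d "f - g"] by simp

quotient_type (overloaded) 'v coord_alg = "'v::presented_generators cpoly"
  / "\<lambda>f g. gen_relator dvd f - g"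
proof (rule equivpI)
  show "reflp (\<lambda>f g. gen_relator dvd f - (g :: 'v cpoly))"
    by (rule reflpI) simp
  show "symp (\<lambda>f g. gen_relator dvd f - (g :: 'v cpoly))"
    by (rule sympI) (rule dvd_diff_swap)
  show "transp (\<lambda>f g. gen_relator dvd f - (g :: 'v cpoly))"
  proof (rule transpI)
    fix f g h :: "'v cpoly"
    assume "gen_relator dvd f - g" "gen_relator dvd g - h"
    from dvd_add[OF this] show "gen_relator dvd f - h" by simp
  qed
qed

lemma dvd_scaleC:
  fixes f g :: "'v cpoly"
  assumes "f dvd g" shows "f dvd c *\<^sub>C g"
proof -
  have "c *\<^sub>C h = Poly_Mapping.single 0 c * h" for h :: "'v cpoly"
    by (induction h rule: poly_additive_induct)
      (auto simp: scaleC_single mult_single scaleC_add_right algebra_simps scaleC_complex_def)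
  then show ?thesis using assms by simp
qed

instantiation coord_alg :: (presented_generators) "{comm_ring, comm_monoid_mult, complex_space}"
begin

lift_definition zero_coord_alg :: "'a coord_alg" is 0 .
lift_definition one_coord_alg :: "'a coord_alg" is 1 .
lift_definition plus_coord_alg :: "'a coord_alg \<Rightarrow> 'a coord_alg \<Rightarrow> 'a coord_alg" is "(+)"
  subgoal premises prems for f f' g g'
    using dvd_add[OF prems] by (simp add: algebra_simps)
  done
lift_definition uminus_coord_alg :: "'a coord_alg \<Rightarrow> 'a coord_alg" is uminus
  subgoal premises prems for f f'
    using dvd_diff_swap[OF prems] by simp
  done
lift_definition minus_coord_alg :: "'a coord_alg \<Rightarrow> 'a coord_alg \<Rightarrow> 'a coord_alg" is "(-)"
  subgoal premises prems for f f' g g'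
    using dvd_diff[OF prems] by (simp add: algebra_simps)
  done
lift_definition times_coord_alg :: "'a coord_alg \<Rightarrow> 'a coord_alg \<Rightarrow> 'a coord_alg" is "(*)"
  subgoal premises prems for f f' g g'
    using dvd_add[OF dvd_mult2[OF prems(1), of g] dvd_mult[OF prems(2), of f']]
    by (simp add: algebra_simps)
  done
lift_definition scaleC_coord_alg :: "complex \<Rightarrow> 'a coord_alg \<Rightarrow> 'a coord_alg" is scaleC
  by (metis scaleC_diff_right dvd_scaleC)
instance
proof
  fix x y z :: "'a coord_alg" and b c :: complex and m n :: weight
  note ind = coord_alg.abs_induct
  note abs_eqs = plus_coord_alg.abs_eq uminus_coord_alg.abs_eq minus_coord_alg.abs_eq
    times_coord_alg.abs_eq scaleC_coord_alg.abs_eq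
    zero_coord_alg_def one_coord_alg_def
  show "x * y * z = x * (y * z)"
    by (induct x rule: ind, induct y rule: ind, induct z rule: ind) (simp only: abs_eqs mult.assoc)
  show "x * y = y * x"
    by (induct x rule: ind, induct y rule: ind) (simp only: abs_eqs mult.commute)
  show "1 * x = x"
    by (induct x rule: ind) (simp only: abs_eqs mult_1_left)
  show "x + y + z = x + (y + z)"
    by (induct x rule: ind, induct y rule: ind, induct z rule: ind) (simp only: abs_eqs add.assoc)
  show "x + y = y + x"
    by (induct x rule: ind, induct y rule: ind) (simp only: abs_eqs add.commute)
  show "0 + x = x"
    by (induct x rule: ind) (simp only: abs_eqs add_0_left)
  show "- x + x = 0"
    by (induct x rule: ind) (simp only: abs_eqs ab_left_minus)
  show "x - y = x + - y"
    by (induct x rule: ind, induct y rule: ind) (simp only: abs_eqs diff_conv_add_uminus)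
  show "(x + y) * z = x * z + y * z"
    by (induct x rule: ind, induct y rule: ind, induct z rule: ind) (simp only: abs_eqs distrib_right)
  show "c *\<^sub>C (x + y) = c *\<^sub>C x + c *\<^sub>C y"
    by (induct x rule: ind, induct y rule: ind) (simp only: abs_eqs scaleC_add_right)
  show "(b + c) *\<^sub>C x = b *\<^sub>C x + c *\<^sub>C x"
    by (induct x rule: ind) (simp only: abs_eqs scaleC_add_left)
  show "b *\<^sub>C c *\<^sub>C x = (b * c) *\<^sub>C x"
    by (induct x rule: ind) (simp only: abs_eqs scaleC_scaleC)
  show "1 *\<^sub>C x = x"
    by (induct x rule: ind) (simp only: abs_eqs scaleC_one)
qed

end

instantiation coord_alg :: (presented_generators) h_comodule
begin

lift_definition hcomp_coord_alg :: "weight \<Rightarrow> 'a coord_alg \<Rightarrow> 'a coord_alg" is "poly_comp gen_weight"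
proof -
  fix n :: weight and f g :: "'a cpoly"
  assume "gen_relator dvd f - g"
  then obtain h where h: "f - g = h * gen_relator" by (metis dvd_def mult.commute)
  have "poly_comp gen_weight n f - poly_comp gen_weight n g = poly_comp gen_weight n (h * gen_relator)"
    by (simp add: h[symmetric] poly_comp_diff)
  also have "\<dots> = poly_comp gen_weight n h * gen_relator"
    by (subst poly_comp_mult[where k = 0]) (auto simp: gen_relator_weight)
  finally show "gen_relator dvd poly_comp gen_weight n f - poly_comp gen_weight n g" by simp
qed

instance
proof
  fix x y :: "'a coord_alg" and c :: complex and m n :: weight
  note ind = coord_alg.abs_induct
  note abs_eqs = plus_coord_alg.abs_eq scaleC_coord_alg.abs_eq hcomp_coord_alg.abs_eq zero_coord_alg_def
  show "hcomp n (x + y) = hcomp n x + hcomp n y"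
    by (induct x rule: ind, induct y rule: ind) (simp only: abs_eqs poly_comp_add)
  show "hcomp n (c *\<^sub>C x) = c *\<^sub>C hcomp n x"
    by (induct x rule: ind) (simp only: abs_eqs poly_comp_scaleC)
  show "hcomp m (hcomp n x) = (if m = n then hcomp n x else 0)"
    by (induct x rule: ind) (simp add: abs_eqs poly_comp_comp)
  obtain f where f: "x = abs_coord_alg f" by (induct x rule: ind) auto
  let ?W = "mono_weight gen_weight ` Poly_Mapping.keys f"
  have sub: "{n. hcomp n x \<noteq> 0} \<subseteq> ?W"
    using poly_comp_nonzero_subset[of gen_weight f]
    by (auto simp: f hcomp_coord_alg.abs_eq zero_coord_alg_def)
  then show "finite {n. hcomp n x \<noteq> 0}"
    by (rule finite_subset) simp
  have abs_sum: "abs_coord_alg (sum g A) = (\<Sum>n\<in>A. abs_coord_alg (g n))" for g :: "weight \<Rightarrow> 'a cpoly" and A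
    by (induction A rule: infinite_finite_induct)
      (auto simp: zero_coord_alg_def plus_coord_alg.abs_eq[symmetric])
  have "(\<Sum>n | hcomp n x \<noteq> 0. hcomp n x) = (\<Sum>n\<in>?W. hcomp n x)"
    using sub by (intro sum.mono_neutral_left) auto
  also have "\<dots> = abs_coord_alg (\<Sum>n\<in>?W. poly_comp gen_weight n f)"
    by (simp add: f hcomp_coord_alg.abs_eq abs_sum)
  also have "\<dots> = x"
    by (subst poly_sum_comp) (auto simp: f)
  finally show "(\<Sum>n | hcomp n x \<noteq> 0. hcomp n x) = x" .
qed

end

lift_definition alg_star :: "'v::presented_generators coord_alg \<Rightarrow> 'v coord_alg" is "poly_star gen_conj"
proof -
  fix f g :: "'v cpoly"
  assume "gen_relator dvd f - g"
  then obtain h where h: "f - g = gen_relator * h" by (metis dvd_def)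
  have "poly_star gen_conj f - poly_star gen_conj g = gen_relator * poly_star gen_conj h"
    by (simp add: h poly_star_diff[symmetric] poly_star_mult gen_relator_star)
  then show "gen_relator dvd poly_star gen_conj f - poly_star gen_conj g" by simp
qed

abbreviation poly_gen :: "'v \<Rightarrow> 'v cpoly"
  where "poly_gen v \<equiv> Poly_Mapping.single (monom_of v) 1"

lift_definition gen :: "'v::presented_generators \<Rightarrow> 'v coord_alg" is poly_gen .

lemma alg_star_gen: "alg_star (gen v) = gen (gen_conj v)"
  by (simp add: gen_def alg_star.abs_eq poly_star_single)

definition homog :: "('v \<Rightarrow> weight) \<Rightarrow> weight \<Rightarrow> 'v cpoly \<Rightarrow> bool"
  where "homog w k f \<longleftrightarrow> (\<forall>m\<in>Poly_Mapping.keys f. mono_weight w m = k)"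

lemma homog_add: "homog w k f \<Longrightarrow> homog w k g \<Longrightarrow> homog w k (f + g)"
  using keys_add[of f g] by (auto simp: homog_def)

lemma homog_uminus: "homog w k f \<Longrightarrow> homog w k (- f)"
  by (auto simp: homog_def in_keys_iff)

lemma homog_diff: "homog w k f \<Longrightarrow> homog w k g \<Longrightarrow> homog w k (f - g)"
  using homog_add[of w k f "- g"] by (simp add: homog_uminus)

lemma homog_mult: "homog w k f \<Longrightarrow> homog w l g \<Longrightarrow> homog w (k + l) (f * g)"
  using keys_mult[of f g] by (force simp: homog_def mono_weight_add)

lemma homog_zero: "homog w k 0"
  by (simp add: homog_def)

lemma homog_one: "homog w 0 1"
  by (simp add: homog_def)

lemma homog_gen: "homog w (w v) (poly_gen v)"
  by (simp add: homog_def del: One_nat_def)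

lemma homog_sum: "(\<And>x. x \<in> A \<Longrightarrow> homog w k (f x)) \<Longrightarrow> homog w k (sum f A)"
  by (induction A rule: infinite_finite_induct) (auto intro: homog_add homog_zero)

lemma homog_prod: "(\<And>x. x \<in> A \<Longrightarrow> homog w (k x) (f x)) \<Longrightarrow> homog w (sum k A) (prod f A)"
  by (induction A rule: infinite_finite_induct) (auto intro: homog_mult homog_one)

section \<open>The relators\<close>

text \<open>\<open>\<tau> = (t\<^sub>1, t\<^sub>1\<^sup>*, t\<^sub>2, t\<^sub>2\<^sup>*)\<close>; the index \<open>4 :: 4\<close> is written \<open>0\<close> by the library.\<close>

definition tau_weight :: "4 \<Rightarrow> weight"
  where "tau_weight i = (if i = 1 then (1, 0) else if i = 2 then (-1, 0) else if i = 3 then (0, 1) else (0, -1))"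

datatype quat_entry = Qa1 | Qa2 | Qb1 | Qb2 | Qc1 | Qc2 | Qd1 | Qd2
datatype mat_var = Entry quat_entry | EntryConj quat_entry

text \<open>The weight of the \<open>(i, j)\<close> entry of \<open>A\<close> is \<open>\<tau>\<^sub>i \<tau>\<^sub>j\<^sup>*\<close>; see \<open>poly_mat_homog\<close> below.\<close>

primrec entry_weight :: "quat_entry \<Rightarrow> weight" where
  "entry_weight Qa1 = tau_weight 1 - tau_weight 1"
| "entry_weight Qa2 = tau_weight 2 - tau_weight 1"
| "entry_weight Qb1 = tau_weight 1 - tau_weight 3"
| "entry_weight Qb2 = tau_weight 2 - tau_weight 3"
| "entry_weight Qc1 = tau_weight 3 - tau_weight 1"
| "entry_weight Qc2 = tau_weight 4 - tau_weight 1"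
| "entry_weight Qd1 = tau_weight 3 - tau_weight 3"
| "entry_weight Qd2 = tau_weight 4 - tau_weight 3"

primrec mat_conj :: "mat_var \<Rightarrow> mat_var" where
  "mat_conj (Entry e) = EntryConj e"
| "mat_conj (EntryConj e) = Entry e"

primrec mat_weight :: "mat_var \<Rightarrow> weight" where
  "mat_weight (Entry e) = entry_weight e"
| "mat_weight (EntryConj e) = - entry_weight e"

definition poly_mat :: "mat_var cpoly^4^4"
  where "poly_mat = (let x = (\<lambda>e. poly_gen (Entry e)); xs = (\<lambda>e. poly_gen (EntryConj e)) in
    vector [vector [x Qa1, - xs Qa2, x Qb1, - xs Qb2],
            vector [x Qa2,   xs Qa1, x Qb2,   xs Qb1],
            vector [x Qc1, - xs Qc2, x Qd1, - xs Qd2],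
            vector [x Qc2,   xs Qc1, x Qd2,   xs Qd1]])"

lemma vector_4: "(vector [a,b,c,d] :: ('a::zero)^4) $ 1 = a" "(vector [a,b,c,d] :: ('a::zero)^4) $ 2 = b"
  "(vector [a,b,c,d] :: ('a::zero)^4) $ 3 = c" "(vector [a,b,c,d] :: ('a::zero)^4) $ 4 = d"
  by (simp_all add: vector_def)

lemma poly_mat_homog: "homog mat_weight (tau_weight i - tau_weight j) (poly_mat $ i $ j)"
proof -
  have g: "homog mat_weight k (poly_gen v)" if "k = mat_weight v" for k v
    using homog_gen[of mat_weight v] that by simp
  have "\<forall>i j. homog mat_weight (tau_weight i - tau_weight j) (poly_mat $ i $ j)"
    unfolding forall_4 poly_mat_def Let_def vector_4
    by (intro conjI; (intro homog_uminus)?; rule g; simp add: tau_weight_def)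
  then show ?thesis by blast
qed

definition det_relator :: "mat_var cpoly"
  where "det_relator = det poly_mat - 1"

lemma det_homog: "homog mat_weight 0 (det poly_mat)"
proof -
  have "homog mat_weight 0 (of_int (sign p) * (\<Prod>i\<in>UNIV. poly_mat $ i $ p i))" if "p permutes UNIV" for p
  proof -
    have "homog mat_weight (\<Sum>i\<in>UNIV. tau_weight i - tau_weight (p i)) (\<Prod>i\<in>UNIV. poly_mat $ i $ p i)"
      by (intro homog_prod poly_mat_homog)
    moreover have "(\<Sum>i\<in>UNIV. tau_weight i - tau_weight (p i)) = 0"
      using sum.permute[OF that, of tau_weight] by (simp add: sum_subtractf o_def)
    ultimately show ?thesis
      by (cases p rule: sign_cases) (auto intro: homog_uminus)
  qed
  then show ?thesis unfolding det_def by (intro homog_sum) auto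
qed

lemma det_star: "poly_star mat_conj (det poly_mat) = det poly_mat"
proof -
  define J :: "mat_var cpoly^4^4" where "J = vector [vector [0, -1, 0, 0], vector [1, 0, 0, 0],
    vector [0, 0, 0, -1], vector [0, 0, 1, 0]]"
  have s: "poly_star mat_conj (- f) = - poly_star mat_conj f" for f by (rule poly_star_uminus)
  have "map_matrix (poly_star mat_conj) poly_mat = J ** poly_mat ** transpose J"
    by (simp add: vec_eq_iff forall_4 matrix_matrix_mult_def sum_4 transpose_def J_def poly_mat_def Let_def
        vector_4 s poly_star_single)
  moreover have "J ** transpose J = mat 1"
    by (simp add: vec_eq_iff forall_4 matrix_matrix_mult_def sum_4 transpose_def J_def vector_4 mat_def)
  then have "det J * det (transpose J) = 1" by (metis det_I det_mul)
  ultimately have "det (map_matrix (poly_star mat_conj) poly_mat) = det poly_mat"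
    by (simp add: det_mul algebra_simps)
  moreover have "poly_star mat_conj (det M) = det (map_matrix (poly_star mat_conj) M)" for M :: "mat_var cpoly^4^4"
  proof -
    have sum: "poly_star mat_conj (sum f A) = (\<Sum>x\<in>A. poly_star mat_conj (f x))" for f :: "(4 \<Rightarrow> 4) \<Rightarrow> _" and A
      by (induction A rule: infinite_finite_induct) (auto simp: poly_star_add, simp_all add: poly_star_def)
    have prod: "poly_star mat_conj (prod f A) = (\<Prod>x\<in>A. poly_star mat_conj (f x))" for f :: "4 \<Rightarrow> _" and A
      by (induction A rule: infinite_finite_induct) (auto simp: poly_star_mult)
    have sgn: "poly_star mat_conj (of_int (sign p)) = of_int (sign p)" for p :: "4 \<Rightarrow> 4"
      by (cases p rule: sign_cases) (auto simp: s)
    show ?thesis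
      by (simp add: det_def sum prod sgn poly_star_mult)
  qed
  ultimately show ?thesis by simp
qed

instantiation mat_var :: presented_generators
begin
definition "gen_conj = mat_conj"
definition "gen_weight = mat_weight"
definition "gen_relator = det_relator"
instance
proof
  fix v :: mat_var and m
  show "gen_conj (gen_conj v) = v" by (cases v) (auto simp: gen_conj_mat_var_def)
  show "gen_weight (gen_conj v) = - gen_weight v"
    by (cases v) (auto simp: gen_conj_mat_var_def gen_weight_mat_var_def)
  have "homog mat_weight 0 det_relator"
    unfolding det_relator_def by (intro homog_diff det_homog homog_one)
  then show "m \<in> Poly_Mapping.keys (gen_relator :: mat_var cpoly) \<Longrightarrow> mono_weight gen_weight m = 0"
    by (auto simp: homog_def gen_relator_mat_var_def gen_weight_mat_var_def)
  show "poly_star gen_conj (gen_relator :: mat_var cpoly) = gen_relator"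
    by (simp add: gen_relator_mat_var_def gen_conj_mat_var_def det_relator_def poly_star_diff det_star)
qed
end

datatype sphere_var = Zvar 4 | Zbar 4 | Rinv

primrec sphere_conj :: "sphere_var \<Rightarrow> sphere_var" where
  "sphere_conj (Zvar j) = Zbar j"
| "sphere_conj (Zbar j) = Zvar j"
| "sphere_conj Rinv = Rinv"

primrec sphere_weight :: "sphere_var \<Rightarrow> weight" where
  "sphere_weight (Zvar j) = tau_weight j"
| "sphere_weight (Zbar j) = - tau_weight j"
| "sphere_weight Rinv = 0"

definition poly_r2 :: "sphere_var cpoly"
  where "poly_r2 = (\<Sum>j\<in>UNIV. poly_gen (Zbar j) * poly_gen (Zvar j))"

instantiation sphere_var :: presented_generators
begin
definition "gen_conj = sphere_conj"
definition "gen_weight = sphere_weight"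
definition "gen_relator = poly_gen Rinv * poly_r2 - 1"
instance
proof
  fix v :: sphere_var and m
  show "gen_conj (gen_conj v) = v" by (cases v) (auto simp: gen_conj_sphere_var_def)
  show "gen_weight (gen_conj v) = - gen_weight v"
    by (cases v) (auto simp: gen_conj_sphere_var_def gen_weight_sphere_var_def)
  have 1: "homog sphere_weight 0 (poly_gen (Zbar j) * poly_gen (Zvar j))" for j
    using homog_mult[OF homog_gen[of sphere_weight "Zbar j"] homog_gen[of sphere_weight "Zvar j"]] by simp
  have 2: "homog sphere_weight 0 poly_r2"
    unfolding poly_r2_def by (intro homog_sum 1)
  have "homog sphere_weight 0 (gen_relator :: sphere_var cpoly)"
    unfolding gen_relator_sphere_var_def
    using homog_mult[OF homog_gen[of sphere_weight Rinv] 2] by (intro homog_diff homog_one) simp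
  then show "m \<in> Poly_Mapping.keys (gen_relator :: sphere_var cpoly) \<Longrightarrow> mono_weight gen_weight m = 0"
    by (auto simp: homog_def gen_weight_sphere_var_def)
  show "poly_star gen_conj (gen_relator :: sphere_var cpoly) = gen_relator"
    by (simp add: gen_relator_sphere_var_def gen_conj_sphere_var_def poly_star_diff poly_star_mult
        poly_star_single poly_r2_def sum_4 poly_star_add mult.commute)
qed
end


section \<open>Differential forms on the spheres\<close>

text \<open>\<open>(j, False)\<close> stands for the coordinate \<open>z\<^sub>j\<close> and \<open>(j, True)\<close> for \<open>z\<^sub>j\<^sup>*\<close>.\<close>

type_synonym sphere_alg = "sphere_var coord_alg"
type_synonym dvar = "4 \<times> bool"

primrec coord_var :: "dvar \<Rightarrow> sphere_var" where
  "coord_var (j, b) = (if b then Zbar j else Zvar j)"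

primrec conj_coord_var :: "dvar \<Rightarrow> sphere_var" where
  "conj_coord_var (j, b) = (if b then Zvar j else Zbar j)"

definition partial_gen :: "dvar \<Rightarrow> sphere_var \<Rightarrow> sphere_var cpoly"
  where "partial_gen v x = (if x = coord_var v then 1
    else if x = Rinv then - (poly_gen Rinv * poly_gen Rinv * poly_gen (conj_coord_var v)) else 0)"

lemma partial_gen_Rinv: "partial_gen v Rinv = - (poly_gen Rinv * poly_gen Rinv * poly_gen (conj_coord_var v))"
  by (cases v) (auto simp: partial_gen_def)

lemma poly_der_sum: "poly_der D (sum f A) = (\<Sum>x\<in>A. poly_der D (f x))"
proof (induction A rule: infinite_finite_induct)
  case (insert x F)
  then show ?case by (simp add: poly_der_add)
qed (simp_all add: poly_der_def)

lemma poly_der_r2: "poly_der (partial_gen v) poly_r2 = poly_gen (conj_coord_var v)"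
proof -
  obtain i b where v: "v = (i, b)" by (cases v)
  have "poly_der (partial_gen v) poly_r2 = (\<Sum>j\<in>UNIV. poly_der (partial_gen v) (poly_gen (Zbar j) * poly_gen (Zvar j)))"
    unfolding poly_r2_def by (rule poly_der_sum)
  also have "\<dots> = (\<Sum>j\<in>UNIV. if j = i then poly_gen (conj_coord_var v) else 0)"
    by (intro sum.cong) (auto simp: poly_der_mult partial_gen_def v simp del: One_nat_def)
  finally show ?thesis by simp
qed

lift_definition partial_deriv :: "dvar \<Rightarrow> sphere_alg \<Rightarrow> sphere_alg" is "\<lambda>v. poly_der (partial_gen v)"
proof -
  fix v :: dvar and f g :: "sphere_var cpoly"
  let ?d = "poly_der (partial_gen v)" and ?e = "gen_relator :: sphere_var cpoly"
  assume "?e dvd f - g"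
  then obtain h where h: "f - g = ?e * h" by (metis dvd_def)
  have "?d ?e = ?e * - (poly_gen Rinv * poly_gen (conj_coord_var v))"
    using poly_der_single[of "partial_gen v" 0 1]
    by (simp add: gen_relator_sphere_var_def poly_der_diff poly_der_mult poly_der_r2 poly_der_gen[unfolded One_nat_def]
        partial_gen_Rinv algebra_simps)
  then have "?e dvd ?d (?e * h)" by (simp add: poly_der_mult)
  then show "?e dvd ?d f - ?d g" by (simp add: poly_der_diff[symmetric] h)
qed

text \<open>
  A form \<open>\<Sum>\<^sub>S x\<^sub>S dx\<^sub>S\<close>, with \<open>dx\<^sub>S\<close> the product of the \<open>dv\<close>, \<open>v \<in> S\<close>, in increasing
  order, is stored as the family of its coefficients \<open>x\<^sub>S\<close>.
\<close>

type_synonym raw_form = "(sphere_alg, dvar set) vec"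

definition dvar_less :: "dvar \<Rightarrow> dvar \<Rightarrow> bool"
  where "dvar_less v w \<longleftrightarrow> fst v < fst w \<or> fst v = fst w \<and> snd v < snd w"

definition inversions :: "dvar set \<Rightarrow> dvar set \<Rightarrow> nat"
  where "inversions S T = card {(v, w). v \<in> S \<and> w \<in> T \<and> dvar_less w v}"

definition wedge_sign :: "dvar set \<Rightarrow> dvar set \<Rightarrow> complex"
  where "wedge_sign S T = (-1) ^ inversions S T"

definition wedge :: "raw_form \<Rightarrow> raw_form \<Rightarrow> raw_form"
  where "wedge x y = (\<chi> U. \<Sum>S\<in>Pow U. wedge_sign S (U - S) *\<^sub>C (x $ S * y $ (U - S)))"

definition raw_function :: "sphere_alg \<Rightarrow> raw_form"
  where "raw_function f = (\<chi> S. if S = {} then f else 0)"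

definition raw_one_form :: "(dvar \<Rightarrow> sphere_alg) \<Rightarrow> raw_form"
  where "raw_one_form c = (\<chi> S. \<Sum>v\<in>UNIV. if S = {v} then c v else 0)"

definition raw_dr2 :: raw_form
  where "raw_dr2 = raw_one_form (\<lambda>v. gen (conj_coord_var v))"

definition dvar_weight :: "dvar \<Rightarrow> weight"
  where "dvar_weight v = gen_weight (coord_var v)"

definition raw_comp :: "weight \<Rightarrow> raw_form \<Rightarrow> raw_form"
  where "raw_comp n x = (\<chi> S. hcomp (n - sum dvar_weight S) (x $ S))"

lemma coord_scaleC_mult_left: "(c *\<^sub>C x) * y = c *\<^sub>C (x * (y :: 'v::presented_generators coord_alg))"
proof -
  have eq: "c *\<^sub>C h = Poly_Mapping.single 0 c * h" for h :: "'v cpoly"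
    by (induction h rule: poly_additive_induct)
      (auto simp: scaleC_single mult_single scaleC_add_right algebra_simps scaleC_complex_def)
  show ?thesis
    by (induct x rule: coord_alg.abs_induct, induct y rule: coord_alg.abs_induct)
      (simp only: scaleC_coord_alg.abs_eq times_coord_alg.abs_eq eq mult.assoc)
qed

lemma coord_scaleC_mult_right: "x * (c *\<^sub>C y) = c *\<^sub>C (x * (y :: 'v::presented_generators coord_alg))"
  using coord_scaleC_mult_left[of c y x] by (simp add: mult.commute)

lemma inversions_Un_left:
  assumes "A \<inter> B = {}" shows "inversions (A \<union> B) C = inversions A C + inversions B C"
proof -
  have "{(v, w). v \<in> A \<union> B \<and> w \<in> C \<and> dvar_less w v}
    = {(v, w). v \<in> A \<and> w \<in> C \<and> dvar_less w v} \<union> {(v, w). v \<in> B \<and> w \<in> C \<and> dvar_less w v}" by auto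
  then show ?thesis unfolding inversions_def
    using assms by (subst card_Un_disjoint[symmetric]) auto
qed

lemma inversions_Un_right:
  assumes "B \<inter> C = {}" shows "inversions A (B \<union> C) = inversions A B + inversions A C"
proof -
  have "{(v, w). v \<in> A \<and> w \<in> B \<union> C \<and> dvar_less w v}
    = {(v, w). v \<in> A \<and> w \<in> B \<and> dvar_less w v} \<union> {(v, w). v \<in> A \<and> w \<in> C \<and> dvar_less w v}" by auto
  then show ?thesis unfolding inversions_def
    using assms by (subst card_Un_disjoint[symmetric]) auto
qed

lemma wedge_sign_assoc:
  assumes "A \<inter> B = {}" "A \<inter> C = {}" "B \<inter> C = {}"
  shows "wedge_sign (A \<union> B) C * wedge_sign A B = wedge_sign A (B \<union> C) * wedge_sign B C"
  using assms by (simp add: wedge_sign_def inversions_Un_left inversions_Un_right power_add)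

lemma wedge_add_left: "wedge (x + y) z = wedge x z + wedge y z"
  by (simp add: wedge_def vec_eq_iff algebra_simps scaleC_add_right sum.distrib)

lemma wedge_add_right: "wedge x (y + z) = wedge x y + wedge x z"
  by (simp add: wedge_def vec_eq_iff algebra_simps scaleC_add_right sum.distrib)

lemma wedge_zero_left [simp]: "wedge 0 x = 0"
  using wedge_add_left[of 0 0 x] by simp

lemma wedge_zero_right [simp]: "wedge x 0 = 0"
  using wedge_add_right[of x 0 0] by simp

lemma wedge_uminus_left: "wedge (- x) y = - wedge x y"
  using wedge_add_left[of "-x" x y] by (simp add: eq_neg_iff_add_eq_0)

lemma wedge_uminus_right: "wedge x (- y) = - wedge x y"
  using wedge_add_right[of x "-y" y] by (simp add: eq_neg_iff_add_eq_0)

lemma wedge_diff_left: "wedge (x - y) z = wedge x z - wedge y z"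
  using wedge_add_left[of x "-y" z] by (simp add: wedge_uminus_left)

lemma wedge_diff_right: "wedge x (y - z) = wedge x y - wedge x z"
  using wedge_add_right[of x y "-z"] by (simp add: wedge_uminus_right)

lemma wedge_scaleC_left: "wedge (c *\<^sub>C x) y = c *\<^sub>C wedge x y"
  by (simp add: wedge_def vec_eq_iff scaleC_vec_def coord_scaleC_mult_left scaleC_sum_right scaleC_scaleC mult.commute)

lemma wedge_scaleC_right: "wedge x (c *\<^sub>C y) = c *\<^sub>C wedge x y"
  by (simp add: wedge_def vec_eq_iff scaleC_vec_def coord_scaleC_mult_right scaleC_sum_right scaleC_scaleC mult.commute)

lemma wedge_assoc: "wedge (wedge x y) z = wedge x (wedge y z)"
proof -
  have "wedge (wedge x y) z $ U = wedge x (wedge y z) $ U" for U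
  proof -
    let ?l = "\<lambda>(T, S). (wedge_sign T (U - T) * wedge_sign S (T - S)) *\<^sub>C (x $ S * y $ (T - S) * z $ (U - T))"
    let ?r = "\<lambda>(S, R). (wedge_sign S (U - S) * wedge_sign R (U - S - R)) *\<^sub>C (x $ S * y $ R * z $ (U - S - R))"
    have "wedge (wedge x y) z $ U = (\<Sum>T\<in>Pow U. \<Sum>S\<in>Pow T. ?l (T, S))"
      by (simp add: wedge_def sum_distrib_right scaleC_sum_right scaleC_scaleC coord_scaleC_mult_left)
    also have "\<dots> = sum ?l (Sigma (Pow U) Pow)"
      by (subst sum.Sigma) (auto intro: finite)
    also have "\<dots> = sum ?r (Sigma (Pow U) (\<lambda>S. Pow (U - S)))"
    proof (rule sum.reindex_bij_witness[where i = "\<lambda>(S, R). (S \<union> R, S)" and j = "\<lambda>(T, S). (S, T - S)"])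
      fix p assume "p \<in> Sigma (Pow U) Pow"
      then obtain T S where p: "p = (T, S)" "T \<subseteq> U" "S \<subseteq> T" by auto
      have e: "S \<union> (T - S) = T" "(T - S) \<union> (U - T) = U - S" "U - S - (T - S) = U - T" using p by auto
      have "wedge_sign T (U - T) * wedge_sign S (T - S) = wedge_sign S (U - S) * wedge_sign (T - S) (U - T)"
        using wedge_sign_assoc[of S "T - S" "U - T"] p e by auto
      then show "?r (case p of (T, S) \<Rightarrow> (S, T - S)) = ?l p" using e by (simp add: p)
    qed auto
    also have "\<dots> = (\<Sum>S\<in>Pow U. \<Sum>R\<in>Pow (U - S). ?r (S, R))"
      by (subst sum.Sigma) (auto intro: finite)
    also have "\<dots> = wedge x (wedge y z) $ U"
      by (simp add: wedge_def sum_distrib_left scaleC_sum_right scaleC_scaleC coord_scaleC_mult_right mult.assoc)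
    finally show ?thesis .
  qed
  then show ?thesis by (simp add: vec_eq_iff)
qed

lemma inversions_empty [simp]: "inversions {} S = 0" "inversions S {} = 0"
  by (simp_all add: inversions_def)

lemma wedge_one_left: "wedge (raw_function 1) x = x"
proof -
  have "wedge (raw_function 1) x $ U = x $ U" for U
  proof -
    have "wedge (raw_function 1) x $ U = (\<Sum>S\<in>Pow U. if S = {} then x $ U else 0)"
      unfolding wedge_def raw_function_def
      by (intro vec_lambda_beta[THEN trans] sum.cong) (auto simp: wedge_sign_def scaleC_one)
    then show ?thesis by (simp add: finite)
  qed
  then show ?thesis by (simp add: vec_eq_iff)
qed

lemma wedge_one_right: "wedge x (raw_function 1) = x"
proof -
  have "wedge x (raw_function 1) $ U = x $ U" for U
  proof -
    have "wedge x (raw_function 1) $ U = (\<Sum>S\<in>Pow U. if S = U then x $ U else 0)"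
      unfolding wedge_def raw_function_def
      by (intro vec_lambda_beta[THEN trans] sum.cong) (auto simp: wedge_sign_def scaleC_one mult.commute)
    then show ?thesis by (simp add: finite)
  qed
  then show ?thesis by (simp add: vec_eq_iff)
qed

lemma raw_one_form_nth: "raw_one_form c $ {v} = c v" "(\<And>v. S \<noteq> {v}) \<Longrightarrow> raw_one_form c $ S = 0"
  by (simp_all add: raw_one_form_def)

lemma wedge_one_form_left:
  "wedge (raw_one_form c) x $ U = (\<Sum>v\<in>U. wedge_sign {v} (U - {v}) *\<^sub>C (c v * x $ (U - {v})))"
proof -
  have "wedge (raw_one_form c) x $ U
      = (\<Sum>S\<in>(\<lambda>v. {v}) ` U. wedge_sign S (U - S) *\<^sub>C (raw_one_form c $ S * x $ (U - S)))"
    unfolding wedge_def vec_lambda_beta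
  proof (intro sum.mono_neutral_right ballI)
    fix S assume "S \<in> Pow U - (\<lambda>v. {v}) ` U"
    then have "S \<noteq> {v}" for v by auto
    then show "wedge_sign S (U - S) *\<^sub>C (raw_one_form c $ S * x $ (U - S)) = 0"
      by (simp add: raw_one_form_nth(2))
  qed (auto simp: finite)
  then show ?thesis by (simp add: sum.reindex raw_one_form_nth)
qed

lemma wedge_one_form_right:
  "wedge x (raw_one_form c) $ U = (\<Sum>v\<in>U. wedge_sign (U - {v}) {v} *\<^sub>C (x $ (U - {v}) * c v))"
proof -
  have "wedge x (raw_one_form c) $ U
      = (\<Sum>S\<in>(\<lambda>v. U - {v}) ` U. wedge_sign S (U - S) *\<^sub>C (x $ S * raw_one_form c $ (U - S)))"
    unfolding wedge_def vec_lambda_beta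
  proof (intro sum.mono_neutral_right ballI)
    fix S assume S: "S \<in> Pow U - (\<lambda>v. U - {v}) ` U"
    have "U - S \<noteq> {v}" for v
    proof
      assume "U - S = {v}"
      then have "S = U - {v}" "v \<in> U" using S by auto
      then show False using S by auto
    qed
    then show "wedge_sign S (U - S) *\<^sub>C (x $ S * raw_one_form c $ (U - S)) = 0"
      by (simp add: raw_one_form_nth(2))
  qed (auto simp: finite)
  also have "\<dots> = (\<Sum>v\<in>U. wedge_sign (U - {v}) (U - (U - {v})) *\<^sub>C (x $ (U - {v}) * raw_one_form c $ (U - (U - {v}))))"
    by (subst sum.reindex) (auto simp: inj_on_def)
  also have "\<dots> = (\<Sum>v\<in>U. wedge_sign (U - {v}) {v} *\<^sub>C (x $ (U - {v}) * c v))"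
  proof (intro sum.cong refl)
    fix v assume "v \<in> U"
    then have "U - (U - {v}) = {v}" by auto
    then show "wedge_sign (U - {v}) (U - (U - {v})) *\<^sub>C (x $ (U - {v}) * raw_one_form c $ (U - (U - {v})))
      = wedge_sign (U - {v}) {v} *\<^sub>C (x $ (U - {v}) * c v)" by (simp add: raw_one_form_nth)
  qed
  finally show ?thesis .
qed

lemma dvar_less_total: "v \<noteq> w \<Longrightarrow> dvar_less v w \<or> dvar_less w v"
  by (cases v; cases w) (auto simp: dvar_less_def)

lemma wedge_sign_swap:
  assumes "v \<notin> T" shows "wedge_sign {v} T = (-1) ^ card T * wedge_sign T {v}"
proof -
  have 1: "inversions {v} T = card {w \<in> T. dvar_less w v}"
    unfolding inversions_def by (rule bij_betw_same_card[of snd]) (auto simp: bij_betw_def inj_on_def image_iff)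
  have 2: "inversions T {v} = card {w \<in> T. dvar_less v w}"
    unfolding inversions_def by (rule bij_betw_same_card[of fst]) (auto simp: bij_betw_def inj_on_def image_iff)
  let ?A = "{w \<in> T. dvar_less w v}" and ?B = "{w \<in> T. dvar_less v w}"
  have "T \<subseteq> ?A \<union> ?B"
  proof
    fix w assume "w \<in> T"
    then show "w \<in> ?A \<union> ?B" using assms dvar_less_total[of v w] by (cases "v = w") auto
  qed
  then have T: "?A \<union> ?B = T" by auto
  have "?A \<inter> ?B = {}" by (auto simp: dvar_less_def)
  then have "card (?A \<union> ?B) = card ?A + card ?B" by (intro card_Un_disjoint) auto
  then have c: "card T = inversions {v} T + inversions T {v}" unfolding 1 2 T .
  have "(-1 :: complex) ^ k * (-1) ^ k = 1" for k :: nat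
    by (simp add: power_mult_distrib[symmetric])
  then show ?thesis unfolding wedge_sign_def c power_add by (simp add: mult.assoc)
qed

definition raw_parity :: "raw_form \<Rightarrow> raw_form"
  where "raw_parity x = (\<chi> S. (-1) ^ card S *\<^sub>C x $ S)"

lemma wedge_one_form_commute: "wedge (raw_one_form c) x = wedge (raw_parity x) (raw_one_form c)"
  by (auto simp: vec_eq_iff wedge_one_form_left wedge_one_form_right raw_parity_def wedge_sign_swap
      coord_scaleC_mult_left coord_scaleC_mult_right scaleC_scaleC mult.commute intro!: sum.cong)

lemma hcomp_mult_homog:
  fixes x y :: "'v::presented_generators coord_alg"
  assumes "hcomp k y = y"
  shows "hcomp n (x * y) = hcomp (n - k) x * y"
proof -
  obtain f where f: "x = abs_coord_alg f" by (induct x rule: coord_alg.abs_induct) auto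
  obtain g where g: "y = abs_coord_alg g" by (induct y rule: coord_alg.abs_induct) auto
  let ?g = "poly_comp gen_weight k g"
  have y: "y = abs_coord_alg ?g" using assms by (simp add: g hcomp_coord_alg.abs_eq)
  have "mono_weight gen_weight m = k" if "m \<in> Poly_Mapping.keys ?g" for m
    using that by (auto simp: in_keys_iff lookup_poly_comp split: if_splits)
  then have "poly_comp gen_weight n (f * ?g) = poly_comp gen_weight (n - k) f * ?g"
    by (intro poly_comp_mult)
  then show ?thesis by (simp add: y f times_coord_alg.abs_eq hcomp_coord_alg.abs_eq)
qed

lemma hcomp_gen: "hcomp (gen_weight v) (gen v) = gen v"
  by (simp add: gen_def hcomp_coord_alg.abs_eq poly_comp_single del: One_nat_def)

lemma h_comodule_simps:
  fixes x y :: "'a::h_comodule"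
  shows "hcomp n (0::'a) = 0" "hcomp n (- x) = - hcomp n x" "hcomp n (x - y) = hcomp n x - hcomp n y"
proof -
  show 0: "hcomp n (0::'a) = 0" using hcomp_add[of n "0::'a" 0] by simp
  show 1: "hcomp n (- x) = - hcomp n x" for x :: 'a
    using hcomp_add[of n "- x" x] 0 by (simp add: eq_neg_iff_add_eq_0)
  show "hcomp n (x - y) = hcomp n x - hcomp n y"
    using hcomp_add[of n x "- y"] 1[of y] by simp
qed

lemma hcomp_sum: "hcomp n (sum f A) = (\<Sum>x\<in>A. hcomp n (f x :: 'a::h_comodule))"
  by (induction A rule: infinite_finite_induct) (auto simp: hcomp_add h_comodule_simps)

lemma raw_comp_dr2: "raw_comp n (wedge x raw_dr2) = wedge (raw_comp n x) raw_dr2"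
proof -
  have "raw_comp n (wedge x raw_dr2) $ U = wedge (raw_comp n x) raw_dr2 $ U" for U
  proof -
    have "hcomp (n - sum dvar_weight U) (x $ (U - {v}) * gen (conj_coord_var v))
        = hcomp (n - sum dvar_weight (U - {v})) (x $ (U - {v})) * gen (conj_coord_var v)" if "v \<in> U" for v
    proof -
      have "gen_weight (conj_coord_var v) = - dvar_weight v"
        by (cases v) (auto simp: dvar_weight_def gen_weight_sphere_var_def)
      moreover have "sum dvar_weight U = dvar_weight v + sum dvar_weight (U - {v})"
        using that by (simp add: sum.remove finite)
      ultimately show ?thesis
        by (subst hcomp_mult_homog[OF hcomp_gen]) (simp add: algebra_simps)
    qed
    then show ?thesis
      by (simp add: raw_comp_def raw_dr2_def wedge_one_form_right hcomp_sum hcomp_scaleC)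
  qed
  then show ?thesis by (simp add: vec_eq_iff)
qed

text \<open>
  Forms on the family of spheres of fixed radius: the relation \<open>d r\<^sup>2 = 0\<close> is imposed.
  The forms on the four-spheres are those generated by functions in \<open>\<A>\<^sub>r(S\<^sup>4)\<close> and their
  differentials (pull-back along the Hopf fibration is injective).
\<close>

quotient_type forms = raw_form / "\<lambda>x y. \<exists>g. x - y = wedge g raw_dr2"
proof (rule equivpI)
  show "reflp (\<lambda>x y. \<exists>g. x - y = wedge g raw_dr2)"
    by (rule reflpI) (auto intro!: exI[of _ 0])
  show "symp (\<lambda>x y. \<exists>g. x - y = wedge g raw_dr2)"
  proof (rule sympI)
    fix x y :: raw_form
    assume "\<exists>g. x - y = wedge g raw_dr2"
    then obtain g where "x - y = wedge g raw_dr2" by blast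
    then have "- (x - y) = wedge (- g) raw_dr2" by (simp only: wedge_uminus_left)
    then have "y - x = wedge (- g) raw_dr2" by (simp only: minus_diff_eq)
    then show "\<exists>g. y - x = wedge g raw_dr2" by blast
  qed
  show "transp (\<lambda>x y. \<exists>g. x - y = wedge g raw_dr2)"
  proof (rule transpI)
    fix x y z :: raw_form
    assume "\<exists>g. x - y = wedge g raw_dr2" "\<exists>g. y - z = wedge g raw_dr2"
    then obtain g h where "x - y = wedge g raw_dr2" "y - z = wedge h raw_dr2" by blast
    then have "(x - y) + (y - z) = wedge (g + h) raw_dr2" by (simp only: wedge_add_left)
    then have "x - z = wedge (g + h) raw_dr2" by simp
    then show "\<exists>g. x - z = wedge g raw_dr2" by blast
  qed
qed

instantiation forms :: "{ring, monoid_mult, complex_space}"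
begin

lift_definition zero_forms :: forms is 0 .
lift_definition one_forms :: forms is "raw_function 1" .
lift_definition plus_forms :: "forms \<Rightarrow> forms \<Rightarrow> forms" is "(+)"
proof -
  fix x x' y y' :: raw_form
  assume "\<exists>g. x - x' = wedge g raw_dr2" "\<exists>g. y - y' = wedge g raw_dr2"
  then obtain g h where "x - x' = wedge g raw_dr2" "y - y' = wedge h raw_dr2" by blast
  then have "x + y - (x' + y') = wedge (g + h) raw_dr2"
    by (simp add: wedge_add_left add_diff_add)
  then show "\<exists>g. x + y - (x' + y') = wedge g raw_dr2" by blast
qed
lift_definition uminus_forms :: "forms \<Rightarrow> forms" is uminus
proof -
  fix x x' :: raw_form
  assume "\<exists>g. x - x' = wedge g raw_dr2"
  then obtain g where "x - x' = wedge g raw_dr2" by blast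
  then have "- x - - x' = wedge (- g) raw_dr2" by (simp only: minus_diff_minus wedge_uminus_left)
  then show "\<exists>g. - x - - x' = wedge g raw_dr2" by blast
qed
lift_definition minus_forms :: "forms \<Rightarrow> forms \<Rightarrow> forms" is "(-)"
proof -
  fix x x' y y' :: raw_form
  assume "\<exists>g. x - x' = wedge g raw_dr2" "\<exists>g. y - y' = wedge g raw_dr2"
  then obtain g h where "x - x' = wedge g raw_dr2" "y - y' = wedge h raw_dr2" by blast
  moreover have "x - y - (x' - y') = (x - x') - (y - y')" by (simp add: algebra_simps)
  ultimately have "x - y - (x' - y') = wedge (g - h) raw_dr2" by (simp only: wedge_diff_left)
  then show "\<exists>g. x - y - (x' - y') = wedge g raw_dr2" by blast
qed
lift_definition scaleC_forms :: "complex \<Rightarrow> forms \<Rightarrow> forms" is scaleC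
proof -
  fix c and x x' :: raw_form
  assume "\<exists>g. x - x' = wedge g raw_dr2"
  then obtain g where "x - x' = wedge g raw_dr2" by blast
  then have "c *\<^sub>C x - c *\<^sub>C x' = wedge (c *\<^sub>C g) raw_dr2"
    by (simp only: scaleC_diff_right[symmetric] wedge_scaleC_left)
  then show "\<exists>g. c *\<^sub>C x - c *\<^sub>C x' = wedge g raw_dr2" by blast
qed
lift_definition times_forms :: "forms \<Rightarrow> forms \<Rightarrow> forms" is wedge
proof -
  fix x x' y y' :: raw_form
  assume "\<exists>g. x - x' = wedge g raw_dr2" "\<exists>g. y - y' = wedge g raw_dr2"
  then obtain g h where gh: "x - x' = wedge g raw_dr2" "y - y' = wedge h raw_dr2" by blast
  have "wedge x y - wedge x' y' = wedge (x - x') y + wedge x' (y - y')"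
    by (simp add: wedge_diff_left wedge_diff_right)
  also have "\<dots> = wedge (wedge g (raw_parity y) + wedge x' h) raw_dr2"
    unfolding gh by (simp add: wedge_assoc wedge_add_left raw_dr2_def wedge_one_form_commute[symmetric])
  finally show "\<exists>g. wedge x y - wedge x' y' = wedge g raw_dr2" by blast
qed

instance
proof
  fix x y z :: forms and b c :: complex
  note ind = forms.abs_induct
  note abs_eqs = plus_forms.abs_eq uminus_forms.abs_eq minus_forms.abs_eq
    times_forms.abs_eq scaleC_forms.abs_eq zero_forms_def one_forms_def
  show "x * y * z = x * (y * z)"
    by (induct x rule: ind, induct y rule: ind, induct z rule: ind) (simp only: abs_eqs wedge_assoc)
  show "1 * x = x"
    by (induct x rule: ind) (simp only: abs_eqs wedge_one_left)
  show "x * 1 = x"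
    by (induct x rule: ind) (simp only: abs_eqs wedge_one_right)
  show "x + y + z = x + (y + z)"
    by (induct x rule: ind, induct y rule: ind, induct z rule: ind) (simp only: abs_eqs add.assoc)
  show "x + y = y + x"
    by (induct x rule: ind, induct y rule: ind) (simp only: abs_eqs add.commute)
  show "0 + x = x"
    by (induct x rule: ind) (simp only: abs_eqs add_0_left)
  show "- x + x = 0"
    by (induct x rule: ind) (simp only: abs_eqs ab_left_minus)
  show "x - y = x + - y"
    by (induct x rule: ind, induct y rule: ind) (simp only: abs_eqs diff_conv_add_uminus)
  show "(x + y) * z = x * z + y * z"
    by (induct x rule: ind, induct y rule: ind, induct z rule: ind) (simp only: abs_eqs wedge_add_left)
  show "x * (y + z) = x * y + x * z"
    by (induct x rule: ind, induct y rule: ind, induct z rule: ind) (simp only: abs_eqs wedge_add_right)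
  show "c *\<^sub>C (x + y) = c *\<^sub>C x + c *\<^sub>C y"
    by (induct x rule: ind, induct y rule: ind) (simp only: abs_eqs scaleC_add_right)
  show "(b + c) *\<^sub>C x = b *\<^sub>C x + c *\<^sub>C x"
    by (induct x rule: ind) (simp only: abs_eqs scaleC_add_left)
  show "b *\<^sub>C c *\<^sub>C x = (b * c) *\<^sub>C x"
    by (induct x rule: ind) (simp only: abs_eqs scaleC_scaleC)
  show "1 *\<^sub>C x = x"
    by (induct x rule: ind) (simp only: abs_eqs scaleC_one)
qed

end

instantiation forms :: h_comodule
begin

lift_definition hcomp_forms :: "weight \<Rightarrow> forms \<Rightarrow> forms" is raw_comp
proof -
  fix n and x y :: raw_form
  assume "\<exists>g. x - y = wedge g raw_dr2"
  then obtain g where "x - y = wedge g raw_dr2" by blast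
  moreover have "raw_comp n x - raw_comp n y = raw_comp n (x - y)"
    by (simp add: raw_comp_def vec_eq_iff h_comodule_simps)
  ultimately have "raw_comp n x - raw_comp n y = wedge (raw_comp n g) raw_dr2"
    by (simp add: raw_comp_dr2)
  then show "\<exists>g. raw_comp n x - raw_comp n y = wedge g raw_dr2" by blast
qed

instance
proof
  fix x y :: forms and c :: complex and m n :: weight
  note ind = forms.abs_induct
  note abs_eqs = plus_forms.abs_eq scaleC_forms.abs_eq hcomp_forms.abs_eq zero_forms_def
  show "hcomp n (x + y) = hcomp n x + hcomp n y"
  proof (induct x rule: ind, induct y rule: ind)
    fix r s :: raw_form
    have "raw_comp n (r + s) = raw_comp n r + raw_comp n s"
      by (simp add: raw_comp_def hcomp_add vec_eq_iff)
    then show "hcomp n (abs_forms r + abs_forms s) = hcomp n (abs_forms r) + hcomp n (abs_forms s)"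
      by (simp only: abs_eqs)
  qed
  show "hcomp n (c *\<^sub>C x) = c *\<^sub>C hcomp n x"
  proof (induct x rule: ind)
    fix r :: raw_form
    have "raw_comp n (c *\<^sub>C r) = c *\<^sub>C raw_comp n r"
      by (simp add: raw_comp_def hcomp_scaleC vec_eq_iff scaleC_vec_def)
    then show "hcomp n (c *\<^sub>C abs_forms r) = c *\<^sub>C hcomp n (abs_forms r)" by (simp only: abs_eqs)
  qed
  show "hcomp m (hcomp n x) = (if m = n then hcomp n x else 0)"
  proof (induct x rule: ind)
    fix r :: raw_form
    have "raw_comp m (raw_comp n r) = (if m = n then raw_comp n r else 0)"
      by (auto simp: raw_comp_def hcomp_hcomp vec_eq_iff)
    then show "hcomp m (hcomp n (abs_forms r)) = (if m = n then hcomp n (abs_forms r) else 0)"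
      by (simp add: abs_eqs)
  qed
  obtain r where r: "x = abs_forms r" by (induct x rule: ind) auto
  let ?W = "\<Union>S. (\<lambda>k. k + sum dvar_weight S) ` {k. hcomp k (r $ S) \<noteq> 0}"
  have fin: "finite ?W" by (auto intro: finite_hcomp)
  have sub: "{n. hcomp n x \<noteq> 0} \<subseteq> ?W"
  proof
    fix n assume "n \<in> {n. hcomp n x \<noteq> 0}"
    then have "raw_comp n r \<noteq> 0" by (auto simp: r abs_eqs)
    then obtain S where "hcomp (n - sum dvar_weight S) (r $ S) \<noteq> 0" by (auto simp: raw_comp_def vec_eq_iff)
    then show "n \<in> ?W" by (force intro!: image_eqI[where x = "n - sum dvar_weight S"])
  qed
  then show "finite {n. hcomp n x \<noteq> 0}" by (rule finite_subset) (rule fin)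
  have abs_sum: "abs_forms (sum g A) = (\<Sum>n\<in>A. abs_forms (g n))" for g :: "weight \<Rightarrow> raw_form" and A
    by (induction A rule: infinite_finite_induct)
      (auto simp: zero_forms_def plus_forms.abs_eq[symmetric])
  have comp: "(\<Sum>n\<in>?W. raw_comp n r) = r"
  proof -
    have "(\<Sum>n\<in>?W. hcomp (n - sum dvar_weight S) (r $ S)) = r $ S" for S
    proof -
      let ?V = "(\<lambda>k. k + sum dvar_weight S) ` {k. hcomp k (r $ S) \<noteq> 0}"
      have "(\<Sum>n\<in>?W. hcomp (n - sum dvar_weight S) (r $ S)) = (\<Sum>n\<in>?V. hcomp (n - sum dvar_weight S) (r $ S))"
        by (intro sum.mono_neutral_right fin)
          (auto intro: image_eqI[where x = "n - sum dvar_weight S" for n])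
      also have "\<dots> = r $ S"
        by (subst sum.reindex) (auto simp: inj_on_def sum_hcomp)
      finally show ?thesis .
    qed
    then show ?thesis by (simp add: vec_eq_iff sum_component raw_comp_def)
  qed
  have "(\<Sum>n | hcomp n x \<noteq> 0. hcomp n x) = (\<Sum>n\<in>?W. hcomp n x)"
    using sub fin by (intro sum.mono_neutral_left) auto
  also have "\<dots> = abs_forms (\<Sum>n\<in>?W. raw_comp n r)"
    by (simp add: r abs_eqs abs_sum)
  also have "\<dots> = x"
    by (simp only: comp r)
  finally show "(\<Sum>n | hcomp n x \<noteq> 0. hcomp n x) = x" .
qed

end

lift_definition function_form :: "sphere_alg \<Rightarrow> forms" is raw_function .

definition differential :: "sphere_alg \<Rightarrow> forms"
  where "differential f = abs_forms (raw_one_form (\<lambda>v. partial_deriv v f))"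

section \<open>Cotwist\<close>

definition bichar :: "real \<Rightarrow> weight \<Rightarrow> weight \<Rightarrow> complex"
  where "bichar \<theta> a b = exp (\<i> * pi * \<theta> / 2 * of_int (fst a * snd b - snd a * fst b))"

text \<open>For \<open>\<theta> = 0\<close> this is the classical product.\<close>

definition cotwist :: "real \<Rightarrow> 'a::{h_comodule, times} \<Rightarrow> 'a \<Rightarrow> 'a"
  where "cotwist \<theta> x y = (\<Sum>m | hcomp m x \<noteq> 0. \<Sum>n | hcomp n y \<noteq> 0.
    bichar \<theta> m n *\<^sub>C (hcomp m x * hcomp n y))"

section \<open>The noncommutative spheres\<close>

text \<open>
  \<open>\<A>\<^sub>r(S\<^sup>7\<^sub>\<theta>)\<close> is \<^typ>\<open>sphere_alg\<close> with the product \<open>cotwist \<theta>\<close>.  As \<open>r\<^sup>2\<close> has weight zero,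
  its products with any element are the classical ones, so adjoining \<open>r\<^sup>-\<^sup>2\<close> before or after
  the cotwist gives the same algebra.
\<close>

abbreviation z_elem :: "4 \<Rightarrow> sphere_alg" where "z_elem j \<equiv> gen (Zvar j)"
abbreviation zbar_elem :: "4 \<Rightarrow> sphere_alg" where "zbar_elem j \<equiv> gen (Zbar j)"
abbreviation r_inv2 :: sphere_alg where "r_inv2 \<equiv> gen Rinv"

definition r_sq :: sphere_alg
  where "r_sq = (\<Sum>j\<in>UNIV. zbar_elem j * z_elem j)"

lemma abs_poly_r2: "abs_coord_alg poly_r2 = r_sq"
  by (simp add: poly_r2_def r_sq_def sum_4 gen_def plus_coord_alg.abs_eq times_coord_alg.abs_eq
      del: One_nat_def)

lemma r_inv2_r_sq: "r_inv2 * r_sq = 1"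
proof -
  have "r_inv2 * r_sq = abs_coord_alg (poly_gen Rinv * poly_r2)"
    by (simp only: abs_poly_r2[symmetric] gen.abs_eq times_coord_alg.abs_eq)
  also have "\<dots> = abs_coord_alg 1"
    unfolding coord_alg.abs_eq_iff by (simp add: gen_relator_sphere_var_def)
  finally show ?thesis by (simp only: one_coord_alg_def)
qed

lemma differential_r_sq: "differential r_sq = 0"
proof -
  have "raw_one_form (\<lambda>v. partial_deriv v r_sq) = wedge (raw_function 1) raw_dr2"
    unfolding wedge_one_left raw_dr2_def abs_poly_r2[symmetric]
    by (simp add: partial_deriv.abs_eq poly_der_r2 gen_def)
  then show ?thesis
    unfolding differential_def zero_forms_def forms.abs_eq_iff by auto
qed

definition u_mat :: "sphere_alg^2^4"
  where "u_mat = vector [vector [z_elem 1, - zbar_elem 2], vector [z_elem 2, zbar_elem 1],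
    vector [z_elem 3, - zbar_elem 4], vector [z_elem 4, zbar_elem 3]]"

definition uu_star :: "real \<Rightarrow> sphere_alg^4^4"
  where "uu_star \<theta> = (\<chi> i j. \<Sum>a\<in>UNIV. cotwist \<theta> (u_mat $ i $ a) (alg_star (u_mat $ j $ a)))"

definition basic_projection :: "real \<Rightarrow> sphere_alg^4^4"
  where "basic_projection \<theta> = (\<chi> i j. (if i = j then 1 else 0) -
    (\<Sum>a\<in>UNIV. cotwist \<theta> (cotwist \<theta> (u_mat $ i $ a) r_inv2) (alg_star (u_mat $ j $ a))))"

text \<open>The subalgebra \<open>\<A>\<^sub>r(S\<^sup>4\<^sub>\<theta>)\<close>; \<open>S4_alg 0\<close> is the classical \<open>\<A>\<^sub>r(S\<^sup>4)\<close>.\<close>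

inductive_set S4_alg :: "real \<Rightarrow> sphere_alg set" for \<theta> where
  one: "1 \<in> S4_alg \<theta>"
| r_sq: "r_sq \<in> S4_alg \<theta>"
| r_inv2: "r_inv2 \<in> S4_alg \<theta>"
| uu_star: "uu_star \<theta> $ i $ j \<in> S4_alg \<theta>"
| add: "f \<in> S4_alg \<theta> \<Longrightarrow> g \<in> S4_alg \<theta> \<Longrightarrow> f + g \<in> S4_alg \<theta>"
| scaleC: "f \<in> S4_alg \<theta> \<Longrightarrow> c *\<^sub>C f \<in> S4_alg \<theta>"
| mult: "f \<in> S4_alg \<theta> \<Longrightarrow> g \<in> S4_alg \<theta> \<Longrightarrow> cotwist \<theta> f g \<in> S4_alg \<theta>"
| star: "f \<in> S4_alg \<theta> \<Longrightarrow> alg_star f \<in> S4_alg \<theta>"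

text \<open>\<open>\<Omega>\<^sup>2(S\<^sup>4)\<close>: as a vector space it does not depend on \<open>\<theta>\<close>.\<close>

inductive_set S4_two_forms :: "forms set" where
  zero: "0 \<in> S4_two_forms"
| add: "\<omega> \<in> S4_two_forms \<Longrightarrow> \<eta> \<in> S4_two_forms \<Longrightarrow> \<omega> + \<eta> \<in> S4_two_forms"
| gen: "f \<in> S4_alg 0 \<Longrightarrow> g \<in> S4_alg 0 \<Longrightarrow> h \<in> S4_alg 0 \<Longrightarrow>
    function_form f * differential g * differential h \<in> S4_two_forms"

text \<open>
  Real coordinates \<open>y\<^sub>0, \<dots>, y\<^sub>4\<close> on \<open>S\<^sup>4 \<subseteq> \<R>\<^sup>5\<close>: classically \<open>\<Sum>\<^sub>\<mu> y\<^sub>\<mu>\<^sup>2 = (r\<^sup>2)\<^sup>2\<close>, that is, the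
  sphere has radius \<open>r\<^sup>2\<close> in these coordinates.
\<close>

definition y_coord :: "nat \<Rightarrow> sphere_alg"
  where "y_coord \<mu> = (let N = uu_star 0 in
    if \<mu> = 0 then N $ 1 $ 1 - N $ 3 $ 3
    else if \<mu> = 1 then N $ 1 $ 3 + alg_star (N $ 1 $ 3)
    else if \<mu> = 2 then \<i> *\<^sub>C (alg_star (N $ 1 $ 3) - N $ 1 $ 3)
    else if \<mu> = 3 then N $ 1 $ 4 + alg_star (N $ 1 $ 4)
    else \<i> *\<^sub>C (alg_star (N $ 1 $ 4) - N $ 1 $ 4))"

text \<open>\<open>p (dp)\<^sup>2\<close>, with the cotwisted product of forms.\<close>

definition basic_curvature :: "real \<Rightarrow> forms^4^4"
  where "basic_curvature \<theta> = (\<chi> i k. \<Sum>j\<in>UNIV. \<Sum>l\<in>UNIV.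
    cotwist \<theta> (function_form (basic_projection \<theta> $ i $ j))
      (cotwist \<theta> (differential (basic_projection \<theta> $ j $ l))
        (differential (basic_projection \<theta> $ l $ k))))"

text \<open>
  On a sphere in \<open>\<R>\<^sup>5\<close> with unit normal covector \<open>n\<close> the Hodge operator is
  \<open>\<omega> \<mapsto> \<plusminus> *\<^sub>5 (n \<and> \<omega>)\<close>, the sign being the orientation.  Here \<open>n = r\<^sup>-\<^sup>2 \<Sum>\<^sub>\<lambda> y\<^sub>\<lambda> dy\<^sub>\<lambda>\<close>, so
  \<open>*(dy\<^sub>\<mu> \<and> dy\<^sub>\<nu>) = \<plusminus> (1/2) r\<^sup>-\<^sup>2 \<Sum> \<epsilon>\<^sub>\<lambda>\<^sub>\<rho>\<^sub>\<sigma>\<^sub>\<mu>\<^sub>\<nu> y\<^sub>\<lambda> dy\<^sub>\<rho> \<and> dy\<^sub>\<sigma>\<close>; the sum over \<open>\<lambda>\<close>, \<open>\<rho>\<close>, \<open>\<sigma>\<close> is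
  written as a sum over the permutations \<open>\<pi>\<close> with
  \<open>(\<pi> 0, \<dots>, \<pi> 4) = (\<lambda>, \<rho>, \<sigma>, \<mu>, \<nu>)\<close>.  The products are the classical ones.
  The last conjunct fixes the orientation: the basic instanton is anti-self-dual.
\<close>

definition round_hodge :: "real \<Rightarrow> (forms \<Rightarrow> forms) \<Rightarrow> bool"
  where "round_hodge \<theta> hodge \<longleftrightarrow>
    (\<forall>\<omega>\<in>S4_two_forms. \<forall>\<eta>\<in>S4_two_forms. hodge (\<omega> + \<eta>) = hodge \<omega> + hodge \<eta>) \<and>
    (\<exists>\<epsilon>\<in>{1, -1}. \<forall>f\<in>S4_alg 0. \<forall>\<mu><5. \<forall>\<nu><5.
      hodge (function_form f * differential (y_coord \<mu>) * differential (y_coord \<nu>)) =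
      (\<Sum>\<pi> | \<pi> permutes {..<5} \<and> \<pi> 3 = \<mu> \<and> \<pi> 4 = \<nu>.
        (\<epsilon> / 2 * of_int (sign \<pi>)) *\<^sub>C
          (function_form (f * r_inv2 * y_coord (\<pi> 0)) *
            differential (y_coord (\<pi> 1)) * differential (y_coord (\<pi> 2))))) \<and>
    map_matrix hodge (basic_curvature \<theta>) = - basic_curvature \<theta>"

section \<open>The cobosonised transformation algebra\<close>

text \<open>
  \<open>\<B>(SL\<^sub>\<theta>(2,\<H>))\<close> is \<^typ>\<open>mat_var coord_alg\<close> with the product \<open>cotwist \<theta>\<close>.
\<close>

definition A_mat :: "mat_var coord_alg^4^4"
  where "A_mat = map_matrix abs_coord_alg poly_mat"

definition A_hat :: "real \<Rightarrow> 4 \<Rightarrow> 4 \<Rightarrow> mat_var coord_alg"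
  where "A_hat \<theta> i j = inverse (bichar \<theta> (tau_weight i) (tau_weight j)) *\<^sub>C A_mat $ i $ j"

text \<open>
  The group-likes being a basis of \<open>H\<^sub>F\<close>, the vector space \<open>\<B>(SL\<^sub>\<theta>(2,\<H>)) \<otimes> H\<^sub>F\<close> consists of
  the finitely supported functions on \<open>weight\<close>, and \<open>a \<otimes> g\<close> is \<open>Poly_Mapping.single g a\<close>.
\<close>

type_synonym cobos = "weight \<Rightarrow>\<^sub>0 mat_var coord_alg"

definition cobos_mult :: "real \<Rightarrow> cobos \<Rightarrow> cobos \<Rightarrow> cobos"
  where "cobos_mult \<theta> x y = (\<Sum>g\<in>Poly_Mapping.keys x. \<Sum>h\<in>Poly_Mapping.keys y.
    let a = Poly_Mapping.lookup x g; b = Poly_Mapping.lookup y h in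
    \<Sum>n | hcomp n b \<noteq> 0.
      Poly_Mapping.single (g + h) (inverse (bichar \<theta> n g ^ 2) *\<^sub>C cotwist \<theta> a (hcomp n b)))"

definition cobos_star :: "real \<Rightarrow> cobos \<Rightarrow> cobos"
  where "cobos_star \<theta> x = (\<Sum>g\<in>Poly_Mapping.keys x.
    cobos_mult \<theta> (Poly_Mapping.single (- g) 1)
      (Poly_Mapping.single 0 (alg_star (Poly_Mapping.lookup x g))))"

section \<open>The coaction and the calculus with the inverse of \<open>\<rho>\<^sup>2\<close> adjoined\<close>

text \<open>
  The element \<open>\<rho>\<^sup>2 = \<Delta>\<^sub>L(r\<^sup>2)\<close> commutes with the image of \<open>\<Delta>\<^sub>L\<close> but is not central in
  \<open>A \<otimes> \<A>\<^sub>r(S\<^sup>4\<^sub>\<theta>)\<close>, so adjoining an inverse does not simply give an algebra of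
  fractions.  We therefore consider an arbitrary complex algebra \<open>'e\<close> with an algebra map
  \<open>\<iota>\<close> from \<open>A \<otimes> \<Omega>(S\<^sup>7\<^sub>\<theta>)\<close> under which \<open>\<rho>\<^sup>2\<close> becomes invertible, and to which
  \<open>id \<otimes> d\<close> and \<open>id \<otimes> *\<^sub>\<theta>\<close> extend.  The extensions are only required to have the
  expected properties on \<open>A \<otimes> \<Omega>(S\<^sup>4\<^sub>\<theta>)\<close> with \<open>\<rho>\<^sup>-\<^sup>2\<close> adjoined.
\<close>

inductive_set gen_subalgebra :: "'e::complex_algebra_1 set \<Rightarrow> 'e set" for X where
  one: "1 \<in> gen_subalgebra X"
| base: "x \<in> X \<Longrightarrow> x \<in> gen_subalgebra X"
| add: "x \<in> gen_subalgebra X \<Longrightarrow> y \<in> gen_subalgebra X \<Longrightarrow> x + y \<in> gen_subalgebra X"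
| scaleC: "x \<in> gen_subalgebra X \<Longrightarrow> c *\<^sub>C x \<in> gen_subalgebra X"
| mult: "x \<in> gen_subalgebra X \<Longrightarrow> y \<in> gen_subalgebra X \<Longrightarrow> x * y \<in> gen_subalgebra X"

text \<open>
  \<open>functions_over \<iota> \<rho>\<^sup>-\<^sup>2 B\<close> is \<open>A \<otimes> B\<close> with \<open>\<rho>\<^sup>-\<^sup>2\<close> adjoined, and \<open>two_forms_over \<iota> \<rho>\<^sup>-\<^sup>2 B W\<close> the
  left module over it generated by \<open>A \<otimes> W\<close>.
\<close>

definition functions_over :: "((cobos, forms) tensor \<Rightarrow> 'e) \<Rightarrow> 'e \<Rightarrow> sphere_alg set \<Rightarrow> 'e::complex_algebra_1 set"
  where "functions_over \<iota> \<rho>inv B =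
    gen_subalgebra (insert \<rho>inv {\<iota> (a \<otimes>\<^sub>C function_form f) | a f. f \<in> B})"

inductive_set two_forms_over ::
    "((cobos, forms) tensor \<Rightarrow> 'e) \<Rightarrow> 'e \<Rightarrow> sphere_alg set \<Rightarrow> forms set \<Rightarrow> 'e::complex_algebra_1 set"
  for \<iota> \<rho>inv B W where
  zero: "0 \<in> two_forms_over \<iota> \<rho>inv B W"
| add: "x \<in> two_forms_over \<iota> \<rho>inv B W \<Longrightarrow> y \<in> two_forms_over \<iota> \<rho>inv B W \<Longrightarrow>
    x + y \<in> two_forms_over \<iota> \<rho>inv B W"
| gen: "b \<in> functions_over \<iota> \<rho>inv B \<Longrightarrow> \<omega> \<in> W \<Longrightarrow> b * \<iota> (a \<otimes>\<^sub>C \<omega>) \<in> two_forms_over \<iota> \<rho>inv B W"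

text \<open>
  \<open>invol\<close> is the involution on \<open>A \<otimes> \<A>\<^sub>r(S\<^sup>7\<^sub>\<theta>)\<close> with \<open>\<rho>\<^sup>-\<^sup>2\<close> adjoined.  That \<open>\<Delta>\<^sub>L r_inv2\<close>
  is inverse to \<open>\<rho>\<^sup>2\<close> follows from multiplicativity.
\<close>

locale localised_coaction =
  fixes \<theta> :: real
    and \<iota> :: "(cobos, forms) tensor \<Rightarrow> 'e::complex_algebra_1"
    and invol :: "'e \<Rightarrow> 'e"
    and \<Delta>\<^sub>L :: "sphere_alg \<Rightarrow> 'e"
  assumes \<iota>_add: "\<iota> (s + t) = \<iota> s + \<iota> t"
    and \<iota>_scaleC: "\<iota> (c *\<^sub>C t) = c *\<^sub>C \<iota> t"
    and \<iota>_one: "\<iota> (Poly_Mapping.single 0 1 \<otimes>\<^sub>C 1) = 1"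
    and \<iota>_mult: "\<iota> (a \<otimes>\<^sub>C \<omega>) * \<iota> (b \<otimes>\<^sub>C \<eta>) = \<iota> (cobos_mult \<theta> a b \<otimes>\<^sub>C cotwist \<theta> \<omega> \<eta>)"
    and invol_add: "x \<in> functions_over \<iota> (\<Delta>\<^sub>L r_inv2) UNIV \<Longrightarrow> y \<in> functions_over \<iota> (\<Delta>\<^sub>L r_inv2) UNIV \<Longrightarrow>
      invol (x + y) = invol x + invol y"
    and invol_scaleC: "x \<in> functions_over \<iota> (\<Delta>\<^sub>L r_inv2) UNIV \<Longrightarrow> invol (c *\<^sub>C x) = cnj c *\<^sub>C invol x"
    and invol_mult: "x \<in> functions_over \<iota> (\<Delta>\<^sub>L r_inv2) UNIV \<Longrightarrow> y \<in> functions_over \<iota> (\<Delta>\<^sub>L r_inv2) UNIV \<Longrightarrow>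
      invol (x * y) = invol y * invol x"
    and invol_invol: "x \<in> functions_over \<iota> (\<Delta>\<^sub>L r_inv2) UNIV \<Longrightarrow> invol (invol x) = x"
    and invol_\<iota>: "invol (\<iota> (a \<otimes>\<^sub>C function_form f)) = \<iota> (cobos_star \<theta> a \<otimes>\<^sub>C function_form (alg_star f))"
    and coaction_add: "\<Delta>\<^sub>L (f + g) = \<Delta>\<^sub>L f + \<Delta>\<^sub>L g"
    and coaction_scaleC: "\<Delta>\<^sub>L (c *\<^sub>C f) = c *\<^sub>C \<Delta>\<^sub>L f"
    and coaction_one: "\<Delta>\<^sub>L 1 = 1"
    and coaction_mult: "\<Delta>\<^sub>L (cotwist \<theta> f g) = \<Delta>\<^sub>L f * \<Delta>\<^sub>L g"
    and coaction_star: "\<Delta>\<^sub>L (alg_star f) = invol (\<Delta>\<^sub>L f)"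
    and coaction_u: "\<Delta>\<^sub>L (u_mat $ i $ k) = (\<Sum>\<beta>\<in>UNIV.
      \<iota> (Poly_Mapping.single (tau_weight \<beta>) (A_hat \<theta> i \<beta>) \<otimes>\<^sub>C function_form (u_mat $ \<beta> $ k)))"

text \<open>
  \<open>D\<close> is \<open>id \<otimes> d\<close>, extended to \<open>\<rho>\<^sup>-\<^sup>2\<close> by the Leibniz rule; \<open>hodge'\<close> is \<open>id \<otimes> *\<^sub>\<theta>\<close>,
  extended by left linearity over the functions.
\<close>

locale localised_calculus = localised_coaction \<theta> \<iota> invol \<Delta>\<^sub>L
  for \<theta> :: real
    and \<iota> :: "(cobos, forms) tensor \<Rightarrow> 'e::complex_algebra_1"
    and invol :: "'e \<Rightarrow> 'e"
    and \<Delta>\<^sub>L :: "sphere_alg \<Rightarrow> 'e" +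
  fixes hodge :: "forms \<Rightarrow> forms"
    and D :: "'e \<Rightarrow> 'e"
    and hodge' :: "'e \<Rightarrow> 'e"
  assumes D_add: "x \<in> functions_over \<iota> (\<Delta>\<^sub>L r_inv2) (S4_alg \<theta>) \<Longrightarrow>
      y \<in> functions_over \<iota> (\<Delta>\<^sub>L r_inv2) (S4_alg \<theta>) \<Longrightarrow> D (x + y) = D x + D y"
    and D_mult: "x \<in> functions_over \<iota> (\<Delta>\<^sub>L r_inv2) (S4_alg \<theta>) \<Longrightarrow>
      y \<in> functions_over \<iota> (\<Delta>\<^sub>L r_inv2) (S4_alg \<theta>) \<Longrightarrow> D (x * y) = D x * y + x * D y"
    and D_\<iota>: "f \<in> S4_alg \<theta> \<Longrightarrow> D (\<iota> (a \<otimes>\<^sub>C function_form f)) = \<iota> (a \<otimes>\<^sub>C differential f)"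
    and hodge'_add: "x \<in> two_forms_over \<iota> (\<Delta>\<^sub>L r_inv2) (S4_alg \<theta>) S4_two_forms \<Longrightarrow>
      y \<in> two_forms_over \<iota> (\<Delta>\<^sub>L r_inv2) (S4_alg \<theta>) S4_two_forms \<Longrightarrow> hodge' (x + y) = hodge' x + hodge' y"
    and hodge'_\<iota>: "b \<in> functions_over \<iota> (\<Delta>\<^sub>L r_inv2) (S4_alg \<theta>) \<Longrightarrow> \<omega> \<in> S4_two_forms \<Longrightarrow>
      hodge' (b * \<iota> (a \<otimes>\<^sub>C \<omega>)) = b * \<iota> (a \<otimes>\<^sub>C hodge \<omega>)"

definition grassmann_curvature :: "('e::ring_1 \<Rightarrow> 'e) \<Rightarrow> 'e^4^4 \<Rightarrow> 'e^4^4"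
  where "grassmann_curvature D P = P ** (map_matrix D P ** map_matrix D P)"

end

theory Submission
  imports Defs
begin

text \<open>
  Classically, an element \<open>X\<close> of \<open>SL(2,\<H>)\<close> maps the basic instanton with frame \<open>u\<close> to the one
  with frame \<open>U = X u\<close>.  The projection is \<open>P = 1 - U \<rho>\<^sup>-\<^sup>2 U\<^sup>*\<close> with \<open>\<rho>\<^sup>2 = U\<^sup>* U\<close>, and, as \<open>P\<close> kills
  \<open>X u\<close>, its curvature is the basic curvature conjugated by \<open>X\<close>:
  \<open>P dP dP = \<rho>\<^sup>-\<^sup>2 r\<^sup>2 P X (p dp dp) X\<^sup>* P\<close>.
  The Hodge operator is linear over functions and constants in \<open>X\<close>, so the right-hand side is
  anti-self-dual because \<open>p dp dp\<close> is.  The same argument works after the deformation, in the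
  algebra that contains \<open>A \<otimes> \<Omega>(S\<^sup>7\<^sub>\<theta>)\<close> and \<open>\<rho>\<^sup>-\<^sup>2\<close>, once the order of the factors is under control.

  The formula for the curvature is pure matrix algebra over a noncommutative ring
  (\<open>curvature_by_numerator\<close> and \<open>numerator_by_fibre\<close>).  It uses \<open>d\<close> only on \<open>N = U U\<^sup>* = X (u u\<^sup>*) Y\<close>,
  whose entries come from the four-sphere, and not on \<open>u\<close> itself.  It also needs \<open>\<rho>\<^sup>2\<close> to commute with
  certain matrices, although \<open>\<rho>\<^sup>2\<close> is not central and need not commute with \<open>X\<close>.

  These commutation rules come from a grading.  The entries of \<open>X\<close> satisfy
  \<open>X\<^sub>i\<^sub>\<beta> X\<^sub>j\<^sub>\<gamma> = F\<^sup>2(\<tau>\<^sub>i,\<tau>\<^sub>j) F\<^sup>-\<^sup>2(\<tau>\<^sub>\<beta>,\<tau>\<^sub>\<gamma>) X\<^sub>j\<^sub>\<gamma> X\<^sub>i\<^sub>\<beta>\<close> (\<open>X_commute\<close>), and a form of weight \<open>n\<close> commutes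
  with \<open>u\<^sub>\<gamma>\<^sub>b\<close> up to \<open>F\<^sup>2(n,\<tau>\<^sub>\<gamma>)\<close>.  So each element that occurs has a charge (\<open>charged\<close>), a pair of weights that
  gives the phase for passing \<open>X\<^sub>j\<^sub>\<gamma> u\<^sub>\<gamma>\<^sub>b\<close>.  In products such as \<open>X (p dp dp) Y\<close> the inner charges
  cancel.  What remains commutes up to a phase with \<open>U\<close>, so strictly with \<open>\<rho>\<^sup>2\<close>, and up to a phase
  with the entries of \<open>P\<close>.

  The phases also settle the last point.  The operator \<open>id \<otimes> *\<^sub>\<theta>\<close> is linear over functions on the left,
  so the right factor \<open>P\<close> has to be moved there.  As the entries of \<open>X (p dp dp) Y\<close> are charged,
  this is possible entry by entry (\<open>curvature_entry\<close>), and each entry of the curvature becomes a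
  left combination of \<open>a \<otimes> (p dp dp)\<^sub>\<beta>\<^sub>\<gamma>\<close>.
\<close>

section \<open>Cotwisted products of homogeneous elements\<close>

lemma scaleC_minus_left: "(- c) *\<^sub>C x = - (c *\<^sub>C (x :: 'a::complex_space))"
  using scaleC_add_left[of c "- c" x] by (simp add: eq_neg_iff_add_eq_0 add.commute)

lemma bichar_add_left: "bichar \<theta> (m + n) k = bichar \<theta> m k * bichar \<theta> n k"
  unfolding bichar_def exp_add[symmetric] by (simp add: algebra_simps)

lemma bichar_add_right: "bichar \<theta> k (m + n) = bichar \<theta> k m * bichar \<theta> k n"
  unfolding bichar_def exp_add[symmetric] by (simp add: algebra_simps)

lemma bichar_zero [simp]: "bichar \<theta> 0 n = 1" "bichar \<theta> n 0 = 1"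
  by (simp_all add: bichar_def)

lemma bichar_uminus: "bichar \<theta> (- m) n = inverse (bichar \<theta> m n)" "bichar \<theta> m (- n) = inverse (bichar \<theta> m n)"
  by (simp_all add: bichar_def exp_minus[symmetric] algebra_simps)

lemma bichar_diff: "bichar \<theta> (m - k) n = bichar \<theta> m n / bichar \<theta> k n"
  "bichar \<theta> n (m - k) = bichar \<theta> n m / bichar \<theta> n k"
  using bichar_add_left[of \<theta> m "- k" n] bichar_add_right[of \<theta> n m "- k"]
  by (simp_all add: bichar_uminus divide_inverse)

lemma bichar_nonzero [simp]: "bichar \<theta> m n \<noteq> 0"
  by (simp add: bichar_def)

lemma bichar_swap: "bichar \<theta> n m = inverse (bichar \<theta> m n)"
  unfolding bichar_def exp_minus[symmetric] by (rule arg_cong[where f = exp]) (simp add: algebra_simps)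

lemma bichar_self [simp]: "bichar \<theta> n n = 1" "bichar \<theta> (- n) n = 1" "bichar \<theta> n (- n) = 1"
  by (simp_all add: bichar_def)

lemma bichar_theta_zero [simp]: "bichar 0 m n = 1"
  by (simp add: bichar_def)

lemma hcomp_support:
  assumes "hcomp m (x::'a::h_comodule) = x" "x \<noteq> 0"
  shows "{k. hcomp k x \<noteq> 0} = {m}"
proof -
  have "hcomp k x = (if k = m then x else 0)" for k
    using hcomp_hcomp[of k m x] by (simp only: assms(1))
  then show ?thesis using assms(2) by simp
qed

lemma cotwist_zero [simp]: "cotwist \<theta> 0 y = 0" "cotwist \<theta> x 0 = (0 :: 'a::{h_comodule, ring})"
  by (simp_all add: cotwist_def h_comodule_simps)

text \<open>
  The defining double sum runs over the nonzero homogeneous components, and a nonzero homogeneous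
  element has exactly one.
\<close>
lemma cotwist_homogeneous:
  fixes x y :: "'a::{h_comodule, ring}"
  assumes "hcomp m x = x" "hcomp n y = y"
  shows "cotwist \<theta> x y = bichar \<theta> m n *\<^sub>C (x * y)"
proof (cases "x = 0 \<or> y = 0")
  case False
  then have "{k. hcomp k x \<noteq> 0} = {m}" "{k. hcomp k y \<noteq> 0} = {n}"
    using hcomp_support assms by blast+
  then show ?thesis
    unfolding cotwist_def by (simp add: assms)
qed auto

lemma cotwist_invariant_left:
  fixes x y :: "'a::{h_comodule, ring}"
  assumes "hcomp 0 x = x"
  shows "cotwist \<theta> x y = x * y"
proof (cases "x = 0")
  case False
  have "cotwist \<theta> x y = (\<Sum>n | hcomp n y \<noteq> 0. x * hcomp n y)"
    using assms False by (simp add: cotwist_def hcomp_support[OF assms] scaleC_one)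
  then show ?thesis by (simp add: sum_distrib_left[symmetric] sum_hcomp)
qed auto

lemma cotwist_invariant_right:
  fixes x y :: "'a::{h_comodule, ring}"
  assumes "hcomp 0 y = y"
  shows "cotwist \<theta> x y = x * y"
proof (cases "y = 0")
  case False
  have "cotwist \<theta> x y = (\<Sum>n | hcomp n x \<noteq> 0. hcomp n x * y)"
    using assms False by (simp add: cotwist_def hcomp_support[OF assms] scaleC_one)
  then show ?thesis by (simp add: sum_distrib_right[symmetric] sum_hcomp)
qed auto

section \<open>Homogeneous functions and forms\<close>

lemma hcomp_mult:
  fixes x y :: "'v::presented_generators coord_alg"
  assumes "hcomp m x = x" "hcomp n y = y"
  shows "hcomp (m + n) (x * y) = x * y"
  using hcomp_mult_homog[OF assms(2), of "m + n" x] assms(1) by simp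

lemma hcomp_one: "hcomp 0 (1 :: 'v::presented_generators coord_alg) = 1"
proof -
  have "poly_comp gen_weight 0 (1 :: 'v cpoly) = 1"
    using poly_comp_single[of "gen_weight :: 'v \<Rightarrow> weight" 0 0 1] by simp
  then show ?thesis by (simp add: one_coord_alg_def hcomp_coord_alg.abs_eq)
qed

lemma hcomp_cotwist:
  fixes x y :: "'v::presented_generators coord_alg"
  assumes "hcomp m x = x" "hcomp n y = y"
  shows "hcomp (m + n) (cotwist \<theta> x y) = cotwist \<theta> x y"
  using hcomp_mult[OF assms] by (simp add: cotwist_homogeneous[OF assms] hcomp_scaleC)

lemma hcomp_zero_form: "hcomp n (function_form f) = function_form (hcomp n f)"
proof -
  have "raw_comp n (raw_function f) = raw_function (hcomp n f)"
    by (auto simp: raw_comp_def raw_function_def vec_eq_iff h_comodule_simps)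
  then show ?thesis by (simp add: function_form_def hcomp_forms.abs_eq)
qed

lemma function_form_add: "function_form (f + g) = function_form f + function_form g"
  and function_form_scaleC: "function_form (c *\<^sub>C f) = c *\<^sub>C function_form f"
  and function_form_zero [simp]: "function_form 0 = 0"
  and function_form_one: "function_form 1 = 1"
proof -
  have "raw_function (f + g) = raw_function f + raw_function g"
    by (auto simp: raw_function_def vec_eq_iff)
  then show "function_form (f + g) = function_form f + function_form g"
    by (simp add: function_form_def plus_forms.abs_eq)
  have "raw_function (c *\<^sub>C f) = c *\<^sub>C raw_function f"
    by (auto simp: raw_function_def vec_eq_iff scaleC_vec_def)
  then show "function_form (c *\<^sub>C f) = c *\<^sub>C function_form f"
    by (simp add: function_form_def scaleC_forms.abs_eq)
  have "raw_function 0 = 0" by (auto simp: raw_function_def vec_eq_iff)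
  then show "function_form 0 = 0" by (simp add: function_form_def zero_forms_def)
  show "function_form 1 = 1" by (simp add: function_form_def one_forms_def)
qed

lemma function_form_sum: "function_form (sum f A) = (\<Sum>x\<in>A. function_form (f x))"
  by (induction A rule: infinite_finite_induct) (auto simp: function_form_add)

lemma wedge_raw_function:
  "wedge (raw_function f) x $ U = f * x $ U" "wedge x (raw_function f) $ U = x $ U * f"
proof -
  have "wedge (raw_function f) x $ U = (\<Sum>S\<in>Pow U. if S = {} then f * x $ U else 0)"
    unfolding wedge_def raw_function_def
    by (intro vec_lambda_beta[THEN trans] sum.cong) (auto simp: wedge_sign_def scaleC_one)
  then show "wedge (raw_function f) x $ U = f * x $ U" by (simp add: finite)
  have "wedge x (raw_function f) $ U = (\<Sum>S\<in>Pow U. if S = U then x $ U * f else 0)"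
    unfolding wedge_def raw_function_def
    by (intro vec_lambda_beta[THEN trans] sum.cong) (auto simp: wedge_sign_def scaleC_one)
  then show "wedge x (raw_function f) $ U = x $ U * f" by (simp add: finite)
qed

lemma function_form_mult: "function_form (f * g) = function_form f * function_form g"
proof -
  have "raw_function (f * g) = wedge (raw_function f) (raw_function g)"
    by (auto simp: vec_eq_iff wedge_raw_function) (auto simp: raw_function_def)
  then show ?thesis by (simp add: function_form_def times_forms.abs_eq)
qed

lemma function_form_commute: "function_form f * \<omega> = \<omega> * function_form f"
proof (induct \<omega> rule: forms.abs_induct)
  case (1 x)
  have "wedge (raw_function f) x = wedge x (raw_function f)"
    by (simp add: vec_eq_iff wedge_raw_function mult.commute)
  then show ?case by (simp add: function_form_def times_forms.abs_eq)
qed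

lemma function_form_cotwist:
  assumes "hcomp m f = f" "hcomp n g = g"
  shows "function_form (cotwist \<theta> f g) = cotwist \<theta> (function_form f) (function_form g)"
  using assms by (simp add: cotwist_homogeneous[of m _ n] hcomp_zero_form function_form_scaleC function_form_mult)

text \<open>
  Taking the weight component of any representative shows that a homogeneous class has a
  homogeneous representative, so that weights may be counted on polynomials.
\<close>
lemma hcomp_coord_repr:
  fixes f :: "'v::presented_generators coord_alg"
  assumes "hcomp n f = f"
  obtains q where "f = abs_coord_alg q" "homog gen_weight n q"
proof -
  obtain p where p: "f = abs_coord_alg p" by (induct f rule: coord_alg.abs_induct) auto
  show ?thesis
  proof
    show "f = abs_coord_alg (poly_comp gen_weight n p)"
      using assms by (simp add: p hcomp_coord_alg.abs_eq)
    show "homog gen_weight n (poly_comp gen_weight n p)"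
      by (auto simp: homog_def in_keys_iff lookup_poly_comp split: if_splits)
  qed
qed

lemma hcomp_abs_homog:
  assumes "homog gen_weight n q"
  shows "hcomp n (abs_coord_alg q) = abs_coord_alg q"
proof -
  have "poly_comp gen_weight n q = (\<Sum>m\<in>Poly_Mapping.keys q. Poly_Mapping.single m (Poly_Mapping.lookup q m))"
    unfolding poly_comp_def using assms by (intro sum.cong) (auto simp: homog_def)
  then show ?thesis by (simp add: hcomp_coord_alg.abs_eq poly_sum_single[symmetric])
qed

lemma homog_partial_gen: "homog gen_weight (gen_weight x - dvar_weight v) (partial_gen v x)"
proof -
  have c: "gen_weight (conj_coord_var v) = - dvar_weight v"
    by (cases v) (auto simp: dvar_weight_def gen_weight_sphere_var_def)
  have w: "gen_weight Rinv = 0" by (simp add: gen_weight_sphere_var_def)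
  have "homog gen_weight (gen_weight Rinv + gen_weight Rinv + gen_weight (conj_coord_var v))
      (poly_gen Rinv * poly_gen Rinv * poly_gen (conj_coord_var v))"
    by (intro homog_mult homog_gen)
  then have "homog gen_weight (- dvar_weight v) (poly_gen Rinv * poly_gen Rinv * poly_gen (conj_coord_var v))"
    unfolding c w by simp
  then show ?thesis
    by (auto simp: partial_gen_def dvar_weight_def homog_zero homog_one w
        simp del: One_nat_def intro: homog_uminus)
qed

lemma homog_partial_deriv:
  assumes "homog gen_weight n q"
  shows "homog gen_weight (n - dvar_weight v) (poly_der (partial_gen v) q)"
  unfolding poly_der_def
proof (intro homog_sum)
  fix m x assume m: "m \<in> Poly_Mapping.keys q" and x: "x \<in> Poly_Mapping.keys m"
  \<comment> \<open>Subtraction of monomials truncates; \<open>x\<close> does occur in \<open>m\<close>.\<close>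
  have "m = (m - monom_of x) + monom_of x"
    using x by (intro poly_mapping_eqI) (auto simp: lookup_add lookup_minus lookup_single when_def in_keys_iff)
  then have "mono_weight gen_weight m = mono_weight gen_weight (m - monom_of x) + gen_weight x"
    by (metis mono_weight_add mono_weight_single)
  then have "mono_weight gen_weight (m - monom_of x) = n - gen_weight x"
    using assms m by (auto simp: homog_def)
  then have "homog gen_weight (n - gen_weight x) (Poly_Mapping.single (m - monom_of x) c)" for c :: complex
    by (auto simp: homog_def)
  from homog_mult[OF this homog_partial_gen[of x v]]
  show "homog gen_weight (n - dvar_weight v) (Poly_Mapping.single (m - monom_of x)
      (of_nat (Poly_Mapping.lookup m x) * Poly_Mapping.lookup q m) * partial_gen v x)" by simp
qed

text \<open>
  The torus acts on the classical forms by algebra automorphisms commuting with \<open>d\<close>.  On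
  representatives: \<open>\<partial>\<^sub>v\<close> lowers the weight by that of \<open>v\<close>, and in \<open>df\<close> it is multiplied by
  \<open>dv\<close>, which restores it.
\<close>
lemma hcomp_differential:
  assumes "hcomp n f = f"
  shows "hcomp n (differential f) = differential f"
proof -
  have *: "hcomp (n - dvar_weight v) (partial_deriv v f) = partial_deriv v f" for v
    using assms by (elim hcomp_coord_repr) (auto simp: partial_deriv.abs_eq intro!: hcomp_abs_homog homog_partial_deriv)
  have "raw_comp n (raw_one_form (\<lambda>v. partial_deriv v f)) = raw_one_form (\<lambda>v. partial_deriv v f)"
    using * by (auto simp: raw_comp_def raw_one_form_def vec_eq_iff hcomp_sum h_comodule_simps intro!: sum.cong)
  then show ?thesis by (simp add: differential_def hcomp_forms.abs_eq)
qed

lemma hcomp_forms_mult: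
  fixes \<omega> \<eta> :: forms
  assumes "hcomp m \<omega> = \<omega>" "hcomp n \<eta> = \<eta>"
  shows "hcomp (m + n) (\<omega> * \<eta>) = \<omega> * \<eta>"
proof -
  have repr: "\<exists>x. \<zeta> = abs_forms x \<and> raw_comp k x = x" if "hcomp k \<zeta> = \<zeta>" for k \<zeta>
  proof -
    obtain x where x: "\<zeta> = abs_forms x" by (induct \<zeta> rule: forms.abs_induct) auto
    have "raw_comp k (raw_comp k x) = raw_comp k x" by (simp add: raw_comp_def vec_eq_iff hcomp_hcomp)
    then show ?thesis using that by (intro exI[of _ "raw_comp k x"]) (simp add: x hcomp_forms.abs_eq)
  qed
  obtain x y where x: "\<omega> = abs_forms x" "raw_comp m x = x" and y: "\<eta> = abs_forms y" "raw_comp n y = y"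
    using repr[OF assms(1)] repr[OF assms(2)] by blast
  have "hcomp (m + n - sum dvar_weight U) (x $ S * y $ (U - S)) = x $ S * y $ (U - S)" if "S \<subseteq> U" for S U
  proof -
    have "hcomp (m - sum dvar_weight S) (x $ S) = x $ S"
      "hcomp (n - sum dvar_weight (U - S)) (y $ (U - S)) = y $ (U - S)"
      using arg_cong[OF x(2), of "\<lambda>x. x $ S"] arg_cong[OF y(2), of "\<lambda>x. x $ (U - S)"]
      by (simp_all add: raw_comp_def)
    from hcomp_mult[OF this] show ?thesis
      using sum.subset_diff[OF that, of dvar_weight] by (simp add: algebra_simps finite)
  qed
  then have "raw_comp (m + n) (wedge x y) = wedge x y"
    by (auto simp: raw_comp_def wedge_def vec_eq_iff hcomp_sum hcomp_scaleC intro!: sum.cong)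
  then show ?thesis by (simp add: x y times_forms.abs_eq hcomp_forms.abs_eq)
qed

section \<open>The noncommutative Hopf fibration\<close>

lemma alg_star_uminus: "alg_star (- x) = - alg_star x"
proof (induct x rule: coord_alg.abs_induct)
  case (1 f)
  then show ?case by (simp add: uminus_coord_alg.abs_eq alg_star.abs_eq poly_star_uminus)
qed

lemma hcomp_alg_star: "hcomp (- n) (alg_star x) = alg_star (hcomp n x)"
proof (induct x rule: coord_alg.abs_induct)
  case (1 f)
  have "poly_comp gen_weight (- n) (poly_star gen_conj f) = poly_star gen_conj (poly_comp gen_weight n f)"
    by (induction f rule: poly_additive_induct)
      (auto simp: poly_comp_add poly_star_add poly_star_single poly_comp_single poly_star_def[of _ 0] mono_weight_conj[where w = gen_weight and cj = gen_conj, OF gen_weight_conj])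
  then show ?case by (simp add: hcomp_coord_alg.abs_eq alg_star.abs_eq)
qed

lemma hcomp_z: "hcomp (tau_weight j) (z_elem j) = z_elem j" "hcomp (- tau_weight j) (zbar_elem j) = zbar_elem j"
  and hcomp_r_inv2: "hcomp 0 r_inv2 = r_inv2"
  using hcomp_gen[of "Zvar j"] hcomp_gen[of "Zbar j"] hcomp_gen[of Rinv] by (simp_all add: gen_weight_sphere_var_def)

lemma hcomp_r_sq: "hcomp 0 r_sq = r_sq"
  unfolding r_sq_def hcomp_sum
proof (intro sum.cong refl)
  fix j
  show "hcomp 0 (zbar_elem j * z_elem j) = zbar_elem j * z_elem j"
    using hcomp_mult[OF hcomp_z(2)[of j] hcomp_z(1)[of j]] by simp
qed

lemma hcomp_u_mat: "hcomp (tau_weight i) (u_mat $ i $ a) = u_mat $ i $ a"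
proof -
  have tau: "- tau_weight 2 = tau_weight 1" "- tau_weight 1 = tau_weight 2"
    "- tau_weight 4 = tau_weight 3" "- tau_weight 3 = tau_weight 4"
    by (simp_all add: tau_weight_def)
  have "\<forall>i a. hcomp (tau_weight i) (u_mat $ i $ a) = u_mat $ i $ a"
    unfolding forall_4 forall_2
    using hcomp_z(1) hcomp_z(2)[of 1] hcomp_z(2)[of 2] hcomp_z(2)[of 3] hcomp_z(2)[of 4]
    unfolding tau by (simp add: u_mat_def vector_4 h_comodule_simps)
  then show ?thesis by blast
qed

lemma hcomp_u_star: "hcomp (- tau_weight i) (alg_star (u_mat $ i $ a)) = alg_star (u_mat $ i $ a)"
  by (simp add: hcomp_alg_star hcomp_u_mat)

text \<open>
  The columns of \<open>u\<close> are exchanged by \<open>*\<close> up to signs: the entry \<open>u\<^sub>i\<^sub>a\<^sup>*\<close> is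
  \<open>\<plusminus>\<close> the entry in the other row of the same quaternionic pair and in the other column.
\<close>
definition conj_row :: "4 \<Rightarrow> 4"
  where "conj_row i = (if i = 1 then 2 else if i = 2 then 1 else if i = 3 then 4 else 3)"

definition conj_col :: "2 \<Rightarrow> 2"
  where "conj_col a = (if a = 1 then 2 else 1)"

definition row_sign :: "4 \<Rightarrow> complex"
  where "row_sign i = (if i = 1 \<or> i = 3 then 1 else - 1)"

definition col_sign :: "2 \<Rightarrow> complex"
  where "col_sign a = (if a = 1 then 1 else - 1)"

lemma conj_row_conj_row [simp]: "conj_row (conj_row i) = i"
proof -
  have "\<forall>i. conj_row (conj_row i) = i" unfolding forall_4 by (simp add: conj_row_def)
  then show ?thesis by blast
qed

lemma tau_weight_conj_row: "tau_weight (conj_row i) = - tau_weight i"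
proof -
  have "\<forall>i. tau_weight (conj_row i) = - tau_weight i"
    unfolding forall_4 by (simp add: conj_row_def tau_weight_def)
  then show ?thesis by blast
qed

text \<open>
  It follows that the coaction on \<open>u\<^sup>*\<close> is that on \<open>u\<close> with rows and columns conjugated.
\<close>
lemma alg_star_u_mat:
  "alg_star (u_mat $ i $ a) = (row_sign i * col_sign a) *\<^sub>C u_mat $ conj_row i $ conj_col a"
proof -
  have "\<forall>i a. alg_star (u_mat $ i $ a) = (row_sign i * col_sign a) *\<^sub>C u_mat $ conj_row i $ conj_col a"
    unfolding forall_4 forall_2
    by (simp add: u_mat_def vector_4 conj_row_def conj_col_def row_sign_def col_sign_def alg_star_gen
        alg_star_uminus gen_conj_sphere_var_def scaleC_one scaleC_minus_left scaleC_minus_right)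
  then show ?thesis by blast
qed

text \<open>
  Only entries of opposite weight are multiplied, and on those the bicharacter is \<open>1\<close>; the
  relation \<open>u\<^sup>* u = r\<^sup>2\<close> is therefore the classical one.
\<close>
lemma u_star_u:
  "(\<Sum>i\<in>UNIV. cotwist \<theta> (alg_star (u_mat $ i $ a)) (u_mat $ i $ b)) = (if a = b then r_sq else 0)"
proof -
  have "(\<Sum>i\<in>UNIV. cotwist \<theta> (alg_star (u_mat $ i $ a)) (u_mat $ i $ b))
      = (\<Sum>i\<in>UNIV. alg_star (u_mat $ i $ a) * u_mat $ i $ b)"
    by (simp add: cotwist_homogeneous[OF hcomp_u_star hcomp_u_mat] scaleC_one)
  moreover have "\<forall>a b. (\<Sum>i\<in>UNIV. alg_star (u_mat $ i $ a) * u_mat $ i $ b) = (if a = b then r_sq else 0)"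
    unfolding forall_2
    by (simp add: sum_4 u_mat_def vector_4 alg_star_gen alg_star_uminus gen_conj_sphere_var_def r_sq_def
        mult.commute add.commute add.left_commute)
  ultimately show ?thesis by simp
qed

lemma r_sq_eq_uu_star: "r_sq = uu_star \<theta> $ 1 $ 1 + uu_star \<theta> $ 3 $ 3"
proof -
  have "uu_star \<theta> $ i $ i = (\<Sum>a\<in>UNIV. u_mat $ i $ a * alg_star (u_mat $ i $ a))" for i
    by (simp add: uu_star_def cotwist_homogeneous[OF hcomp_u_mat hcomp_u_star] scaleC_one)
  then show ?thesis
    by (simp add: sum_2 u_mat_def vector_4 alg_star_gen alg_star_uminus gen_conj_sphere_var_def r_sq_def sum_4
      mult.commute add.commute add.left_commute)
qed

text \<open>
  The cotwist changes the entries of \<open>u u\<^sup>*\<close> by phases only, so they belong to the classical algebra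
  of functions on the four-sphere as well.
\<close>
lemma uu_star_classical:
  "uu_star \<theta> $ i $ j = bichar \<theta> (tau_weight i) (- tau_weight j) *\<^sub>C uu_star 0 $ i $ j"
  by (simp add: uu_star_def cotwist_homogeneous[OF hcomp_u_mat hcomp_u_star] scaleC_sum_right scaleC_one)

lemma hcomp_uu_star: "hcomp (tau_weight i - tau_weight j) (uu_star \<theta> $ i $ j) = uu_star \<theta> $ i $ j"
  using hcomp_cotwist[OF hcomp_u_mat hcomp_u_star, of i j] by (simp add: uu_star_def hcomp_sum)

lemma basic_projection_eq:
  "basic_projection \<theta> $ i $ j = (if i = j then 1 else 0) - r_inv2 * uu_star \<theta> $ i $ j"
proof -
  have "cotwist \<theta> (cotwist \<theta> (u_mat $ i $ a) r_inv2) (alg_star (u_mat $ j $ a))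
      = r_inv2 * cotwist \<theta> (u_mat $ i $ a) (alg_star (u_mat $ j $ a))" for a
  proof -
    have w: "hcomp (tau_weight i) (r_inv2 * u_mat $ i $ a) = r_inv2 * u_mat $ i $ a"
      using hcomp_mult[OF hcomp_r_inv2 hcomp_u_mat] by simp
    show ?thesis
      by (simp add: cotwist_invariant_right[OF hcomp_r_inv2] mult.commute[of _ r_inv2] mult.assoc
          cotwist_homogeneous[OF w hcomp_u_star] cotwist_homogeneous[OF hcomp_u_mat hcomp_u_star]
          coord_scaleC_mult_right)
  qed
  then show ?thesis by (simp add: basic_projection_def uu_star_def sum_distrib_left)
qed

lemma hcomp_basic_projection:
  "hcomp (tau_weight i - tau_weight j) (basic_projection \<theta> $ i $ j) = basic_projection \<theta> $ i $ j"
  using hcomp_mult[OF hcomp_r_inv2 hcomp_uu_star[of i j \<theta>]]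
  by (auto simp: basic_projection_eq h_comodule_simps hcomp_one)

lemma basic_projection_in_S4_alg:
  assumes "c *\<^sub>C uu_star \<theta>' $ i $ j = uu_star \<theta> $ i $ j"
  shows "basic_projection \<theta> $ i $ j \<in> S4_alg \<theta>'"
proof -
  have "(if i = j then 1 else 0) = (if i = j then 1 else 0) *\<^sub>C (1 :: sphere_alg)"
    by (simp add: scaleC_one)
  moreover have "r_inv2 * uu_star \<theta> $ i $ j = c *\<^sub>C cotwist \<theta>' r_inv2 (uu_star \<theta>' $ i $ j)"
    by (simp add: cotwist_invariant_left[OF hcomp_r_inv2] assms[symmetric] coord_scaleC_mult_right)
  ultimately have "basic_projection \<theta> $ i $ j = (if i = j then 1 else 0) *\<^sub>C 1
      + (- c) *\<^sub>C cotwist \<theta>' r_inv2 (uu_star \<theta>' $ i $ j)"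
    by (simp add: basic_projection_eq scaleC_minus_left)
  also have "\<dots> \<in> S4_alg \<theta>'"
    by (intro S4_alg.intros)
  finally show ?thesis .
qed

lemma basic_projection_in_S4: "basic_projection \<theta> $ i $ j \<in> S4_alg \<theta>" "basic_projection \<theta> $ i $ j \<in> S4_alg 0"
  using basic_projection_in_S4_alg[of 1 \<theta> i j \<theta>] basic_projection_in_S4_alg[OF uu_star_classical[symmetric]]
  by (simp_all add: scaleC_one)

lemma S4_two_forms_sum: "(\<And>x. x \<in> A \<Longrightarrow> f x \<in> S4_two_forms) \<Longrightarrow> sum f A \<in> S4_two_forms"
  by (induction A rule: infinite_finite_induct) (auto intro: S4_two_forms.intros)

lemma forms_scaleC_mult_left: "(c *\<^sub>C \<omega>) * \<eta> = c *\<^sub>C (\<omega> * (\<eta> :: forms))"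
  by (induct \<omega> rule: forms.abs_induct, induct \<eta> rule: forms.abs_induct)
    (simp only: scaleC_forms.abs_eq times_forms.abs_eq wedge_scaleC_left)

lemma forms_scaleC_mult_right: "\<omega> * (c *\<^sub>C \<eta>) = c *\<^sub>C (\<omega> * (\<eta> :: forms))"
  by (induct \<omega> rule: forms.abs_induct, induct \<eta> rule: forms.abs_induct)
    (simp only: scaleC_forms.abs_eq times_forms.abs_eq wedge_scaleC_right)

text \<open>
  All entries of \<open>p\<close> and \<open>dp\<close> are homogeneous, so each cotwisted product is a phase times the
  classical one, and the entries of \<open>p\<close> belong to the classical algebra as well.
\<close>
lemma basic_curvature_two_form: "basic_curvature \<theta> $ i $ k \<in> S4_two_forms"
proof -
  let ?p = "basic_projection \<theta>" and ?w = tau_weight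
  have "cotwist \<theta> (function_form (?p $ i $ j)) (cotwist \<theta> (differential (?p $ j $ l)) (differential (?p $ l $ k)))
      \<in> S4_two_forms" for j l
  proof -
    note d = hcomp_differential[OF hcomp_basic_projection]
    define a where "a = bichar \<theta> (?w j - ?w l) (?w l - ?w k)"
    define b where "b = bichar \<theta> (?w i - ?w j) ((?w j - ?w l) + (?w l - ?w k))"
    have f: "hcomp (?w i - ?w j) (function_form (?p $ i $ j)) = function_form (?p $ i $ j)"
      by (simp only: hcomp_zero_form hcomp_basic_projection)
    have w: "hcomp ((?w j - ?w l) + (?w l - ?w k)) (a *\<^sub>C (differential (?p $ j $ l) * differential (?p $ l $ k)))
        = a *\<^sub>C (differential (?p $ j $ l) * differential (?p $ l $ k))"
      by (simp only: hcomp_scaleC hcomp_forms_mult[OF d d])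
    have "cotwist \<theta> (function_form (?p $ i $ j)) (cotwist \<theta> (differential (?p $ j $ l)) (differential (?p $ l $ k)))
      = function_form ((b * a) *\<^sub>C ?p $ i $ j) * differential (?p $ j $ l) * differential (?p $ l $ k)"
      unfolding cotwist_homogeneous[OF d d] a_def[symmetric] cotwist_homogeneous[OF f w] b_def[symmetric]
      by (simp add: function_form_scaleC forms_scaleC_mult_left forms_scaleC_mult_right scaleC_scaleC mult.assoc)
    also have "\<dots> \<in> S4_two_forms"
      by (intro S4_two_forms.gen S4_alg.scaleC basic_projection_in_S4)
    finally show ?thesis .
  qed
  then show ?thesis
    unfolding basic_curvature_def by (simp add: S4_two_forms_sum)
qed

section \<open>Matrices with noncommuting entries\<close>

lemma matrix_diff_mult:
  fixes A B :: "'e::ring_1^'n^'m" and C :: "'e^'k^'n"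
  shows "(A - B) ** C = A ** C - B ** C"
  by (simp add: matrix_matrix_mult_def vec_eq_iff left_diff_distrib sum_subtractf)

lemma matrix_add_mult:
  fixes A B :: "'e::ring_1^'n^'m" and C :: "'e^'k^'n"
  shows "(A + B) ** C = A ** C + B ** C"
  by (simp add: matrix_matrix_mult_def vec_eq_iff distrib_right sum.distrib)

lemma matrix_mult_diff:
  fixes A :: "'e::ring_1^'n^'m" and B C :: "'e^'k^'n"
  shows "A ** (B - C) = A ** B - A ** C"
  by (simp add: matrix_matrix_mult_def vec_eq_iff right_diff_distrib sum_subtractf)

lemma matrix_uminus_mult:
  fixes A :: "'e::ring_1^'n^'m" and B :: "'e^'k^'n"
  shows "(- A) ** B = - (A ** B)" "A ** (- B) = - (A ** B)"
  by (simp_all add: matrix_matrix_mult_def vec_eq_iff sum_negf)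

lemma matrix_mult_zero:
  fixes A :: "'e::ring_1^'n^'m"
  shows "A ** (0 :: 'e^'k^'n) = 0" "(0 :: 'e^'m^'k) ** A = 0"
  by (simp_all add: matrix_matrix_mult_def vec_eq_iff)

lemma mat_mult_nth:
  fixes M :: "'e::ring_1^'n^'m"
  shows "(mat s ** M) $ i $ j = s * M $ i $ j" "(M ** mat s) $ i $ j = M $ i $ j * s"
proof -
  have "(mat s ** M) $ i $ j = (\<Sum>k\<in>UNIV. if k = i then s * M $ i $ j else 0)"
    unfolding matrix_matrix_mult_def mat_def vec_lambda_beta by (intro sum.cong) auto
  then show "(mat s ** M) $ i $ j = s * M $ i $ j" by simp
  have "(M ** mat s) $ i $ j = (\<Sum>k\<in>UNIV. if k = j then M $ i $ j * s else 0)"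
    unfolding matrix_matrix_mult_def mat_def vec_lambda_beta by (intro sum.cong) auto
  then show "(M ** mat s) $ i $ j = M $ i $ j * s" by simp
qed

text \<open>
  A scalar \<open>s\<close> acts on matrices through \<open>mat s\<close>.  Over a noncommutative ring it can be moved past
  a matrix only when it commutes with its entries.
\<close>
definition commutes_entrywise :: "'e::ring_1 \<Rightarrow> 'e^'n^'m \<Rightarrow> bool"
  where "commutes_entrywise s M \<longleftrightarrow> (\<forall>i j. s * M $ i $ j = M $ i $ j * s)"

lemma mat_commute:
  fixes M :: "'e::ring_1^'n^'m"
  assumes "commutes_entrywise s M"
  shows "M ** mat s = mat s ** M" "M ** (mat s ** Z) = mat s ** (M ** Z)"
proof -
  show "M ** mat s = mat s ** M"
    using assms by (simp add: vec_eq_iff mat_mult_nth commutes_entrywise_def)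
  then show "M ** (mat s ** Z) = mat s ** (M ** Z)"
    by (simp add: matrix_mul_assoc)
qed

lemma mat_mult_mat: "mat s ** mat t = (mat (s * t) :: 'e::ring_1^'n^'n)"
  by (simp add: vec_eq_iff mat_mult_nth) (simp add: mat_def)

lemma commute_inverse:
  fixes x s t :: "'e::ring_1"
  assumes "x * s = s * x" "s * t = 1" "t * s = 1"
  shows "x * t = t * x"
proof -
  have "t * (x * s) * t = t * (s * x) * t" by (simp only: assms(1))
  then have "t * x * (s * t) = (t * s) * x * t" by (simp only: mult.assoc)
  then show ?thesis by (simp add: assms)
qed

text \<open>
  With \<open>v = u\<^sup>*\<close> and \<open>u\<^sup>* u = t\<close>, this is the projection onto the complement of the columns of
  \<open>u\<close>; since \<open>s\<close> commutes with \<open>u\<close> and \<open>u\<^sup>*\<close>, its position does not matter.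
\<close>
lemma isometry_projection:
  fixes u :: "'e::ring_1^'a^'n" and v :: "'e^'n^'a"
  assumes p: "p = mat 1 - mat s ** (u ** v)" and vu: "v ** u = mat t" and st: "s * t = 1" "t * s = 1"
    and comm: "commutes_entrywise s u" "commutes_entrywise s v"
  shows "p ** u = 0" "v ** p = 0" "p ** p = p"
proof -
  have tu: "u ** mat t = mat t ** u"
  proof -
    have "commutes_entrywise t u"
      using comm(1) unfolding commutes_entrywise_def by (metis commute_inverse st)
    then show ?thesis by (rule mat_commute)
  qed
  show pu: "p ** u = 0"
    unfolding p
    by (simp add: matrix_diff_mult matrix_mul_assoc[symmetric] vu tu) (simp add: matrix_mul_assoc mat_mult_mat st)
  show vp: "v ** p = 0"
    unfolding p
    by (simp add: matrix_mult_diff mat_commute[OF comm(2)]) (simp add: matrix_mul_assoc mat_mult_mat st vu)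
  have "p ** p = p - (mat s ** u) ** (v ** p)"
    by (subst (1) p) (simp add: matrix_diff_mult matrix_mul_assoc)
  then show "p ** p = p" using vp by (simp add: matrix_mult_zero)
qed

text \<open>
  For \<open>P = 1 - \<rho>\<^sup>-\<^sup>2 N\<close> the derivative of \<open>\<rho>\<^sup>-\<^sup>2\<close> enters \<open>dP\<close> only through a multiple of \<open>N\<close>,
  and \<open>P N = N P = 0\<close>.  So it drops out of \<open>P dP\<close> and of \<open>dP P\<close>.  Since \<open>P dP P = 0\<close>, the
  curvature equals \<open>(P dP) (dP P)\<close>, which contains \<open>dN\<close> alone.
\<close>
lemma curvature_by_numerator:
  fixes N P DN DP :: "'e::ring_1^'n^'n"
  assumes P: "P = mat 1 - mat S' ** N"
    and NN: "N ** N = mat S ** N" and S': "S' * S = 1" and S'N: "commutes_entrywise S' N"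
    and DP: "DP = - (mat DS' ** N + mat S' ** DN)" and Leibniz: "DP = DP ** P + P ** DP"
    and S'DN: "commutes_entrywise S' DN" and DS'N: "commutes_entrywise DS' N"
  shows "P ** (DP ** DP) = mat (S' * S') ** (P ** (DN ** (DN ** P)))"
proof -
  have S'S: "mat S' ** (mat S ** Z) = Z" for Z :: "'e^'n^'n"
    by (simp add: matrix_mul_assoc mat_mult_mat S')
  have PN: "P ** N = 0"
    unfolding P by (simp add: matrix_diff_mult matrix_mul_assoc[symmetric] NN S'S)
  have NP: "N ** P = 0"
    unfolding P by (simp add: matrix_mult_diff mat_commute[OF S'N] NN S'S)
  have S'P: "P ** (mat S' ** Z) = mat S' ** (P ** Z)" for Z :: "'e^'n^'n"
    unfolding P by (simp add: matrix_diff_mult matrix_mult_diff matrix_mul_assoc[symmetric] mat_commute[OF S'N])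
  \<comment> \<open>The derivative of \<open>S'\<close> disappears here.\<close>
  have "P ** (mat DS' ** N) = 0"
    unfolding mat_commute(1)[OF DS'N, symmetric] matrix_mul_assoc PN by (simp add: matrix_mult_zero)
  then have PDP: "P ** DP = - (mat S' ** (P ** DN))"
    unfolding DP matrix_uminus_mult matrix_add_ldistrib S'P by simp
  have DPP: "DP ** P = - (mat S' ** (DN ** P))"
    unfolding DP matrix_uminus_mult matrix_add_mult
    by (simp add: matrix_mul_assoc[symmetric] NP matrix_mult_zero)
  have PP: "P ** (P ** Z) = P ** Z" for Z :: "'e^'n^'n"
  proof -
    have "P ** P = P"
      by (subst (2) P) (simp add: matrix_mult_diff S'P PN matrix_mult_zero)
    then show ?thesis by (simp add: matrix_mul_assoc)
  qed
  have "P ** DP = P ** (DP ** P) + P ** DP"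
    by (subst (1) Leibniz) (simp add: matrix_add_ldistrib PP)
  then have PDPP: "P ** (DP ** P) = 0" by simp
  have "P ** (DP ** DP) = P ** (DP ** (DP ** P)) + P ** (DP ** (P ** DP))"
    by (subst (2) Leibniz) (simp add: matrix_add_ldistrib)
  also have "P ** (DP ** (P ** DP)) = (P ** (DP ** P)) ** DP"
    by (simp only: matrix_mul_assoc)
  also have "\<dots> = 0" by (simp add: PDPP matrix_mult_zero)
  also have "P ** (DP ** (DP ** P)) = (P ** DP) ** (DP ** P)"
    by (simp only: matrix_mul_assoc)
  also have "\<dots> = mat S' ** (P ** (DN ** (mat S' ** (DN ** P))))"
    unfolding PDP DPP by (simp add: matrix_uminus_mult matrix_mul_assoc[symmetric])
  also have "\<dots> = mat S' ** (mat S' ** (P ** (DN ** (DN ** P))))"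
    by (simp only: mat_commute[OF S'DN] S'P)
  finally show ?thesis by (simp add: matrix_mul_assoc mat_mult_mat)
qed

text \<open>
  The transformation law of the curvature.  Here \<open>U = X u\<close> and \<open>U\<^sup>* = v Y\<close> are the transforms of
  \<open>u\<close> and \<open>v = u\<^sup>*\<close>, so \<open>P\<close> annihilates \<open>X u\<close>, \<open>Y P\<close> is annihilated by \<open>v\<close>, and \<open>P X\<close>,
  \<open>Y P\<close> see only the range of \<open>p\<close>: this replaces \<open>P X d\<close> by \<open>P X p d\<close> and \<open>d Y P\<close> by \<open>d p Y P\<close>.
  As \<open>p d p = 0\<close>, the product \<open>p d\<close> ends in \<open>u v\<close> and \<open>d p\<close> starts with \<open>u v\<close>.  The two factors
  then meet in \<open>v Y X u = U\<^sup>* U\<close>, which is the scalar \<open>S\<close>, and \<open>p d d p\<close> remains.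
  The scalar \<open>S\<close> need not commute with \<open>X\<close> itself, but it does with the combination \<open>X p d u\<close>, past which
  it is taken out.
\<close>
lemma numerator_by_fibre:
  fixes u :: "'e::ring_1^'a^'n" and v :: "'e^'n^'a" and X Y p d P DN :: "'e^'n^'n"
  assumes p: "p = mat 1 - mat R' ** (u ** v)" and Leibniz: "d = d ** p + p ** d" and pu: "p ** u = 0" and vp: "v ** p = 0"
    and R: "R * R' = 1"
    and DN: "DN = mat R ** (X ** (d ** Y))"
    and PXu: "P ** (X ** u) = 0" and vYP: "v ** (Y ** P) = 0" and vYXu: "v ** (Y ** (X ** u)) = mat S"
    and comm_R: "commutes_entrywise R X" "commutes_entrywise R Y" "commutes_entrywise R P" "commutes_entrywise R d"
    and comm_R': "commutes_entrywise R' X" "commutes_entrywise R' Y" "commutes_entrywise R' P" "commutes_entrywise R' d"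
        "commutes_entrywise R' u" "commutes_entrywise R' v" "commutes_entrywise R' p"
    and comm_S: "commutes_entrywise S P" "commutes_entrywise S (X ** (p ** (d ** u)))" "R * S = S * R"
  shows "P ** (DN ** (DN ** P)) = mat (R * S) ** (P ** ((X ** ((p ** (d ** d)) ** Y)) ** P))"
proof -
  note assoc = matrix_mul_assoc[symmetric]
  note R_left = comm_R[THEN mat_commute(2)]
  note R'_left = comm_R'[THEN mat_commute(2)]
  have cancel: "mat R ** (mat R' ** Z) = Z" for Z :: "'e^'n^'n"
    by (simp add: matrix_mul_assoc mat_mult_mat R)
  \<comment> \<open>Decomposition of the identity into \<open>p\<close> and the projection onto the columns of \<open>u\<close>.\<close>
  have split: "Z = p ** Z + mat R' ** (u ** (v ** Z))" for Z :: "'e^'n^'n"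
    unfolding p by (simp add: matrix_diff_mult assoc)
  have pp: "p ** (p ** Z) = p ** Z" for Z :: "'e^'n^'n"
  proof -
    have "p ** (u ** (v ** Z)) = 0" by (simp add: matrix_mul_assoc pu matrix_mult_zero)
    then show ?thesis
      using arg_cong[OF split[of Z], of "\<lambda>Z. p ** Z"]
      by (simp add: matrix_add_ldistrib R'_left matrix_mult_zero)
  qed
  have "p ** (d ** p) = 0"
    using arg_cong[OF Leibniz, of "\<lambda>Z. p ** Z"] by (simp add: matrix_add_ldistrib pp)
  then have pdp: "p ** (d ** (p ** Z)) = 0" for Z :: "'e^'n^'n"
    by (simp add: matrix_mul_assoc matrix_mult_zero)
  have pd: "p ** (d ** Z) = mat R' ** (p ** (d ** (u ** (v ** Z))))" for Z :: "'e^'n^'n"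
    by (subst split[of Z]) (simp add: matrix_add_ldistrib pdp R'_left)
  have dp: "d ** (p ** Z) = mat R' ** (u ** (v ** (d ** (p ** Z))))" for Z :: "'e^'n^'n"
    by (subst split[of "d ** (p ** Z)"]) (simp add: pdp)
  have PX: "P ** (X ** Z) = P ** (X ** (p ** Z))" for Z :: "'e^'n^'n"
  proof -
    have "P ** (X ** (u ** (v ** Z))) = (P ** (X ** u)) ** (v ** Z)"
      by (simp only: assoc)
    then show ?thesis
      by (subst split[of Z]) (simp add: matrix_add_ldistrib R'_left PXu matrix_mult_zero)
  qed
  have YP: "Y ** P = p ** (Y ** P)"
    by (subst split[of "Y ** P"]) (simp add: vYP matrix_mult_zero)
  define T where "T = X ** (p ** (d ** u))"
  have XpduS: "T ** (mat S ** Z) = mat S ** (T ** Z)" for Z :: "'e^'n^'a"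
    unfolding T_def by (rule mat_commute(2)[OF comm_S(2)])
  have PS: "P ** (mat S ** Z) = mat S ** (P ** Z)" for Z :: "'e^'n^'n"
    by (rule mat_commute(2)[OF comm_S(1)])
  have "P ** (DN ** (DN ** P)) = mat R ** (mat R ** (P ** (X ** (d ** (Y ** (X ** (d ** (Y ** P))))))))"
    unfolding DN by (simp add: assoc R_left)
  also have "P ** (X ** (d ** (Y ** (X ** (d ** (Y ** P))))))
      = P ** (X ** (p ** (d ** (Y ** (X ** (d ** (p ** (Y ** P))))))))"
    by (subst PX) (simp only: YP[symmetric])
  also have "\<dots> = mat R' ** (mat R' ** (P ** (T ** (v ** (Y ** (X ** (u ** (v ** (d ** (p ** (Y ** P)))))))))))"
    by (subst pd, subst dp) (simp add: R'_left T_def assoc)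
  also have "v ** (Y ** (X ** (u ** (v ** (d ** (p ** (Y ** P)))))))
      = (v ** (Y ** (X ** u))) ** (v ** (d ** (p ** (Y ** P))))"
    by (simp only: assoc)
  also have "\<dots> = mat S ** (v ** (d ** (p ** (Y ** P))))" by (simp only: vYXu)
  also have "P ** (T ** (mat S ** (v ** (d ** (p ** (Y ** P))))))
      = mat S ** (P ** (T ** (v ** (d ** (p ** (Y ** P))))))"
    by (simp only: XpduS PS)
  also have "P ** (T ** (v ** (d ** (p ** (Y ** P)))))
      = mat R ** (P ** (X ** (mat R' ** (p ** (d ** (u ** (v ** (d ** (p ** (Y ** P)))))))))) "
    by (simp add: T_def assoc R'_left R_left cancel)
  also have "mat R' ** (p ** (d ** (u ** (v ** (d ** (p ** (Y ** P)))))))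
      = p ** (d ** (d ** (p ** (Y ** P))))"
    by (simp only: pd[symmetric])
  also have "p ** (Y ** P) = Y ** P" by (simp only: YP[symmetric])
  also have "mat R ** (mat R ** (mat R' ** (mat R' ** (mat S ** (mat R ** (P ** (X ** (p ** (d ** (d ** (Y ** P))))))))))) 
      = mat (R * S) ** (P ** ((X ** ((p ** (d ** d)) ** Y)) ** P))"
    by (simp add: cancel assoc) (simp add: matrix_mul_assoc mat_mult_mat comm_S(3))
  finally show ?thesis .
qed

section \<open>Products in the cobosonisation\<close>

lemma cobos_mult_single:
  assumes "hcomp n b = b"
  shows "cobos_mult \<theta> (Poly_Mapping.single g a) (Poly_Mapping.single h b)
    = inverse (bichar \<theta> n g ^ 2) *\<^sub>C Poly_Mapping.single (g + h) (cotwist \<theta> a b)"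
proof (cases "a = 0 \<or> b = 0")
  case False
  then show ?thesis
    using assms by (simp add: cobos_mult_def Let_def hcomp_support[OF assms] scaleC_single)
next
  case True
  then show ?thesis by (auto simp: cobos_mult_def)
qed

lemma cobos_mult_unit_right:
  "cobos_mult \<theta> (Poly_Mapping.single g a) (Poly_Mapping.single 0 1) = Poly_Mapping.single g a"
  by (simp add: cobos_mult_single[OF hcomp_one] scaleC_one cotwist_invariant_right[OF hcomp_one])

lemma cobos_mult_unit_left:
  assumes "hcomp n a = a"
  shows "cobos_mult \<theta> (Poly_Mapping.single 0 1) (Poly_Mapping.single g a) = Poly_Mapping.single g a"
  by (simp add: cobos_mult_single[OF assms] scaleC_one cotwist_invariant_left[OF hcomp_one])

lemma hcomp_A_hat: "hcomp (tau_weight i - tau_weight j) (A_hat \<theta> i j) = A_hat \<theta> i j"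
proof -
  have "hcomp (tau_weight i - tau_weight j) (A_mat $ i $ j) = A_mat $ i $ j"
    using poly_mat_homog[of i j] by (simp add: A_mat_def hcomp_abs_homog gen_weight_mat_var_def)
  then show ?thesis by (simp add: A_hat_def hcomp_scaleC)
qed

abbreviation A_tau :: "real \<Rightarrow> 4 \<Rightarrow> 4 \<Rightarrow> cobos"
  where "A_tau \<theta> i \<beta> \<equiv> Poly_Mapping.single (tau_weight \<beta>) (A_hat \<theta> i \<beta>)"

text \<open>
  The braiding \<open>F\<^sup>-\<^sup>2\<close> of the semidirect product turns the mixed phases of the cotwist into the
  symmetric form of a quantum matrix relation: one phase for the row indices and the inverse
  phase for the column indices.
\<close>
lemma A_tau_commute:
  "cobos_mult \<theta> (A_tau \<theta> i \<beta>) (A_tau \<theta> j \<gamma>) =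
    ((bichar \<theta> (tau_weight i) (tau_weight j))\<^sup>2 / (bichar \<theta> (tau_weight \<beta>) (tau_weight \<gamma>))\<^sup>2) *\<^sub>C
    cobos_mult \<theta> (A_tau \<theta> j \<gamma>) (A_tau \<theta> i \<beta>)"
proof -
  have eq: "cobos_mult \<theta> (A_tau \<theta> i \<beta>) (A_tau \<theta> j \<gamma>) =
    (inverse (bichar \<theta> (tau_weight j - tau_weight \<gamma>) (tau_weight \<beta>) ^ 2)
      * bichar \<theta> (tau_weight i - tau_weight \<beta>) (tau_weight j - tau_weight \<gamma>)) *\<^sub>C
    Poly_Mapping.single (tau_weight \<beta> + tau_weight \<gamma>) (A_hat \<theta> i \<beta> * A_hat \<theta> j \<gamma>)" for i \<beta> j \<gamma>
    by (simp add: cobos_mult_single[OF hcomp_A_hat] cotwist_homogeneous[OF hcomp_A_hat hcomp_A_hat]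
        scaleC_single[symmetric] scaleC_scaleC)
  have swap: "bichar \<theta> (tau_weight j) (tau_weight i) = inverse (bichar \<theta> (tau_weight i) (tau_weight j))"
    "bichar \<theta> (tau_weight \<gamma>) (tau_weight \<beta>) = inverse (bichar \<theta> (tau_weight \<beta>) (tau_weight \<gamma>))"
    "bichar \<theta> (tau_weight \<gamma>) (tau_weight i) = inverse (bichar \<theta> (tau_weight i) (tau_weight \<gamma>))"
    "bichar \<theta> (tau_weight j) (tau_weight \<beta>) = inverse (bichar \<theta> (tau_weight \<beta>) (tau_weight j))"
    by (rule bichar_swap)+
  \<comment> \<open>The letters are \<open>a = F(\<tau>\<^sub>i, \<tau>\<^sub>j)\<close>, \<open>b = F(\<tau>\<^sub>\<beta>, \<tau>\<^sub>\<gamma>)\<close>, \<open>d = F(\<tau>\<^sub>\<beta>, \<tau>\<^sub>j)\<close>, \<open>e = F(\<tau>\<^sub>i, \<tau>\<^sub>\<gamma>)\<close>; the last two cancel.\<close>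
  have factor: "inverse ((inverse d / inverse b)\<^sup>2) * (a / d / (e / b))
      = a\<^sup>2 / b\<^sup>2 * (inverse ((e / b)\<^sup>2) * (inverse a / inverse e / (inverse d / inverse b)))"
    if "a \<noteq> 0" "b \<noteq> 0" "d \<noteq> 0" "e \<noteq> 0" for a b d e :: complex
    using that by (simp add: field_simps power2_eq_square)
  let ?Z = "Poly_Mapping.single (tau_weight \<beta> + tau_weight \<gamma>) (A_hat \<theta> i \<beta> * A_hat \<theta> j \<gamma>)"
  have swapped: "cobos_mult \<theta> (A_tau \<theta> j \<gamma>) (A_tau \<theta> i \<beta>) =
    (inverse (bichar \<theta> (tau_weight i - tau_weight \<beta>) (tau_weight \<gamma>) ^ 2)
      * bichar \<theta> (tau_weight j - tau_weight \<gamma>) (tau_weight i - tau_weight \<beta>)) *\<^sub>C ?Z"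
    using eq[of \<gamma> j \<beta> i] by (simp only: mult.commute[of "A_hat \<theta> j \<gamma>"] add.commute[of "tau_weight \<gamma>"])
  show ?thesis
    unfolding eq[of \<beta> i \<gamma> j] swapped scaleC_scaleC bichar_diff swap
    by (subst factor) simp_all
qed

section \<open>Quantum-plane relations between the coaction and forms\<close>

context localised_coaction
begin

definition form_incl :: "forms \<Rightarrow> 'e"
  where "form_incl \<omega> = \<iota> (Poly_Mapping.single 0 1 \<otimes>\<^sub>C \<omega>)"

lemma form_incl_mult: "form_incl \<omega> * form_incl \<eta> = form_incl (cotwist \<theta> \<omega> \<eta>)"
  by (simp add: form_incl_def \<iota>_mult cobos_mult_unit_right)

lemma form_incl_add: "form_incl (\<omega> + \<eta>) = form_incl \<omega> + form_incl \<eta>"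
  by (simp add: form_incl_def pure_tensor_add_right \<iota>_add)

lemma form_incl_scaleC: "form_incl (c *\<^sub>C \<omega>) = c *\<^sub>C form_incl \<omega>"
  by (simp add: form_incl_def pure_tensor_scaleC_right \<iota>_scaleC)

lemma form_incl_zero [simp]: "form_incl 0 = 0"
  using form_incl_add[of 0 0] by simp

lemma form_incl_sum: "form_incl (sum f A) = (\<Sum>x\<in>A. form_incl (f x))"
  by (induction A rule: infinite_finite_induct) (auto simp: form_incl_add)

lemma form_incl_one: "form_incl 1 = 1"
  by (simp add: form_incl_def \<iota>_one)

lemma hcomp_one_form: "hcomp 0 (1 :: forms) = 1"
  using hcomp_zero_form[of 0 1] by (simp add: function_form_one hcomp_one)

lemma \<iota>_split:
  "\<iota> (Poly_Mapping.single g a \<otimes>\<^sub>C \<omega>) = \<iota> (Poly_Mapping.single g a \<otimes>\<^sub>C 1) * form_incl \<omega>"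
  by (simp add: form_incl_def \<iota>_mult cobos_mult_unit_right cotwist_invariant_left[OF hcomp_one_form])

text \<open>
  The transformation acts on \<open>u\<close> by \<open>U = X u\<close> and on \<open>u\<^sup>*\<close> by \<open>U\<^sup>* = u\<^sup>* Y\<close>, with \<open>Y\<close>
  obtained from \<open>X\<close> by quaternionic conjugation of rows and columns.  The suffix \<open>_E\<close> marks
  matrices of forms on the sphere, included in the target algebra.
\<close>
definition X_mat :: "'e^4^4"
  where "X_mat = (\<chi> i \<beta>. \<iota> (A_tau \<theta> i \<beta> \<otimes>\<^sub>C 1))"

lemma form_incl_X: "form_incl \<omega> * X_mat $ i $ \<beta> = X_mat $ i $ \<beta> * form_incl \<omega>"
  by (simp add: X_mat_def form_incl_def \<iota>_mult cobos_mult_unit_right cobos_mult_unit_left[OF hcomp_A_hat]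
      cotwist_invariant_left[OF hcomp_one_form] cotwist_invariant_right[OF hcomp_one_form])

lemma X_commute:
  "X_mat $ i $ \<beta> * X_mat $ j $ \<gamma> =
    ((bichar \<theta> (tau_weight i) (tau_weight j))\<^sup>2 / (bichar \<theta> (tau_weight \<beta>) (tau_weight \<gamma>))\<^sup>2) *\<^sub>C
      (X_mat $ j $ \<gamma> * X_mat $ i $ \<beta>)"
  unfolding X_mat_def
  by (simp add: \<iota>_mult pure_tensor_scaleC_left \<iota>_scaleC) (subst A_tau_commute, simp add: pure_tensor_scaleC_left \<iota>_scaleC)

lemma form_incl_twisted_commute:
  assumes "hcomp n \<omega> = \<omega>" "hcomp m f = f"
  shows "form_incl \<omega> * form_incl (function_form f) =
    (bichar \<theta> n m)\<^sup>2 *\<^sub>C (form_incl (function_form f) * form_incl \<omega>)"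
proof -
  have f: "hcomp m (function_form f) = function_form f"
    using assms(2) by (simp add: hcomp_zero_form)
  show ?thesis
    unfolding form_incl_mult cotwist_homogeneous[OF assms(1) f] cotwist_homogeneous[OF f assms(1)]
    by (simp add: form_incl_scaleC scaleC_scaleC function_form_commute bichar_swap[of \<theta> m n] power2_eq_square mult.assoc)
qed

lemma form_incl_central:
  assumes "hcomp 0 f = f"
  shows "form_incl (function_form f) * form_incl \<omega> = form_incl \<omega> * form_incl (function_form f)"
proof -
  have "hcomp 0 (function_form f) = function_form f" using assms by (simp add: hcomp_zero_form)
  then show ?thesis
    by (simp add: form_incl_mult cotwist_invariant_left cotwist_invariant_right function_form_commute)
qed

definition exchange_factor :: "weight \<times> weight \<Rightarrow> weight \<times> weight \<Rightarrow> complex"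
  where "exchange_factor k l = (bichar \<theta> (fst k) (fst l))\<^sup>2 * (bichar \<theta> (snd k) (snd l))\<^sup>2"

lemma exchange_factor_add: "exchange_factor (k + k') l = exchange_factor k l * exchange_factor k' l"
  by (simp add: exchange_factor_def bichar_add_left power_mult_distrib)

text \<open>
  Every element that occurs commutes up to a phase with the products \<open>X\<^sub>j\<^sub>\<gamma> u\<^sub>\<gamma>\<^sub>b\<close>, the summands of
  \<open>U\<^sub>j\<^sub>b\<close>.  The phase depends on the outer index \<open>j\<close> and on the summation index \<open>\<gamma>\<close>; a charge is the
  pair of weights that produce it.  A charge with second component zero gives the same phase for all
  summands, so the element commutes up to a phase with \<open>U\<^sub>j\<^sub>b\<close>, hence with \<open>N\<close> and \<open>P\<close>.
\<close>
definition charged :: "weight \<times> weight \<Rightarrow> 'e \<Rightarrow> bool"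
  where "charged k x \<longleftrightarrow> (\<forall>j \<gamma> b. let g = X_mat $ j $ \<gamma> * form_incl (function_form (u_mat $ \<gamma> $ b)) in
    x * g = exchange_factor k (tau_weight j, tau_weight \<gamma>) *\<^sub>C (g * x))"

lemma charged_zero: "charged k 0"
  by (simp add: charged_def)

lemma charged_add: "charged k x \<Longrightarrow> charged k y \<Longrightarrow> charged k (x + y)"
  by (simp add: charged_def Let_def distrib_left distrib_right scaleC_add_right)

lemma charged_scaleC: "charged k x \<Longrightarrow> charged k (c *\<^sub>C x)"
  by (simp add: charged_def Let_def scaleC_mult_left scaleC_mult_right scaleC_scaleC mult.commute)

lemma charged_sum: "(\<And>x. x \<in> A \<Longrightarrow> charged k (f x)) \<Longrightarrow> charged k (sum f A)"
  by (induction A rule: infinite_finite_induct) (auto intro: charged_zero charged_add)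

lemma charged_mult:
  assumes "charged k x" "charged l y"
  shows "charged (k + l) (x * y)"
  unfolding charged_def Let_def
proof (intro allI)
  fix j \<gamma> b
  let ?g = "X_mat $ j $ \<gamma> * form_incl (function_form (u_mat $ \<gamma> $ b))"
  let ?t = "(tau_weight j, tau_weight \<gamma>)"
  have "x * y * ?g = exchange_factor l ?t *\<^sub>C (x * ?g * y)"
    using assms(2) by (simp add: charged_def Let_def mult.assoc scaleC_mult_right)
  also have "x * ?g = exchange_factor k ?t *\<^sub>C (?g * x)"
    using assms(1) by (simp add: charged_def Let_def)
  finally show "x * y * ?g = exchange_factor (k + l) ?t *\<^sub>C (?g * (x * y))"
    by (simp add: scaleC_mult_left scaleC_scaleC exchange_factor_add mult.assoc mult.commute)
qed

lemma charged_form_incl: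
  assumes "hcomp n \<omega> = \<omega>"
  shows "charged (0, n) (form_incl \<omega>)"
  unfolding charged_def Let_def
proof (intro allI)
  fix j \<gamma> b
  let ?f = "form_incl (function_form (u_mat $ \<gamma> $ b))"
  have "form_incl \<omega> * (X_mat $ j $ \<gamma> * ?f) = X_mat $ j $ \<gamma> * (form_incl \<omega> * ?f)"
    by (simp only: mult.assoc[symmetric] form_incl_X)
  then show "form_incl \<omega> * (X_mat $ j $ \<gamma> * ?f)
      = exchange_factor (0, n) (tau_weight j, tau_weight \<gamma>) *\<^sub>C (X_mat $ j $ \<gamma> * ?f * form_incl \<omega>)"
    by (simp add: form_incl_twisted_commute[OF assms hcomp_u_mat] scaleC_mult_right exchange_factor_def mult.assoc)
qed

lemma charged_X: "charged (tau_weight i, - tau_weight \<beta>) (X_mat $ i $ \<beta>)"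
  unfolding charged_def Let_def
proof (intro allI)
  fix j \<gamma> b
  let ?f = "form_incl (function_form (u_mat $ \<gamma> $ b))"
  have "X_mat $ i $ \<beta> * (X_mat $ j $ \<gamma> * ?f) = (X_mat $ i $ \<beta> * X_mat $ j $ \<gamma>) * ?f"
    by (simp only: mult.assoc)
  also have "\<dots> = exchange_factor (tau_weight i, - tau_weight \<beta>) (tau_weight j, tau_weight \<gamma>) *\<^sub>C
      (X_mat $ j $ \<gamma> * (X_mat $ i $ \<beta> * ?f))"
    by (subst X_commute)
      (simp add: scaleC_mult_left exchange_factor_def bichar_uminus power_inverse divide_inverse mult.assoc)
  also have "X_mat $ i $ \<beta> * ?f = ?f * X_mat $ i $ \<beta>" by (simp only: form_incl_X)
  finally show "X_mat $ i $ \<beta> * (X_mat $ j $ \<gamma> * ?f) = exchange_factor (tau_weight i, - tau_weight \<beta>)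
      (tau_weight j, tau_weight \<gamma>) *\<^sub>C (X_mat $ j $ \<gamma> * ?f * X_mat $ i $ \<beta>)"
    by (simp only: mult.assoc)
qed

text \<open>
  Charges add under products, so for a matrix it is enough to record a charge for each row and
  column index; the contracted index cancels in a matrix product.
\<close>
definition matrix_charged :: "('m::finite \<Rightarrow> weight \<times> weight) \<Rightarrow> ('n::finite \<Rightarrow> weight \<times> weight) \<Rightarrow> 'e^'n^'m \<Rightarrow> bool"
  where "matrix_charged f g M \<longleftrightarrow> (\<forall>i j. charged (f i - g j) (M $ i $ j))"

lemma matrix_charged_mult:
  assumes "matrix_charged f g M" "matrix_charged g h M'"
  shows "matrix_charged f h (M ** M')"
  unfolding matrix_charged_def matrix_matrix_mult_def
proof (intro allI)
  fix i j
  have "charged (f i - h j) (M $ i $ k * M' $ k $ j)" for k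
    using charged_mult[of "f i - g k" "M $ i $ k" "g k - h j" "M' $ k $ j"] assms by (simp add: matrix_charged_def)
  then show "charged (f i - h j) ((\<chi> i j. \<Sum>k\<in>UNIV. M $ i $ k * M' $ k $ j) $ i $ j)"
    by (simp add: charged_sum)
qed

text \<open>
  \<open>X\<close> carries outer charge on its rows and inner charge on its columns, and \<open>u\<close> carries inner
  charge on its rows.  Contracting them leaves outer charge only.
\<close>
abbreviation outer :: "4 \<Rightarrow> weight \<times> weight" where "outer i \<equiv> (tau_weight i, 0)"
abbreviation inner :: "4 \<Rightarrow> weight \<times> weight" where "inner \<beta> \<equiv> (0, tau_weight \<beta>)"
abbreviation neutral :: "2 \<Rightarrow> weight \<times> weight" where "neutral a \<equiv> 0"

definition u_E :: "'e^2^4" where "u_E = (\<chi> \<beta> a. form_incl (function_form (u_mat $ \<beta> $ a)))"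
definition u_star_E :: "'e^4^2" where "u_star_E = (\<chi> a \<beta>. form_incl (function_form (alg_star (u_mat $ \<beta> $ a))))"
definition Y_mat :: "'e^4^4"
  where "Y_mat = (\<chi> \<delta> j. (row_sign j * row_sign \<delta>) *\<^sub>C X_mat $ conj_row j $ conj_row \<delta>)"

definition U_mat :: "'e^2^4" where "U_mat = (\<chi> i a. \<Delta>\<^sub>L (u_mat $ i $ a))"
definition U_star :: "'e^4^2" where "U_star = (\<chi> a i. \<Delta>\<^sub>L (alg_star (u_mat $ i $ a)))"

lemma charged_matrices:
  "matrix_charged outer inner X_mat" "matrix_charged inner neutral u_E"
  "matrix_charged neutral inner u_star_E" "matrix_charged inner outer Y_mat"
proof -
  show "matrix_charged outer inner X_mat"
    using charged_X by (simp add: matrix_charged_def)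
  show "matrix_charged inner neutral u_E"
    by (simp add: matrix_charged_def u_E_def charged_form_incl hcomp_zero_form hcomp_u_mat)
  show "matrix_charged neutral inner u_star_E"
    by (simp add: matrix_charged_def u_star_E_def charged_form_incl hcomp_zero_form hcomp_u_star)
  have "charged (inner \<delta> - outer j) (Y_mat $ \<delta> $ j)" for \<delta> j
    using charged_scaleC[OF charged_X[of "conj_row j" "conj_row \<delta>"]]
    by (simp add: Y_mat_def tau_weight_conj_row)
  then show "matrix_charged inner outer Y_mat" by (simp add: matrix_charged_def)
qed

lemma U_mat_eq: "U_mat = X_mat ** u_E"
  by (simp add: vec_eq_iff U_mat_def matrix_matrix_mult_def coaction_u X_mat_def u_E_def \<iota>_split[of _ _ "function_form _"])

lemma U_star_nth: "U_star $ a $ i = (row_sign i * col_sign a) *\<^sub>C U_mat $ conj_row i $ conj_col a"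
  by (simp add: U_star_def U_mat_def alg_star_u_mat coaction_scaleC)

lemma u_star_E_nth: "u_star_E $ a $ i = (row_sign i * col_sign a) *\<^sub>C u_E $ conj_row i $ conj_col a"
  by (simp add: u_star_E_def u_E_def alg_star_u_mat function_form_scaleC form_incl_scaleC)

text \<open>
  As \<open>u\<^sup>*\<close> is \<open>u\<close> with rows and columns conjugated, the relation \<open>U = X u\<close> is reindexed; the
  factors change order because \<open>X\<close> commutes with forms on the sphere.
\<close>
lemma U_star_eq: "U_star = u_star_E ** Y_mat"
proof -
  have "U_star $ a $ j = (u_star_E ** Y_mat) $ a $ j" for a j
  proof -
    have "U_star $ a $ j = (\<Sum>\<gamma>\<in>UNIV. (row_sign j * col_sign a) *\<^sub>C (X_mat $ conj_row j $ \<gamma> * u_E $ \<gamma> $ conj_col a))"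
      by (simp add: U_star_nth U_mat_eq matrix_matrix_mult_def scaleC_sum_right)
    also have "\<dots> = (\<Sum>\<delta>\<in>UNIV. (row_sign j * col_sign a) *\<^sub>C
        (X_mat $ conj_row j $ conj_row \<delta> * u_E $ conj_row \<delta> $ conj_col a))"
      by (rule sum.reindex_bij_witness[where i = conj_row and j = conj_row]) auto
    also have "\<dots> = (\<Sum>\<delta>\<in>UNIV. u_star_E $ a $ \<delta> * Y_mat $ \<delta> $ j)"
    proof (intro sum.cong refl)
      fix \<delta>
      have "u_star_E $ a $ \<delta> * Y_mat $ \<delta> $ j = (row_sign \<delta> * col_sign a * (row_sign j * row_sign \<delta>)) *\<^sub>C
          (u_E $ conj_row \<delta> $ conj_col a * X_mat $ conj_row j $ conj_row \<delta>)"
        by (simp only: u_star_E_nth Y_mat_def vec_lambda_beta scaleC_mult_left scaleC_mult_right scaleC_scaleC)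
          (simp only: mult.commute)
      also have "row_sign \<delta> * col_sign a * (row_sign j * row_sign \<delta>) = row_sign j * col_sign a"
        by (simp add: row_sign_def)
      finally show "(row_sign j * col_sign a) *\<^sub>C (X_mat $ conj_row j $ conj_row \<delta> * u_E $ conj_row \<delta> $ conj_col a)
          = u_star_E $ a $ \<delta> * Y_mat $ \<delta> $ j"
        by (simp add: u_E_def form_incl_X)
    qed
    finally show ?thesis by (simp add: matrix_matrix_mult_def)
  qed
  then show ?thesis by (simp add: vec_eq_iff)
qed

section \<open>The transformed instanton projection\<close>

abbreviation rho_sq :: 'e where "rho_sq \<equiv> \<Delta>\<^sub>L r_sq"
abbreviation rho_inv2 :: 'e where "rho_inv2 \<equiv> \<Delta>\<^sub>L r_inv2"
abbreviation r_sq_E :: 'e where "r_sq_E \<equiv> form_incl (function_form r_sq)"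
abbreviation r_inv2_E :: 'e where "r_inv2_E \<equiv> form_incl (function_form r_inv2)"

definition N_mat :: "'e^4^4" where "N_mat = U_mat ** U_star"
definition P_mat :: "'e^4^4" where "P_mat = map_matrix \<Delta>\<^sub>L (basic_projection \<theta>)"
definition p_E :: "'e^4^4" where "p_E = (\<chi> i j. form_incl (function_form (basic_projection \<theta> $ i $ j)))"

lemma coaction_zero [simp]: "\<Delta>\<^sub>L 0 = 0"
  using coaction_add[of 0 0] by simp

lemma coaction_sum: "\<Delta>\<^sub>L (sum f A) = (\<Sum>x\<in>A. \<Delta>\<^sub>L (f x))"
  by (induction A rule: infinite_finite_induct) (auto simp: coaction_add)

lemma coaction_diff: "\<Delta>\<^sub>L (f - g) = \<Delta>\<^sub>L f - \<Delta>\<^sub>L g"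
  using coaction_add[of "f - g" g] by simp

lemma form_incl_diff: "form_incl (\<omega> - \<eta>) = form_incl \<omega> - form_incl \<eta>"
  using form_incl_add[of "\<omega> - \<eta>" \<eta>] by simp

lemma function_incl_mult:
  assumes "hcomp m f = f" "hcomp n g = g"
  shows "form_incl (function_form f) * form_incl (function_form g) = form_incl (function_form (cotwist \<theta> f g))"
  by (simp add: form_incl_mult function_form_cotwist[OF assms])

lemma N_mat_nth: "N_mat $ i $ j = \<Delta>\<^sub>L (uu_star \<theta> $ i $ j)"
  by (simp add: N_mat_def matrix_matrix_mult_def U_mat_def U_star_def uu_star_def coaction_sum coaction_mult)

lemma U_star_U: "U_star ** U_mat = mat rho_sq"
  by (simp add: vec_eq_iff matrix_matrix_mult_def U_mat_def U_star_def mat_def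
      coaction_mult[symmetric] coaction_sum[symmetric] u_star_u)

lemma u_star_u_E: "u_star_E ** u_E = mat r_sq_E"
  by (simp add: vec_eq_iff matrix_matrix_mult_def u_E_def u_star_E_def mat_def
      function_incl_mult[OF hcomp_u_star hcomp_u_mat] form_incl_sum[symmetric] function_form_sum[symmetric] u_star_u)

lemma u_E_u_star_E_nth: "(u_E ** u_star_E) $ i $ j = form_incl (function_form (uu_star \<theta> $ i $ j))"
  by (simp add: matrix_matrix_mult_def u_E_def u_star_E_def uu_star_def
      function_incl_mult[OF hcomp_u_mat hcomp_u_star] form_incl_sum function_form_sum)

lemma rho_inverse: "rho_inv2 * rho_sq = 1" "rho_sq * rho_inv2 = 1"
  using coaction_mult[of r_inv2 r_sq] coaction_mult[of r_sq r_inv2]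
  by (simp_all add: cotwist_invariant_left hcomp_r_inv2 hcomp_r_sq r_inv2_r_sq coaction_one mult.commute[of r_sq])

lemma r_inverse_E: "r_inv2_E * r_sq_E = 1" "r_sq_E * r_inv2_E = 1"
  using function_incl_mult[OF hcomp_r_inv2 hcomp_r_sq] function_incl_mult[OF hcomp_r_sq hcomp_r_inv2]
  by (simp_all add: cotwist_invariant_left hcomp_r_inv2 hcomp_r_sq r_inv2_r_sq mult.commute[of r_sq]
      function_form_one form_incl_one)

lemma P_mat_eq: "P_mat = mat 1 - mat rho_inv2 ** N_mat"
proof -
  have "\<Delta>\<^sub>L (r_inv2 * uu_star \<theta> $ i $ j) = rho_inv2 * N_mat $ i $ j" for i j
    by (simp add: N_mat_nth coaction_mult[symmetric] cotwist_invariant_left[OF hcomp_r_inv2])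
  then show ?thesis
    by (simp add: vec_eq_iff P_mat_def map_matrix_def basic_projection_eq coaction_diff mat_mult_nth)
      (simp add: mat_def coaction_one)
qed

lemma p_E_eq: "p_E = mat 1 - mat r_inv2_E ** (u_E ** u_star_E)"
proof -
  have "form_incl (function_form (r_inv2 * uu_star \<theta> $ i $ j)) = r_inv2_E * form_incl (function_form (uu_star \<theta> $ i $ j))" for i j
    by (simp add: function_incl_mult[OF hcomp_r_inv2 hcomp_uu_star] cotwist_invariant_left[OF hcomp_r_inv2])
  moreover have "function_form (f - g) = function_form f - function_form g" for f g
    using function_form_add[of "f - g" g] by simp
  ultimately show ?thesis
    by (simp add: vec_eq_iff p_E_def basic_projection_eq form_incl_diff mat_mult_nth u_E_u_star_E_nth)
      (simp add: mat_def function_form_one form_incl_one)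
qed

lemma N_mat_eq: "N_mat = X_mat ** ((u_E ** u_star_E) ** Y_mat)"
  by (simp add: N_mat_def U_mat_eq U_star_eq matrix_mul_assoc)

lemma rho_sq_eq: "rho_sq = N_mat $ 1 $ 1 + N_mat $ 3 $ 3"
  by (simp add: N_mat_nth coaction_add[symmetric] r_sq_eq_uu_star[symmetric])

text \<open>
  Needed to apply \<open>id \<otimes> d\<close> and \<open>id \<otimes> *\<close>, which are given only on elements \<open>a \<otimes> \<omega>\<close>: the two outer
  factors combine to a single \<open>a\<close>, which depends on the indices but not on \<open>\<omega>\<close>.
\<close>
lemma X_form_Y_in_range:
  "\<exists>a. \<forall>\<omega>. X_mat $ i $ \<beta> * (form_incl \<omega> * Y_mat $ \<gamma> $ j) = \<iota> (a \<otimes>\<^sub>C \<omega>)"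
proof -
  \<comment> \<open>The element \<open>a\<close> is a single \<open>c \<otimes> g\<close> with \<open>g\<close> group-like, so that \<open>a 1 = a\<close> applies.\<close>
  obtain g c where gc: "(row_sign j * row_sign \<gamma>) *\<^sub>C cobos_mult \<theta> (A_tau \<theta> i \<beta>) (A_tau \<theta> (conj_row j) (conj_row \<gamma>))
      = Poly_Mapping.single g c"
    unfolding cobos_mult_single[OF hcomp_A_hat] scaleC_single by blast
  have "X_mat $ i $ \<beta> * (form_incl \<omega> * Y_mat $ \<gamma> $ j) = \<iota> (Poly_Mapping.single g c \<otimes>\<^sub>C \<omega>)" for \<omega>
  proof -
    have "X_mat $ i $ \<beta> * (form_incl \<omega> * Y_mat $ \<gamma> $ j) = X_mat $ i $ \<beta> * Y_mat $ \<gamma> $ j * form_incl \<omega>"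
      by (simp add: Y_mat_def scaleC_mult_left scaleC_mult_right form_incl_X mult.assoc)
    also have "X_mat $ i $ \<beta> * Y_mat $ \<gamma> $ j = \<iota> (Poly_Mapping.single g c \<otimes>\<^sub>C 1)"
      by (simp add: gc[symmetric] X_mat_def Y_mat_def scaleC_mult_right \<iota>_mult cotwist_invariant_left[OF hcomp_one_form]
          pure_tensor_scaleC_left \<iota>_scaleC)
    finally show ?thesis by (simp only: \<iota>_split[symmetric])
  qed
  then show ?thesis by blast
qed

lemma matrix_charged_projection:
  assumes "matrix_charged f f (M :: 'e^'n^'n)" "charged 0 s"
  shows "matrix_charged f f (mat 1 - mat s ** M)"
proof -
  have one: "charged 0 1"
    by (simp add: charged_def exchange_factor_def scaleC_one)
  have "charged (f i - f j) ((if i = j then 1 else 0) + (- 1) *\<^sub>C (s * M $ i $ j))" for i j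
    using one charged_zero charged_mult[OF assms(2), of "f i - f j" "M $ i $ j"] assms(1)
    by (intro charged_add charged_scaleC) (auto simp: matrix_charged_def)
  then show ?thesis
    by (auto simp: matrix_charged_def mat_mult_nth scaleC_minus_left scaleC_one) (simp_all add: mat_def)
qed

lemma charged_inverse:
  assumes "charged 0 s" "s * t = 1" "t * s = 1"
  shows "charged 0 t"
  unfolding charged_def Let_def
proof (intro allI)
  fix j \<gamma> b
  let ?g = "X_mat $ j $ \<gamma> * form_incl (function_form (u_mat $ \<gamma> $ b))"
  have "s * ?g = ?g * s"
    using assms(1) by (simp add: charged_def Let_def exchange_factor_def scaleC_one)
  then have "t * (s * ?g) * t = t * (?g * s) * t" by simp
  then have "(t * s) * ?g * t = t * ?g * (s * t)" by (simp only: mult.assoc)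
  then show "t * ?g = exchange_factor 0 (tau_weight j, tau_weight \<gamma>) *\<^sub>C (?g * t)"
    by (simp add: assms exchange_factor_def scaleC_one)
qed

lemma charged_past_U:
  assumes "charged (n, 0) x"
  shows "x * U_mat $ j $ b = (bichar \<theta> n (tau_weight j))\<^sup>2 *\<^sub>C (U_mat $ j $ b * x)"
proof -
  have "x * (X_mat $ j $ \<gamma> * u_E $ \<gamma> $ b) = (bichar \<theta> n (tau_weight j))\<^sup>2 *\<^sub>C (X_mat $ j $ \<gamma> * u_E $ \<gamma> $ b * x)" for \<gamma>
    using assms by (simp add: charged_def Let_def exchange_factor_def u_E_def)
  then show ?thesis
    by (simp add: U_mat_eq matrix_matrix_mult_def sum_distrib_left sum_distrib_right scaleC_sum_right)
qed

lemma charged_past_N: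
  assumes "charged (n, 0) x"
  shows "x * N_mat $ j $ l = (bichar \<theta> n (tau_weight j - tau_weight l))\<^sup>2 *\<^sub>C (N_mat $ j $ l * x)"
proof -
  have "x * (U_mat $ j $ a * U_star $ a $ l)
      = (bichar \<theta> n (tau_weight j - tau_weight l))\<^sup>2 *\<^sub>C (U_mat $ j $ a * U_star $ a $ l * x)" for a
  proof -
    have "x * U_star $ a $ l = (bichar \<theta> n (- tau_weight l))\<^sup>2 *\<^sub>C (U_star $ a $ l * x)"
      by (simp add: U_star_nth scaleC_mult_left scaleC_mult_right charged_past_U[OF assms] tau_weight_conj_row
          scaleC_scaleC mult.commute)
    then have "x * (U_mat $ j $ a * U_star $ a $ l) = ((bichar \<theta> n (tau_weight j))\<^sup>2 * (bichar \<theta> n (- tau_weight l))\<^sup>2)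
        *\<^sub>C (U_mat $ j $ a * U_star $ a $ l * x)"
      unfolding mult.assoc[symmetric] charged_past_U[OF assms]
      by (simp add: scaleC_mult_left scaleC_mult_right scaleC_scaleC mult.assoc)
    then show ?thesis
      by (simp add: bichar_add_right[of \<theta> n "tau_weight j" "- tau_weight l", simplified] power_mult_distrib)
  qed
  then show ?thesis
    by (simp add: N_mat_def matrix_matrix_mult_def sum_distrib_left sum_distrib_right scaleC_sum_right)
qed

text \<open>
  The element \<open>\<rho>\<^sup>2\<close> is the sum of two diagonal entries of \<open>N\<close>, and passing a diagonal entry costs
  no phase.
\<close>
lemma charged_commute_rho:
  assumes "charged (n, 0) x"
  shows "x * rho_sq = rho_sq * x" "x * rho_inv2 = rho_inv2 * x"
proof -
  show *: "x * rho_sq = rho_sq * x"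
    by (simp add: rho_sq_eq distrib_left distrib_right charged_past_N[OF assms] scaleC_one)
  show "x * rho_inv2 = rho_inv2 * x"
    by (rule commute_inverse[OF * rho_inverse(2,1)])
qed

text \<open>
  This allows a right factor \<open>P\<^sub>j\<^sub>l\<close> to be brought to the left of a form, where
  \<open>id \<otimes> *\<close> is linear.
\<close>
lemma charged_past_P:
  assumes "charged (n, 0) x"
  shows "x * P_mat $ j $ l = (bichar \<theta> n (tau_weight j - tau_weight l))\<^sup>2 *\<^sub>C (P_mat $ j $ l * x)"
proof -
  let ?c = "(bichar \<theta> n (tau_weight j - tau_weight l))\<^sup>2"
  have "x * (rho_inv2 * N_mat $ j $ l) = ?c *\<^sub>C (rho_inv2 * N_mat $ j $ l * x)"
    by (simp add: mult.assoc[symmetric] charged_commute_rho[OF assms])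
      (simp add: mult.assoc charged_past_N[OF assms] scaleC_mult_right)
  moreover have "x * (mat 1 :: 'e^4^4) $ j $ l = ?c *\<^sub>C ((mat 1 :: 'e^4^4) $ j $ l * x)"
    by (simp add: mat_def scaleC_one)
  ultimately show ?thesis
    by (simp add: P_mat_eq mat_mult_nth left_diff_distrib right_diff_distrib scaleC_diff_right)
qed

lemma charged_N: "matrix_charged outer outer N_mat"
  unfolding N_mat_eq
  by (rule matrix_charged_mult[OF charged_matrices(1)
        matrix_charged_mult[OF matrix_charged_mult[OF charged_matrices(2,3)] charged_matrices(4)]])

lemma charged_rho: "charged 0 rho_sq" "charged 0 rho_inv2"
proof -
  have "charged 0 (N_mat $ i $ i)" for i
    using charged_N unfolding matrix_charged_def by (metis diff_self)
  then show "charged 0 rho_sq" by (simp add: rho_sq_eq charged_add)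
  then show "charged 0 rho_inv2" by (rule charged_inverse[OF _ rho_inverse(2,1)])
qed

lemma charged_P: "matrix_charged outer outer P_mat"
  unfolding P_mat_eq by (intro matrix_charged_projection charged_N charged_rho)

lemma matrix_charged_commute_rho:
  fixes M :: "'e^'n^4"
  assumes "matrix_charged outer g M" "\<And>j. snd (g j) = 0"
  shows "commutes_entrywise rho_sq M" "commutes_entrywise rho_inv2 M"
proof -
  have "charged (tau_weight i - fst (g j), 0) (M $ i $ j)" for i j
  proof -
    have "outer i - g j = (tau_weight i - fst (g j), 0)"
      using assms(2)[of j] by (simp add: prod_eq_iff)
    then show ?thesis using assms(1) unfolding matrix_charged_def by metis
  qed
  then show "commutes_entrywise rho_sq M" "commutes_entrywise rho_inv2 M"
    unfolding commutes_entrywise_def using charged_commute_rho by metis+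
qed

text \<open>
  Invariant functions such as \<open>r\<^sup>2\<close> commute with all forms on the sphere and with \<open>X\<close>, \<open>Y\<close>, so
  with everything built from them, including the inverse of \<open>\<rho>\<^sup>2\<close>.
\<close>
lemma invariant_commute:
  assumes "hcomp 0 f = f"
  shows "commutes_entrywise (form_incl (function_form f)) X_mat"
    "commutes_entrywise (form_incl (function_form f)) Y_mat"
    "commutes_entrywise (form_incl (function_form f)) u_E"
    "commutes_entrywise (form_incl (function_form f)) u_star_E"
    "commutes_entrywise (form_incl (function_form f)) p_E"
    "commutes_entrywise (form_incl (function_form f)) P_mat"
    "form_incl (function_form f) * rho_sq = rho_sq * form_incl (function_form f)"
proof -
  let ?f = "form_incl (function_form f)"
  show X: "commutes_entrywise ?f X_mat"
    by (simp add: commutes_entrywise_def form_incl_X)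
  show Y: "commutes_entrywise ?f Y_mat"
    by (simp add: commutes_entrywise_def Y_mat_def form_incl_X scaleC_mult_left scaleC_mult_right)
  show u: "commutes_entrywise ?f u_E" "commutes_entrywise ?f u_star_E" "commutes_entrywise ?f p_E"
    by (simp_all add: commutes_entrywise_def u_E_def u_star_E_def p_E_def form_incl_central[OF assms])
  have "mat ?f ** N_mat = N_mat ** mat ?f"
    unfolding N_mat_eq by (simp add: matrix_mul_assoc[symmetric] mat_commute[OF X] mat_commute[OF Y] mat_commute[OF u(1)] mat_commute[OF u(2)])
  then have N: "?f * N_mat $ i $ j = N_mat $ i $ j * ?f" for i j
    by (metis mat_mult_nth)
  then show rho: "?f * rho_sq = rho_sq * ?f"
    by (simp add: rho_sq_eq distrib_left distrib_right)
  have "?f * rho_inv2 = rho_inv2 * ?f"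
    by (rule commute_inverse[OF rho rho_inverse(2,1)])
  then have "?f * (rho_inv2 * N_mat $ i $ j) = rho_inv2 * N_mat $ i $ j * ?f" for i j
    by (metis N mult.assoc)
  then show "commutes_entrywise ?f P_mat"
    by (simp add: commutes_entrywise_def P_mat_eq mat_mult_nth left_diff_distrib right_diff_distrib)
      (simp add: mat_def)
qed

end

section \<open>Curvature of the transformed instanton\<close>

context localised_calculus
begin

abbreviation fun_alg :: "'e set" where "fun_alg \<equiv> functions_over \<iota> (\<Delta>\<^sub>L r_inv2) (S4_alg \<theta>)"

lemma functions_one: "1 \<in> fun_alg"
    and functions_rho_inv2: "rho_inv2 \<in> fun_alg"
    and functions_base: "f \<in> S4_alg \<theta> \<Longrightarrow> \<iota> (a \<otimes>\<^sub>C function_form f) \<in> fun_alg"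
    and functions_add: "x \<in> fun_alg \<Longrightarrow> y \<in> fun_alg \<Longrightarrow> x + y \<in> fun_alg"
    and functions_scaleC: "x \<in> fun_alg \<Longrightarrow> c *\<^sub>C x \<in> fun_alg"
    and functions_mult: "x \<in> fun_alg \<Longrightarrow> y \<in> fun_alg \<Longrightarrow> x * y \<in> fun_alg"
  unfolding functions_over_def by (auto intro: gen_subalgebra.intros)

lemma functions_zero: "0 \<in> fun_alg"
  using functions_scaleC[OF functions_one, of 0] by simp

lemma functions_diff: "x \<in> fun_alg \<Longrightarrow> y \<in> fun_alg \<Longrightarrow> x - y \<in> fun_alg"
proof -
  assume "x \<in> fun_alg" "y \<in> fun_alg"
  then have "x + (- 1) *\<^sub>C y \<in> fun_alg" by (intro functions_add functions_scaleC)
  then show ?thesis by (simp add: scaleC_minus_left scaleC_one)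
qed

lemma functions_sum: "(\<And>x. x \<in> A \<Longrightarrow> f x \<in> fun_alg) \<Longrightarrow> sum f A \<in> fun_alg"
  by (induction A rule: infinite_finite_induct) (auto intro: functions_zero functions_add)

lemma functions_incl: "f \<in> S4_alg \<theta> \<Longrightarrow> form_incl (function_form f) \<in> fun_alg"
  unfolding form_incl_def by (rule functions_base)

lemma D_incl: "f \<in> S4_alg \<theta> \<Longrightarrow> D (form_incl (function_form f)) = form_incl (differential f)"
  unfolding form_incl_def by (rule D_\<iota>)

lemma D_zero [simp]: "D 0 = 0"
  and D_one [simp]: "D 1 = 0"
  using D_add[OF functions_zero functions_zero] D_mult[OF functions_one functions_one] by simp_all

lemma D_diff: "x \<in> fun_alg \<Longrightarrow> y \<in> fun_alg \<Longrightarrow> D (x - y) = D x - D y"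
  using D_add[of "x - y" y] by (simp add: functions_diff)

lemma D_sum: "(\<And>x. x \<in> A \<Longrightarrow> f x \<in> fun_alg) \<Longrightarrow> D (sum f A) = (\<Sum>x\<in>A. D (f x))"
  by (induction A rule: infinite_finite_induct) (auto simp: D_add functions_sum)

abbreviation function_matrix :: "'e^'n^'m \<Rightarrow> bool"
  where "function_matrix M \<equiv> \<forall>i j. M $ i $ j \<in> fun_alg"

lemma D_matrix_mult:
  assumes "function_matrix A" "function_matrix B"
  shows "map_matrix D (A ** B) = map_matrix D A ** B + A ** map_matrix D B"
  using assms by (simp add: vec_eq_iff matrix_matrix_mult_def map_matrix_def D_sum functions_mult D_mult sum.distrib)

lemma D_matrix_diff:
  assumes "function_matrix A" "function_matrix B"
  shows "map_matrix D (A - B) = map_matrix D A - map_matrix D B"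
  using assms by (simp add: vec_eq_iff map_matrix_def D_diff)

lemma D_mat: "map_matrix D (mat s) = mat (D s)"
  by (simp add: vec_eq_iff map_matrix_def mat_def)

lemma function_matrix_mat: "s \<in> fun_alg \<Longrightarrow> function_matrix (mat s)"
  by (simp add: mat_def functions_zero)

lemma function_matrix_mult: "function_matrix A \<Longrightarrow> function_matrix B \<Longrightarrow> function_matrix (A ** B)"
  by (simp add: matrix_matrix_mult_def functions_sum functions_mult)

lemma function_matrix_diff: "function_matrix A \<Longrightarrow> function_matrix B \<Longrightarrow> function_matrix (A - B)"
  by (simp add: functions_diff)

definition n_E :: "'e^4^4" where "n_E = u_E ** u_star_E"
definition dp_E :: "'e^4^4" where "dp_E = map_matrix D p_E"
definition DN_mat :: "'e^4^4" where "DN_mat = map_matrix D N_mat"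

lemma function_matrices: "function_matrix n_E" "function_matrix p_E" "function_matrix N_mat" "function_matrix P_mat"
proof -
  show "function_matrix n_E"
    by (simp add: n_E_def u_E_u_star_E_nth functions_incl S4_alg.uu_star)
  show "function_matrix p_E"
    by (simp add: p_E_def functions_incl basic_projection_in_S4)
  have N: "N_mat = X_mat ** (n_E ** Y_mat)" by (simp add: N_mat_eq n_E_def)
  have "X_mat $ i $ \<beta> * (n_E $ \<beta> $ \<gamma> * Y_mat $ \<gamma> $ j) \<in> fun_alg" for i j \<beta> \<gamma>
  proof -
    obtain a where "\<forall>\<omega>. X_mat $ i $ \<beta> * (form_incl \<omega> * Y_mat $ \<gamma> $ j) = \<iota> (a \<otimes>\<^sub>C \<omega>)"
      using X_form_Y_in_range by blast
    then show ?thesis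
      by (simp add: n_E_def u_E_u_star_E_nth functions_base[OF S4_alg.uu_star])
  qed
  then show *: "function_matrix N_mat"
    by (simp add: N matrix_matrix_mult_def sum_distrib_left functions_sum)
  show "function_matrix P_mat"
    unfolding P_mat_eq
    by (intro function_matrix_diff function_matrix_mult function_matrix_mat functions_one functions_rho_inv2 *)
qed

lemma dp_E_nth: "dp_E $ i $ j = form_incl (differential (basic_projection \<theta> $ i $ j))"
  by (simp add: dp_E_def map_matrix_def p_E_def D_incl basic_projection_in_S4)

text \<open>
  The calculus is that of spheres of fixed radius.
\<close>
lemma D_r_sq_E: "D r_sq_E = 0"
  by (simp add: D_incl S4_alg.r_sq differential_r_sq)

lemma n_E_eq: "n_E = mat r_sq_E - mat r_sq_E ** p_E"
  by (simp add: p_E_eq n_E_def[symmetric] matrix_mult_diff matrix_mul_assoc mat_mult_mat r_inverse_E)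

text \<open>
  \<open>id \<otimes> d\<close> acts on the middle factor of \<open>N = X (u u\<^sup>*) Y\<close> only, and
  \<open>u u\<^sup>* = r\<^sup>2 (1 - p)\<close> with \<open>d r\<^sup>2 = 0\<close>.
\<close>
lemma DN_mat_eq: "DN_mat = mat r_sq_E ** (X_mat ** ((- dp_E) ** Y_mat))"
proof -
  have Dn: "map_matrix D n_E = mat r_sq_E ** (- dp_E)"
    unfolding n_E_eq
    by (subst D_matrix_diff)
      (simp_all add: D_matrix_mult D_mat D_r_sq_E function_matrix_mat functions_incl S4_alg.r_sq function_matrices(2)
        dp_E_def matrix_mult_zero matrix_uminus_mult function_matrix_mult)
  have "D (X_mat $ i $ \<beta> * (n_E $ \<beta> $ \<gamma> * Y_mat $ \<gamma> $ j)) = X_mat $ i $ \<beta> * (D (n_E $ \<beta> $ \<gamma>) * Y_mat $ \<gamma> $ j)"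
    "X_mat $ i $ \<beta> * (n_E $ \<beta> $ \<gamma> * Y_mat $ \<gamma> $ j) \<in> fun_alg" for i j \<beta> \<gamma>
  proof -
    obtain a where "\<forall>\<omega>. X_mat $ i $ \<beta> * (form_incl \<omega> * Y_mat $ \<gamma> $ j) = \<iota> (a \<otimes>\<^sub>C \<omega>)"
      using X_form_Y_in_range by blast
    then show "D (X_mat $ i $ \<beta> * (n_E $ \<beta> $ \<gamma> * Y_mat $ \<gamma> $ j)) = X_mat $ i $ \<beta> * (D (n_E $ \<beta> $ \<gamma>) * Y_mat $ \<gamma> $ j)"
      "X_mat $ i $ \<beta> * (n_E $ \<beta> $ \<gamma> * Y_mat $ \<gamma> $ j) \<in> fun_alg"
      by (simp_all add: n_E_def u_E_u_star_E_nth D_incl[OF S4_alg.uu_star] D_\<iota>[OF S4_alg.uu_star] functions_base[OF S4_alg.uu_star])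
  qed
  note summand = this
  have "DN_mat $ i $ j = (X_mat ** (map_matrix D n_E ** Y_mat)) $ i $ j" for i j
  proof -
    have "N_mat $ i $ j = (\<Sum>\<beta>\<in>UNIV. \<Sum>\<gamma>\<in>UNIV. X_mat $ i $ \<beta> * (n_E $ \<beta> $ \<gamma> * Y_mat $ \<gamma> $ j))"
      unfolding N_mat_eq n_E_def[symmetric] by (simp add: matrix_matrix_mult_def sum_distrib_left)
    then have "D (N_mat $ i $ j) = (\<Sum>\<beta>\<in>UNIV. \<Sum>\<gamma>\<in>UNIV. X_mat $ i $ \<beta> * (D (n_E $ \<beta> $ \<gamma>) * Y_mat $ \<gamma> $ j))"
      by (simp add: D_sum functions_sum summand)
    then show ?thesis
      by (simp add: DN_mat_def map_matrix_def matrix_matrix_mult_def[where ?'a = 'e] sum_distrib_left)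
  qed
  then have "DN_mat = X_mat ** (map_matrix D n_E ** Y_mat)"
    by (simp add: vec_eq_iff)
  then show ?thesis
    unfolding Dn using mat_commute(2)[OF invariant_commute(1)[OF hcomp_r_sq]]
    by (simp add: matrix_mul_assoc[symmetric])
qed

lemma charged_dp: "matrix_charged inner inner dp_E"
  by (simp add: matrix_charged_def dp_E_nth charged_form_incl hcomp_differential[OF hcomp_basic_projection])

lemma charged_p: "matrix_charged inner inner p_E"
  by (simp add: matrix_charged_def p_E_def charged_form_incl hcomp_zero_form hcomp_basic_projection)

lemma matrix_charged_uminus: "matrix_charged f g M \<Longrightarrow> matrix_charged f g (- M)"
  using charged_scaleC[of _ _ "- 1"] by (auto simp: matrix_charged_def scaleC_minus_left scaleC_one)

lemma charged_DN: "matrix_charged outer outer DN_mat"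
proof -
  have R: "matrix_charged outer outer (mat r_sq_E)"
    using charged_form_incl[of 0 "function_form r_sq"]
    by (auto simp: matrix_charged_def mat_def hcomp_zero_form hcomp_r_sq charged_zero zero_prod_def[symmetric])
  show ?thesis
    unfolding DN_mat_eq
    by (rule matrix_charged_mult[OF R matrix_charged_mult[OF charged_matrices(1)
            matrix_charged_mult[OF matrix_charged_uminus[OF charged_dp] charged_matrices(4)]]])
qed

lemma rho_sq_function: "rho_sq \<in> fun_alg"
  unfolding rho_sq_eq using function_matrices(3) by (simp add: functions_add)

text \<open>
  Differentiating \<open>\<rho>\<^sup>-\<^sup>2 \<rho>\<^sup>2 = 1\<close> expresses \<open>D \<rho>\<^sup>-\<^sup>2\<close> through \<open>D \<rho>\<^sup>2\<close>, a sum of diagonal entries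
  of \<open>DN\<close>.  Although \<open>\<rho>\<^sup>2\<close> is not constant, its derivative thus commutes with \<open>N\<close>.
\<close>
lemma charged_D_rho_inv2: "charged 0 (D rho_inv2)"
proof -
  have "D rho_sq = DN_mat $ 1 $ 1 + DN_mat $ 3 $ 3"
    using function_matrices(3) by (simp add: rho_sq_eq D_add DN_mat_def map_matrix_def)
  moreover have "charged 0 (DN_mat $ i $ i)" for i
    using charged_DN unfolding matrix_charged_def by (metis diff_self)
  ultimately have *: "charged 0 (D rho_sq)" by (simp add: charged_add)
  have "D rho_inv2 * rho_sq + rho_inv2 * D rho_sq = 0"
    using D_mult[OF functions_rho_inv2 rho_sq_function] by (simp add: rho_inverse)
  then have "(D rho_inv2 * rho_sq + rho_inv2 * D rho_sq) * rho_inv2 = 0" by simp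
  then have "D rho_inv2 * (rho_sq * rho_inv2) + rho_inv2 * D rho_sq * rho_inv2 = 0"
    by (simp only: distrib_right mult.assoc)
  then have "D rho_inv2 = (- 1) *\<^sub>C (rho_inv2 * D rho_sq * rho_inv2)"
    by (simp add: rho_inverse scaleC_minus_left scaleC_one eq_neg_iff_add_eq_0)
  also have "charged 0 \<dots>"
    using charged_mult[OF charged_mult[OF charged_rho(2) *] charged_rho(2)] by (simp add: charged_scaleC)
  finally show ?thesis .
qed

lemma charged_U: "matrix_charged outer neutral U_mat"
  unfolding U_mat_eq by (rule matrix_charged_mult[OF charged_matrices(1,2)])

lemma rho_inv2_commute_U: "commutes_entrywise rho_inv2 U_mat" "commutes_entrywise rho_inv2 U_star"
proof -
  show "commutes_entrywise rho_inv2 U_mat"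
    using matrix_charged_commute_rho(2)[OF charged_U] by simp
  then show "commutes_entrywise rho_inv2 U_star"
    by (simp add: commutes_entrywise_def U_star_nth scaleC_mult_left scaleC_mult_right)
qed

lemmas p_E_relations = isometry_projection[OF p_E_eq u_star_u_E r_inverse_E
  invariant_commute(3)[OF hcomp_r_inv2] invariant_commute(4)[OF hcomp_r_inv2]]

lemmas P_mat_relations = isometry_projection[OF P_mat_eq[unfolded N_mat_def] U_star_U rho_inverse rho_inv2_commute_U]

definition curvature_E :: "'e^4^4"
  where "curvature_E = (\<chi> i k. form_incl (basic_curvature \<theta> $ i $ k))"

lemma curvature_E_eq: "curvature_E = p_E ** (dp_E ** dp_E)"
  by (simp add: vec_eq_iff curvature_E_def basic_curvature_def matrix_matrix_mult_def form_incl_sum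
      form_incl_mult[symmetric] sum_distrib_left dp_E_nth) (simp add: p_E_def)

lemma grassmann_curvature_numerator:
  "grassmann_curvature D P_mat = mat (rho_inv2 * rho_inv2) ** (P_mat ** (DN_mat ** (DN_mat ** P_mat)))"
  unfolding grassmann_curvature_def
proof (rule curvature_by_numerator[where N = N_mat and S = rho_sq and DS' = "D rho_inv2"])
  show "P_mat = mat 1 - mat rho_inv2 ** N_mat" by (rule P_mat_eq)
  have "N_mat ** N_mat = U_mat ** ((U_star ** U_mat) ** U_star)"
    by (simp add: N_mat_def matrix_mul_assoc)
  also have "\<dots> = mat rho_sq ** N_mat"
    using mat_commute(2)[OF matrix_charged_commute_rho(1)[OF charged_U]] by (simp add: U_star_U N_mat_def)
  finally show "N_mat ** N_mat = mat rho_sq ** N_mat" .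
  show "rho_inv2 * rho_sq = 1" by (rule rho_inverse)
  show "commutes_entrywise rho_inv2 N_mat"
    by (rule matrix_charged_commute_rho(2)[OF charged_N]) simp
  show "commutes_entrywise rho_inv2 DN_mat"
    by (rule matrix_charged_commute_rho(2)[OF charged_DN]) simp
  show "commutes_entrywise (D rho_inv2) N_mat"
    using charged_past_N[of 0 "D rho_inv2"] charged_D_rho_inv2
    by (simp add: commutes_entrywise_def scaleC_one zero_prod_def[symmetric])
  show "map_matrix D P_mat = - (mat (D rho_inv2) ** N_mat + mat rho_inv2 ** DN_mat)"
    unfolding P_mat_eq
    by (subst D_matrix_diff)
      (simp_all add: D_matrix_mult D_mat function_matrix_mat functions_one functions_rho_inv2 function_matrices(3)
        function_matrix_mult DN_mat_def)
  show "map_matrix D P_mat = map_matrix D P_mat ** P_mat + P_mat ** map_matrix D P_mat"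
    using D_matrix_mult[OF function_matrices(4) function_matrices(4)] by (simp add: P_mat_relations)
qed

text \<open>
  The transformed curvature is the basic curvature conjugated by the transformation:
  \<open>\<rho>\<^sup>-\<^sup>2 r\<^sup>2 P X (p dp dp) Y P\<close>.
\<close>
lemma grassmann_curvature_transformed:
  "grassmann_curvature D P_mat = mat (rho_inv2 * r_sq_E) ** (P_mat ** ((X_mat ** (curvature_E ** Y_mat)) ** P_mat))"
proof -
  note R = invariant_commute[OF hcomp_r_sq] and R' = invariant_commute[OF hcomp_r_inv2]
  have form_commute: "commutes_entrywise (form_incl (function_form f)) (- dp_E)" if "hcomp 0 f = f" for f
    using form_incl_central[OF that] by (simp add: commutes_entrywise_def dp_E_nth)
  have "P_mat ** (DN_mat ** (DN_mat ** P_mat)) = mat (r_sq_E * rho_sq) **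
      (P_mat ** ((X_mat ** ((p_E ** ((- dp_E) ** (- dp_E))) ** Y_mat)) ** P_mat))"
  proof (rule numerator_by_fibre[where u = u_E and v = u_star_E and R' = r_inv2_E])
    show "p_E = mat 1 - mat r_inv2_E ** (u_E ** u_star_E)" by (rule p_E_eq)
    have "dp_E = dp_E ** p_E + p_E ** dp_E"
      using D_matrix_mult[OF function_matrices(2) function_matrices(2)] by (simp add: p_E_relations dp_E_def)
    then have "- dp_E = - (dp_E ** p_E + p_E ** dp_E)" by (rule arg_cong)
    then show "- dp_E = (- dp_E) ** p_E + p_E ** (- dp_E)"
      unfolding matrix_uminus_mult minus_add_distrib .
    show "p_E ** u_E = 0" "u_star_E ** p_E = 0" by (rule p_E_relations)+
    show "r_sq_E * r_inv2_E = 1" by (rule r_inverse_E)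
    show "DN_mat = mat r_sq_E ** (X_mat ** ((- dp_E) ** Y_mat))" by (rule DN_mat_eq)
    show "P_mat ** (X_mat ** u_E) = 0" using P_mat_relations(1) by (simp add: U_mat_eq)
    show "u_star_E ** (Y_mat ** P_mat) = 0" using P_mat_relations(2) by (simp add: U_star_eq matrix_mul_assoc)
    show "u_star_E ** (Y_mat ** (X_mat ** u_E)) = mat rho_sq"
      using U_star_U by (simp add: U_star_eq U_mat_eq matrix_mul_assoc)
    show "commutes_entrywise rho_sq P_mat"
      by (rule matrix_charged_commute_rho(1)[OF charged_P]) simp
    show "commutes_entrywise rho_sq (X_mat ** (p_E ** ((- dp_E) ** u_E)))"
      by (rule matrix_charged_commute_rho[OF matrix_charged_mult[OF charged_matrices(1)
            matrix_charged_mult[OF charged_p matrix_charged_mult[OF matrix_charged_uminus[OF charged_dp] charged_matrices(2)]]]])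
        simp
    show "r_sq_E * rho_sq = rho_sq * r_sq_E" by (rule R)
  qed (rule R R' form_commute hcomp_r_sq hcomp_r_inv2)+
  moreover have "rho_inv2 * rho_inv2 * (r_sq_E * rho_sq) = rho_inv2 * r_sq_E"
  proof -
    have "rho_inv2 * rho_inv2 * (r_sq_E * rho_sq) = rho_inv2 * (rho_inv2 * rho_sq) * r_sq_E"
      by (simp only: R(7) mult.assoc)
    then show ?thesis by (simp add: rho_inverse)
  qed
  ultimately show ?thesis
    by (simp add: grassmann_curvature_numerator curvature_E_eq matrix_uminus_mult) (simp add: matrix_mul_assoc mat_mult_mat)
qed

section \<open>Anti-self-duality\<close>

abbreviation form_module :: "'e set"
  where "form_module \<equiv> two_forms_over \<iota> rho_inv2 (S4_alg \<theta>) S4_two_forms"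

lemma hodge'_zero: "hodge' 0 = 0"
  using hodge'_add[OF two_forms_over.zero two_forms_over.zero] by simp

lemma form_module_sum: "(\<And>x. x \<in> A \<Longrightarrow> f x \<in> form_module) \<Longrightarrow> sum f A \<in> form_module"
  by (induction A rule: infinite_finite_induct) (auto intro: two_forms_over.zero two_forms_over.add)

lemma hodge'_sum: "(\<And>x. x \<in> A \<Longrightarrow> f x \<in> form_module) \<Longrightarrow> hodge' (sum f A) = (\<Sum>x\<in>A. hodge' (f x))"
  by (induction A rule: infinite_finite_induct) (auto simp: hodge'_zero hodge'_add form_module_sum)

text \<open>
  The right factor \<open>P\<close> is moved to the left at the cost of a phase, and \<open>X\<close>, \<open>Y\<close> are merged;
  what remains is a combination of the entries of the basic curvature with functions as left
  coefficients.
\<close>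
lemma curvature_entry:
  "\<exists>(b :: 4 \<Rightarrow> 4 \<Rightarrow> 'e) a. (\<forall>j l. b j l \<in> fun_alg) \<and>
    grassmann_curvature D P_mat $ i $ k = (\<Sum>j\<in>UNIV. \<Sum>l\<in>UNIV. \<Sum>\<beta>\<in>UNIV. \<Sum>\<gamma>\<in>UNIV.
      b j l * \<iota> (a j l \<beta> \<gamma> \<otimes>\<^sub>C basic_curvature \<theta> $ \<beta> $ \<gamma>))"
proof -
  define W where "W = X_mat ** (curvature_E ** Y_mat)"
  define s where "s = rho_inv2 * r_sq_E"
  define b where "b = (\<lambda>j l. (bichar \<theta> (tau_weight j - tau_weight l) (tau_weight l - tau_weight k))\<^sup>2 *\<^sub>C
    (s * P_mat $ i $ j * P_mat $ l $ k))"
  define a where "a = (\<lambda>j l \<beta> \<gamma>. SOME c. \<forall>\<omega>.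
    X_mat $ j $ \<beta> * (form_incl \<omega> * Y_mat $ \<gamma> $ l) = \<iota> (c \<otimes>\<^sub>C \<omega>))"
  have a: "X_mat $ j $ \<beta> * (form_incl \<omega> * Y_mat $ \<gamma> $ l) = \<iota> (a j l \<beta> \<gamma> \<otimes>\<^sub>C \<omega>)" for j l \<beta> \<gamma> \<omega>
    using someI_ex[OF X_form_Y_in_range[of j \<beta> \<gamma> l]] unfolding a_def by blast
  have K: "matrix_charged inner inner curvature_E"
    unfolding curvature_E_eq by (rule matrix_charged_mult[OF charged_p matrix_charged_mult[OF charged_dp charged_dp]])
  have "matrix_charged outer outer W"
    unfolding W_def
    by (rule matrix_charged_mult[OF charged_matrices(1) matrix_charged_mult[OF K charged_matrices(4)]])
  then have W: "charged (tau_weight j - tau_weight l, 0) (W $ j $ l)" for j l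
    by (simp add: matrix_charged_def)
  have "grassmann_curvature D P_mat $ i $ k = s * (\<Sum>j\<in>UNIV. P_mat $ i $ j * (\<Sum>l\<in>UNIV. W $ j $ l * P_mat $ l $ k))"
    unfolding grassmann_curvature_transformed W_def[symmetric] s_def[symmetric] mat_mult_nth
    by (simp add: matrix_matrix_mult_def)
  also have "\<dots> = (\<Sum>j\<in>UNIV. \<Sum>l\<in>UNIV. b j l * W $ j $ l)"
    by (simp add: sum_distrib_left b_def charged_past_P[OF W] scaleC_mult_left scaleC_mult_right mult.assoc)
  also have "\<dots> = (\<Sum>j\<in>UNIV. \<Sum>l\<in>UNIV. \<Sum>\<beta>\<in>UNIV. \<Sum>\<gamma>\<in>UNIV.
      b j l * \<iota> (a j l \<beta> \<gamma> \<otimes>\<^sub>C basic_curvature \<theta> $ \<beta> $ \<gamma>))"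
    by (simp add: W_def curvature_E_def matrix_matrix_mult_def sum_distrib_left a)
  finally have F: "grassmann_curvature D P_mat $ i $ k = \<dots>" .
  have "s \<in> fun_alg"
    unfolding s_def by (intro functions_mult functions_rho_inv2 functions_incl S4_alg.r_sq)
  then have "b j l \<in> fun_alg" for j l
    unfolding b_def using function_matrices(4) by (intro functions_scaleC functions_mult) auto
  then show ?thesis using F by blast
qed

lemma transformed_curvature_anti_self_dual:
  assumes "map_matrix hodge (basic_curvature \<theta>) = - basic_curvature \<theta>"
  shows "map_matrix hodge' (grassmann_curvature D P_mat) = - grassmann_curvature D P_mat"
proof -
  have hodge: "hodge (basic_curvature \<theta> $ \<beta> $ \<gamma>) = - basic_curvature \<theta> $ \<beta> $ \<gamma>" for \<beta> \<gamma>
    using assms by (simp add: vec_eq_iff map_matrix_def)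
  have "hodge' (grassmann_curvature D P_mat $ i $ k) = - grassmann_curvature D P_mat $ i $ k" for i k
  proof -
    obtain b a where ba: "(\<forall>j l. b j l \<in> fun_alg) \<and>
      grassmann_curvature D P_mat $ i $ k = (\<Sum>j\<in>UNIV. \<Sum>l\<in>UNIV. \<Sum>\<beta>\<in>UNIV. \<Sum>\<gamma>\<in>UNIV.
        b (j :: 4) (l :: 4) * \<iota> (a j l \<beta> \<gamma> \<otimes>\<^sub>C basic_curvature \<theta> $ \<beta> $ \<gamma>))"
      using curvature_entry[of i k] by (elim exE)
    then have b: "b j l \<in> fun_alg" for j l by blast
    note F = ba[THEN conjunct2]
    have mem: "b j l * \<iota> (a j l \<beta> \<gamma> \<otimes>\<^sub>C basic_curvature \<theta> $ \<beta> $ \<gamma>) \<in> form_module" for j l \<beta> \<gamma>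
      by (intro two_forms_over.gen b basic_curvature_two_form)
    have "\<iota> (a' \<otimes>\<^sub>C - \<omega>) = - \<iota> (a' \<otimes>\<^sub>C \<omega>)" for a' and \<omega> :: forms
      using pure_tensor_scaleC_right[of a' "- 1" \<omega>] \<iota>_scaleC[of "- 1"]
      by (simp add: scaleC_minus_left scaleC_one)
    then have "hodge' (b j l * \<iota> (a j l \<beta> \<gamma> \<otimes>\<^sub>C basic_curvature \<theta> $ \<beta> $ \<gamma>))
        = - (b j l * \<iota> (a j l \<beta> \<gamma> \<otimes>\<^sub>C basic_curvature \<theta> $ \<beta> $ \<gamma>))" for j l \<beta> \<gamma>
      by (simp add: hodge'_\<iota>[OF b basic_curvature_two_form] hodge)
    then show ?thesis
      unfolding F by (simp add: hodge'_sum form_module_sum mem sum_negf)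
  qed
  then show ?thesis by (simp add: vec_eq_iff map_matrix_def)
qed

end

theorem proposition6p10:
  fixes \<theta> :: real
    and hodge :: "forms \<Rightarrow> forms"
    and \<iota> :: "(cobos, forms) tensor \<Rightarrow> 'e::complex_algebra_1"
    and invol D hodge' :: "'e \<Rightarrow> 'e"
    and \<Delta>\<^sub>L :: "sphere_alg \<Rightarrow> 'e"
  assumes "round_hodge \<theta> hodge"
    and "localised_calculus \<theta> \<iota> invol \<Delta>\<^sub>L hodge D hodge'"
  shows "map_matrix hodge' (grassmann_curvature D (map_matrix \<Delta>\<^sub>L (basic_projection \<theta>)))
    = - grassmann_curvature D (map_matrix \<Delta>\<^sub>L (basic_projection \<theta>))"
proof -
  interpret localised_calculus \<theta> \<iota> invol \<Delta>\<^sub>L hodge D hodge' by (rule assms(2))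
  show ?thesis
    using transformed_curvature_anti_self_dual assms(1) unfolding P_mat_def round_hodge_def by blast
qed

end
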